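(* Let $F$ be a dynamic forest of maximum degree at most $\Delta\ge 3$ that is properly edge colored with $\Delta$ colors. When a new edge $e$ is inserted (joining two distinct trees, with the maximum degree remaining at most $\Delta$), the coloring of $F$ can be extended to a proper $\Delta$-edge-coloring of $F\cup\{e\}$ by recoloring at most $O\!\left(\frac{1}{\Delta-2}\cdot\sqrt{\lg N}\cdot 2^{\sqrt{2\lg N}}\right)$ existing edges, where $N$ is the number of edges in the smaller of the two trees that $e$ links. Such an extension can be computed in $O(N)$ time.
   Context: $\lg$ denotes the logarithm in base $2$. Recourse counts edges of $F$ (excluding $e$) whose color changes. *)

theory Defs
  imports Complex_Main
begin

section \<open>Finite simple graphs, forests and edge colourings\<close>

definition simple_graph :: "'a set \<Rightarrow> 'a set set \<Rightarrow> bool" where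
  "simple_graph V E \<longleftrightarrow> finite V \<and> (\<forall>f\<in>E. \<exists>x\<in>V. \<exists>y\<in>V. x \<noteq> y \<and> f = {x, y})"

definition is_cycle :: "'a set set \<Rightarrow> 'a list \<Rightarrow> bool" where
  "is_cycle E xs \<longleftrightarrow> 3 \<le> length xs \<and> distinct xs \<and>
     (\<forall>i<length xs. {xs ! i, xs ! (Suc i mod length xs)} \<in> E)"

definition forest :: "'a set \<Rightarrow> 'a set set \<Rightarrow> bool" where
  "forest V E \<longleftrightarrow> simple_graph V E \<and> (\<nexists>xs. is_cycle E xs)"

definition degree :: "'a set set \<Rightarrow> 'a \<Rightarrow> nat" where
  "degree E x = card {f \<in> E. x \<in> f}"

definition max_degree_le :: "'a set \<Rightarrow> 'a set set \<Rightarrow> nat \<Rightarrow> bool" where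
  "max_degree_le V E d \<longleftrightarrow> (\<forall>x\<in>V. degree E x \<le> d)"

definition component :: "'a set set \<Rightarrow> 'a \<Rightarrow> 'a set" where
  "component E x = {y. (x, y) \<in> {(a, b). {a, b} \<in> E}\<^sup>*}"

definition tree_edges :: "'a set set \<Rightarrow> 'a \<Rightarrow> 'a set set" where
  "tree_edges E x = {f \<in> E. f \<subseteq> component E x}"

definition smaller_size :: "'a set set \<Rightarrow> 'a \<Rightarrow> 'a \<Rightarrow> nat" where
  "smaller_size E u v = min (card (tree_edges E u)) (card (tree_edges E v))"

text \<open>The colours are the numbers below \<open>d\<close>; values of \<open>col\<close> outside \<open>E\<close> are irrelevant.\<close>

definition proper_coloring :: "nat \<Rightarrow> 'a set set \<Rightarrow> ('a set \<Rightarrow> nat) \<Rightarrow> bool" where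
  "proper_coloring d E col \<longleftrightarrow> (\<forall>f\<in>E. col f < d) \<and>
     (\<forall>f\<in>E. \<forall>g\<in>E. f \<noteq> g \<and> f \<inter> g \<noteq> {} \<longrightarrow> col f \<noteq> col g)"

definition recourse :: "'a set set \<Rightarrow> ('a set \<Rightarrow> nat) \<Rightarrow> ('a set \<Rightarrow> nat) \<Rightarrow> nat" where
  "recourse E col col' = card {f \<in> E. col' f \<noteq> col f}"

definition link_instance ::
    "nat \<Rightarrow> 'a set \<Rightarrow> 'a set set \<Rightarrow> ('a set \<Rightarrow> nat) \<Rightarrow> 'a \<Rightarrow> 'a \<Rightarrow> bool" where
  "link_instance d V E col u v \<longleftrightarrow>
     forest V E \<and> max_degree_le V E d \<and> proper_coloring d E col \<and>
     u \<in> V \<and> v \<in> V \<and> v \<notin> component E u \<and> max_degree_le V (insert {u, v} E) d"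


section \<open>A unit-cost random access machine\<close>

text \<open>
  Programs are deeply embedded structured programs over natural-number registers and
  arrays, with addition and truncated subtraction as the only arithmetic.
  A skip, an assignment or the evaluation of a test takes one time unit. Since the
  expressions of a fixed program have bounded size, charging for every operation inside
  an expression would only change running times by a constant factor.
\<close>

datatype expr =
    Const nat
  | Reg string
  | Arr string expr
  | Plus expr expr
  | Minus expr expr

datatype test = Less expr expr

datatype com =
    Skip
  | SetReg string expr
  | SetArr string expr expr
  | Seq com com
  | If test com com
  | While test com

record ram =
  reg :: "string \<Rightarrow> nat"
  arr :: "string \<Rightarrow> nat \<Rightarrow> nat"

fun eval_expr :: "expr \<Rightarrow> ram \<Rightarrow> nat" where
  "eval_expr (Const n) s = n"
| "eval_expr (Reg r) s = reg s r"
| "eval_expr (Arr a e) s = arr s a (eval_expr e s)"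
| "eval_expr (Plus e e') s = eval_expr e s + eval_expr e' s"
| "eval_expr (Minus e e') s = eval_expr e s - eval_expr e' s"

fun eval_test :: "test \<Rightarrow> ram \<Rightarrow> bool" where
  "eval_test (Less e e') s \<longleftrightarrow> eval_expr e s < eval_expr e' s"

text \<open>\<open>runs c s t s'\<close>: started in \<open>s\<close>, the program \<open>c\<close> halts in \<open>s'\<close> after exactly \<open>t\<close> time
  units. The relation is deterministic, so it entails termination.\<close>

inductive runs :: "com \<Rightarrow> ram \<Rightarrow> nat \<Rightarrow> ram \<Rightarrow> bool" where
  runs_Skip: "runs Skip s 1 s"
| runs_SetReg: "runs (SetReg r e) s 1 (s\<lparr>reg := (reg s)(r := eval_expr e s)\<rparr>)"
| runs_SetArr: "runs (SetArr a i e) s 1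
     (s\<lparr>arr := (arr s)(a := (arr s a)(eval_expr i s := eval_expr e s))\<rparr>)"
| runs_Seq: "runs c1 s t1 s' \<Longrightarrow> runs c2 s' t2 s'' \<Longrightarrow> runs (Seq c1 c2) s (t1 + t2) s''"
| runs_IfTrue: "eval_test b s \<Longrightarrow> runs c1 s t s' \<Longrightarrow> runs (If b c1 c2) s (Suc t) s'"
| runs_IfFalse: "\<not> eval_test b s \<Longrightarrow> runs c2 s t s' \<Longrightarrow> runs (If b c1 c2) s (Suc t) s'"
| runs_WhileFalse: "\<not> eval_test b s \<Longrightarrow> runs (While b c) s 1 s"
| runs_WhileTrue: "eval_test b s \<Longrightarrow> runs c s t1 s' \<Longrightarrow> runs (While b c) s' t2 s'' \<Longrightarrow>
     runs (While b c) s (Suc (t1 + t2)) s''"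


section \<open>Storing a coloured forest in memory\<close>

text \<open>
  Adjacency lists plus a colour-indexed neighbour table. The block of a vertex \<open>x\<close> starts at
  offset \<open>row[x] = x * d\<close>. Within the block, \<open>cols\<close> lists all \<open>d\<close> colours without repetition,
  first the \<open>deg[x]\<close> colours used at \<open>x\<close> and then the free ones; \<open>pos\<close> is the inverse
  of that enumeration (being a right inverse on a finite set suffices); \<open>nbr\<close> gives,
  for a used colour, the neighbour reached through the edge of that colour.
  All other memory cells may hold arbitrary values.
\<close>

definition represents ::
    "nat \<Rightarrow> nat set \<Rightarrow> nat set set \<Rightarrow> (nat set \<Rightarrow> nat) \<Rightarrow> ram \<Rightarrow> bool" where
  "represents d V E col s \<longleftrightarrow> (\<forall>x\<in>V.
     arr s ''row'' x = x * d \<and>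
     arr s ''deg'' x = degree E x \<and>
     (\<forall>c<d. arr s ''pos'' (x * d + c) < d \<and>
            arr s ''cols'' (x * d + arr s ''pos'' (x * d + c)) = c \<and>
            (arr s ''pos'' (x * d + c) < degree E x \<longleftrightarrow> (\<exists>y. {x, y} \<in> E \<and> col {x, y} = c))) \<and>
     (\<forall>y. {x, y} \<in> E \<longrightarrow> arr s ''nbr'' (x * d + col {x, y}) = y))"

end

theory Submission
  imports Defs
begin

text \<open>
  Colour the new edge, as seen from each of its ends, with a colour that is free there, and repair
  the disagreement inside the smaller tree. If the parent edge of \<open>w\<close> has colour \<open>p\<close> in the view of
  \<open>w\<close> and \<open>q\<close> in the view of its parent, then swapping \<open>p\<close> and \<open>q\<close> in the view of \<open>w\<close> moves the
  disagreement to the child edge \<open>wx\<close> of colour \<open>q\<close>: this is one step along a Kempe chain. Passing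
  through a third colour \<open>c\<close> instead splits the disagreement between the branches that start with
  colour \<open>c\<close> at \<open>w\<close> and at \<open>x\<close>. These branches are disjoint for distinct \<open>c\<close>. Hence, if for each of
  the \<open>\<Delta> - 2\<close> colours one of the two has more than \<open>\<tau>\<close> vertices, then two steps along the chain cut
  the current subtree down by \<open>(\<Delta> - 2) (\<tau> + 1)\<close>. With thresholds that grow like
  \<open>\<tau> (k + 1) = 2^(k + 1) (\<Delta> - 2) \<tau> k\<close>, a chain of level \<open>k + 1\<close> is left, for two of level \<open>k\<close>, after
  \<open>2^(k + 1)\<close> double steps. So level \<open>k\<close> costs \<open>O(k 2^k)\<close>, and \<open>N\<close> edges need
  only a level with \<open>2^(k (k + 1) / 2) (\<Delta> - 2)^k\<close> about \<open>N\<close>.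

  The time is linear because a colour \<open>c\<close> is rejected only on account of a nonempty branch, which
  is then never entered; two interleaved searches find the smaller tree.
\<close>

section \<open>Execution of programs\<close>

text \<open>The factor \<open>2^(k + 1)\<close> in the thresholds is a balance: with a chain of that
  length the cost obeys \<open>C (k + 1) = 2 C k + O(2^(k + 1))\<close>, so all levels of the
  recursion contribute equally. The logarithm of the threshold is about
  \<open>k (k + 1) / 2 + k lam\<close> with \<open>lam = lg (\<Delta> - 2)\<close>. Completing the
  square gives \<open>(k + lam)^2 / 2\<close>, hence \<open>k\<close> is about
  \<open>sqrt (2 lg N) - lam\<close>, and it is this shift by \<open>lam\<close> that becomes the
  factor \<open>1 / (\<Delta> - 2)\<close> of \<open>2^k\<close>. The leftover \<open>lam^2\<close>
  is absorbed only when \<open>N\<close> is large compared with \<open>\<Delta>\<close>.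

  Disagreements need no extra data in memory: the block of a vertex records only how that vertex
  sees its edges, so every intermediate state fills the same tables, and a swap of two colours at
  one vertex takes constant time. The far end of the new edge acts as the parent of the root. Thus
  the root can carry a task like any other vertex, and the repair never leaves its tree. The machine
  cannot multiply, so thresholds must come from repeated addition, stopped early enough to stay
  linear.\<close>

definition exec :: "com \<Rightarrow> ram \<Rightarrow> (nat \<Rightarrow> ram \<Rightarrow> bool) \<Rightarrow> bool" where
  "exec c s Q \<longleftrightarrow> (\<exists>t s'. runs c s t s' \<and> Q t s')"

inductive_cases runs_SkipE: "runs Skip s t s'"
inductive_cases runs_SetRegE: "runs (SetReg r e) s t s'"
inductive_cases runs_SetArrE: "runs (SetArr a i e) s t s'"
inductive_cases runs_SeqE: "runs (Seq c1 c2) s t s'"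
inductive_cases runs_IfE: "runs (If b c1 c2) s t s'"

text \<open>Inversion of \<open>runs\<close> makes the rules for loop-free code equivalences rather
  than implications, so that the simplifier can run such code symbolically and collect its running
  time.\<close>

lemma exec_Skip: "exec Skip s Q \<longleftrightarrow> Q 1 s"
  unfolding exec_def by (metis runs_Skip runs_SkipE)

lemma exec_SetReg:
  "exec (SetReg r e) s Q \<longleftrightarrow> Q 1 (s\<lparr>reg := (reg s)(r := eval_expr e s)\<rparr>)"
  unfolding exec_def by (metis runs_SetReg runs_SetRegE)

lemma exec_SetArr:
  "exec (SetArr a i e) s Q \<longleftrightarrow>
     Q 1 (s\<lparr>arr := (arr s)(a := (arr s a)(eval_expr i s := eval_expr e s))\<rparr>)"
  unfolding exec_def by (metis runs_SetArr runs_SetArrE)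

lemma exec_Seq:
  "exec (Seq c1 c2) s Q \<longleftrightarrow> exec c1 s (\<lambda>t1 s1. exec c2 s1 (\<lambda>t2 s2. Q (t1 + t2) s2))"
  unfolding exec_def by (blast intro: runs.intros elim: runs_SeqE)

lemma exec_If:
  "exec (If b c1 c2) s Q \<longleftrightarrow>
     (if eval_test b s then exec c1 s (\<lambda>t. Q (Suc t)) else exec c2 s (\<lambda>t. Q (Suc t)))"
  unfolding exec_def using runs_IfTrue[of b s c1] runs_IfFalse[of b s c2]
  by (auto elim!: runs_IfE) blast+

lemmas exec_simps = exec_Skip exec_SetReg exec_SetArr exec_Seq exec_If

lemma exec_mono:
  assumes "exec c s Q" and "\<And>t s'. Q t s' \<Longrightarrow> Q' t s'"
  shows "exec c s Q'"
  using assms unfolding exec_def by blast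

text \<open>The ghost state \<open>g\<close> carries the abstract data, and its potential bounds the
  time that remains. The strict inequality for the body pays for the test of that round; the extra
  unit at the exit pays for the test that fails.\<close>

lemma exec_While:
  fixes pot :: "'g \<Rightarrow> nat"
  assumes init: "I g s"
    and body: "\<And>g s. I g s \<Longrightarrow> eval_test b s \<Longrightarrow>
      exec c s (\<lambda>t s'. \<exists>g'. I g' s' \<and> pot g' + t < pot g)"
    and exit: "\<And>g' t s'. I g' s' \<Longrightarrow> \<not> eval_test b s' \<Longrightarrow> t + pot g' \<le> Suc (pot g) \<Longrightarrow> Q t s'"
  shows "exec (While b c) s Q"
proof -
  have "\<exists>t s' g'. runs (While b c) s t s' \<and> I g' s' \<and> \<not> eval_test b s' \<and> t + pot g' \<le> Suc (pot g)"
    using init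
  proof (induction "pot g" arbitrary: g s rule: less_induct)
    case less
    show ?case
    proof (cases "eval_test b s")
      case False
      then show ?thesis using less.prems runs_WhileFalse[of b s c] by fastforce
    next
      case True
      obtain t1 s1 g1 where 1: "runs c s t1 s1" "I g1 s1" "pot g1 + t1 < pot g"
        using body[OF less.prems True] unfolding exec_def by blast
      obtain t2 s2 g2 where 2: "runs (While b c) s1 t2 s2" "I g2 s2" "\<not> eval_test b s2"
          "t2 + pot g2 \<le> Suc (pot g1)"
        using less.hyps[OF _ 1(2)] 1(3) by (meson le_add1 le_less_trans)
      have "runs (While b c) s (Suc (t1 + t2)) s2"
        using True 1(1) 2(1) by (rule runs_WhileTrue)
      moreover have "Suc (t1 + t2) + pot g2 \<le> Suc (pot g)" using 1(3) 2(4) by simp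
      ultimately show ?thesis using 2(2,3) by blast
    qed
  qed
  then show ?thesis using exit unfolding exec_def by blast
qed

section \<open>Walks in a forest\<close>

definition nbrs :: "'a set set \<Rightarrow> 'a \<Rightarrow> 'a set" where
  "nbrs E x = {y. {x, y} \<in> E}"

lemma nbrs_sym: "y \<in> nbrs E x \<longleftrightarrow> x \<in> nbrs E y"
  by (simp add: nbrs_def insert_commute)

lemma simple_graph_nbrs:
  assumes "simple_graph V E" "y \<in> nbrs E x"
  shows "x \<in> V" "y \<in> V" "x \<noteq> y"
proof -
  obtain a b where "a \<in> V" "b \<in> V" "a \<noteq> b" "{x, y} = {a, b}"
    using assms unfolding simple_graph_def nbrs_def by blast
  then show "x \<in> V" "y \<in> V" "x \<noteq> y" by (auto simp: doubleton_eq_iff)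
qed

lemma finite_nbrs:
  assumes "simple_graph V E" shows "finite (nbrs E x)"
proof (rule finite_subset)
  show "nbrs E x \<subseteq> V" using simple_graph_nbrs[OF assms] by blast
  show "finite V" using assms by (simp add: simple_graph_def)
qed

lemma degree_eq_card_nbrs:
  assumes "simple_graph V E" shows "degree E x = card (nbrs E x)"
proof -
  have "bij_betw (\<lambda>y. {x, y}) (nbrs E x) {f \<in> E. x \<in> f}"
    unfolding bij_betw_def
  proof
    show "inj_on (\<lambda>y. {x, y}) (nbrs E x)"
      by (auto simp: inj_on_def doubleton_eq_iff)
    show "(\<lambda>y. {x, y}) ` nbrs E x = {f \<in> E. x \<in> f}"
    proof
      show "{f \<in> E. x \<in> f} \<subseteq> (\<lambda>y. {x, y}) ` nbrs E x"
      proof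
        fix f assume "f \<in> {f \<in> E. x \<in> f}"
        then have f: "f \<in> E" "x \<in> f" by auto
        then obtain a b where "f = {a, b}" using assms unfolding simple_graph_def by blast
        then have "\<exists>y. f = {x, y}" using f(2) by auto
        then show "f \<in> (\<lambda>y. {x, y}) ` nbrs E x" using f(1) by (auto simp: nbrs_def)
      qed
    qed (auto simp: nbrs_def)
  qed
  then show ?thesis unfolding degree_def by (metis bij_betw_same_card)
qed

section \<open>Connected components and simple paths\<close>

lemma component_refl: "x \<in> component E x"
  by (simp add: component_def)

lemma component_step: "y \<in> component E x \<Longrightarrow> z \<in> nbrs E y \<Longrightarrow> z \<in> component E x"
  unfolding component_def nbrs_def by (auto intro: rtrancl.rtrancl_into_rtrancl)

lemma component_induct [consumes 1, case_names refl step]: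
  assumes "y \<in> component E x" "P x"
    and "\<And>y z. y \<in> component E x \<Longrightarrow> z \<in> nbrs E y \<Longrightarrow> P y \<Longrightarrow> P z"
  shows "P y"
proof -
  have "(x, y) \<in> {(a, b). {a, b} \<in> E}\<^sup>*" using assms(1) by (simp add: component_def)
  then show ?thesis
  proof (induction rule: rtrancl_induct)
    case base show ?case by (rule assms(2))
  next
    case (step y z)
    then show ?case using assms(3)[of y z] by (simp add: component_def nbrs_def)
  qed
qed

lemma component_trans:
  assumes "z \<in> component E y" "y \<in> component E x"
  shows "z \<in> component E x"
  using assms by (induction rule: component_induct) (auto intro: component_step)

lemma component_sym: "y \<in> component E x \<Longrightarrow> x \<in> component E y"
proof (induction rule: component_induct)
  case refl show ?case by (rule component_refl)
next
  case (step y z)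
  have "y \<in> component E z"
    using component_step[OF component_refl] step(2) nbrs_sym by metis
  then show ?case using step(3) by (meson component_trans)
qed

lemma component_subset:
  assumes "simple_graph V E" "r \<in> V" shows "component E r \<subseteq> V"
proof
  fix y assume "y \<in> component E r"
  then show "y \<in> V"
    by (induction rule: component_induct) (use assms simple_graph_nbrs[OF assms(1)] in auto)
qed

text \<open>Extending a path by an edge may revisit a vertex; cutting it back to the earlier visit
  keeps the vertices distinct.\<close>

lemma component_path:
  assumes "y \<in> component E x"
  shows "\<exists>xs. xs \<noteq> [] \<and> distinct xs \<and> hd xs = x \<and> last xs = y \<and>
    successively (\<lambda>a b. {a, b} \<in> E) xs"
  using assms
proof (induction rule: component_induct)
  case refl
  show ?case by (rule exI[of _ "[x]"]) simp
next
  case (step y z)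
  then obtain xs where xs: "xs \<noteq> []" "distinct xs" "hd xs = x" "last xs = y"
      "successively (\<lambda>a b. {a, b} \<in> E) xs"
    by blast
  show ?case
  proof (cases "z \<in> set xs")
    case True
    then obtain as bs where ab: "xs = as @ z # bs" by (meson split_list)
    have "successively (\<lambda>a b. {a, b} \<in> E) (as @ [z])"
      using xs(5) unfolding ab by (auto simp: successively_append_iff)
    moreover have "hd (as @ [z]) = x" using xs(3) unfolding ab by (cases as) auto
    ultimately show ?thesis using xs(2) unfolding ab
      by (intro exI[of _ "as @ [z]"]) auto
  next
    case False
    have "{y, z} \<in> E" using step(2) by (simp add: nbrs_def)
    then show ?thesis using xs False
      by (intro exI[of _ "xs @ [z]"]) (auto simp: successively_append_iff)
  qed
qed

text \<open>A simple path between the ends of \<open>xy\<close> that avoids this edge closes up with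
  it to a cycle. It has at least three vertices because the only path on two vertices is the deleted
  edge.\<close>

lemma forest_bridge:
  assumes "forest V E" "{x, y} \<in> E"
  shows "y \<notin> component (E - {{x, y}}) x"
proof
  assume "y \<in> component (E - {{x, y}}) x"
  then obtain xs where xs: "xs \<noteq> []" "distinct xs" "hd xs = x" "last xs = y"
      "successively (\<lambda>a b. {a, b} \<in> E - {{x, y}}) xs"
    using component_path by metis
  have neq: "x \<noteq> y"
    using simple_graph_nbrs(3)[of V E y x] assms by (auto simp: forest_def nbrs_def)
  have len: "3 \<le> length xs"
  proof (rule ccontr)
    assume "\<not> 3 \<le> length xs"
    moreover have "length xs \<noteq> 0" using xs(1) by simp
    ultimately consider "length xs = 1" | "length xs = 2" by linarith
    then show False
    proof cases
      case 1
      then show False using xs(3,4) neq by (cases xs) auto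
    next
      case 2
      then obtain a b where "xs = [a, b]"
        by (metis One_nat_def Suc_1 length_0_conv length_Suc_conv)
      then show False using xs by simp
    qed
  qed
  have "{xs ! i, xs ! (Suc i mod length xs)} \<in> E" if "i < length xs" for i
  proof (cases "Suc i < length xs")
    case True
    then show ?thesis using xs(5) by (auto simp: successively_conv_nth)
  next
    case False
    then have "Suc i = length xs" using that by simp
    then have "xs ! i = y" "xs ! (Suc i mod length xs) = x"
      using xs(1,3,4) by (auto simp: last_conv_nth hd_conv_nth)
         (metis diff_Suc_1 One_nat_def)
    then show ?thesis using assms(2) by (simp add: insert_commute)
  qed
  then have "is_cycle E xs" using len xs(2) by (simp add: is_cycle_def)
  then show False using assms(1) by (auto simp: forest_def)
qed

section \<open>Breadth-first search of a tree\<close>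

lemma inj_on_lessThan_notin:
  assumes "inj_on f {..<n :: nat}" "i < n" shows "f i \<notin> f ` {..<i}"
proof
  assume "f i \<in> f ` {..<i}"
  then obtain j where "j < i" "f i = f j" by auto
  then show False using assms inj_onD[of f "{..<n}" i j] by auto
qed

text \<open>The search runs over the forest with the new edge but must visit only the tree of
  \<open>r\<close>: with \<open>out\<close> entered as the parent of \<open>r\<close>, the new edge
  is met and never followed. The enumeration \<open>nbf\<close> stays abstract, so that both an
  arbitrary one and the one given by the tables in memory can be used.\<close>

locale bfs_tree =
  fixes V :: "'a set" and E :: "'a set set" and r out :: 'a
    and nbf :: "'a \<Rightarrow> nat \<Rightarrow> 'a" and dg :: "'a \<Rightarrow> nat"
  assumes forest: "forest V E" and root: "r \<in> V" and out: "out \<notin> component E r"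
    and nbf: "\<And>x. x \<in> component E r \<Longrightarrow>
      bij_betw (nbf x) {..<dg x} (nbrs (insert {r, out} E) x)"
begin

abbreviation T :: "'a set" where "T \<equiv> component E r"

abbreviation N :: "'a \<Rightarrow> 'a set" where "N \<equiv> nbrs (insert {r, out} E)"

lemma simple: "simple_graph V E"
  using forest by (simp add: forest_def)

lemma finite_T: "finite T"
  using component_subset[OF simple root] simple finite_subset by (auto simp: simple_graph_def)

lemma N_eq: "x \<in> T \<Longrightarrow> N x = nbrs E x \<union> (if x = r then {out} else {})"
  using out by (auto simp: nbrs_def doubleton_eq_iff)

lemma N_T: "x \<in> T \<Longrightarrow> y \<in> N x \<Longrightarrow> y \<noteq> out \<Longrightarrow> y \<in> T \<and> y \<in> nbrs E x"
  using N_eq[of x] component_step[of x E r y] by (auto split: if_splits)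

text \<open>Examined edges are kept with a direction, because an edge is met once from each end:
  towards the child and towards the parent.\<close>

definition scanned :: "'a list \<Rightarrow> nat \<Rightarrow> nat \<Rightarrow> ('a \<times> 'a) set" where
  "scanned Q hh i = {(x, y). \<exists>k < hh. x = Q ! k \<and> y \<in> N x} \<union>
     {(x, y). x = Q ! hh \<and> y \<in> nbf x ` {..<i}}"

text \<open>The last two clauses make \<open>\<pi>\<close> a tree: a queued vertex was entered along
  an examined edge, and its parent stands earlier in the queue. The condition \<open>i = 0\<close>
  fixes the otherwise meaningless index once the queue is exhausted.\<close>

definition bfs_inv :: "'a list \<Rightarrow> ('a \<Rightarrow> 'a) \<Rightarrow> nat \<Rightarrow> nat \<Rightarrow> bool" where
  "bfs_inv Q \<pi> hh i \<longleftrightarrow> Q \<noteq> [] \<and> Q ! 0 = r \<and> distinct Q \<and> set Q \<subseteq> T \<and> \<pi> r = out \<and>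
     hh \<le> length Q \<and> (if hh < length Q then i \<le> dg (Q ! hh) else i = 0) \<and>
     (\<forall>(x, y) \<in> scanned Q hh i. y \<noteq> \<pi> x \<longrightarrow> y \<in> set Q \<and> \<pi> y = x) \<and>
     (\<forall>y \<in> set Q. y \<noteq> r \<longrightarrow> (\<pi> y, y) \<in> scanned Q hh i) \<and>
     (\<forall>k < length Q. 0 < k \<longrightarrow> (\<exists>j < k. \<pi> (Q ! k) = Q ! j))"

text \<open>The last summand records whether the parent of the current vertex has been met; it makes
  every step of the search lower the potential by exactly one.\<close>

definition bfs_pot :: "'a list \<Rightarrow> ('a \<Rightarrow> 'a) \<Rightarrow> nat \<Rightarrow> nat \<Rightarrow> nat" where
  "bfs_pot Q \<pi> hh i = (card T - length Q) + 2 * (card T - hh) -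
     (if hh < length Q \<and> \<pi> (Q ! hh) \<in> nbf (Q ! hh) ` {..<i} then 1 else 0)"

lemma bfs_inv_init: "bfs_inv [r] (\<pi>(r := out)) 0 0"
  by (auto simp: bfs_inv_def scanned_def component_refl)

lemma bfs_inv_length: "bfs_inv Q \<pi> hh i \<Longrightarrow> length Q \<le> card T"
  unfolding bfs_inv_def using finite_T by (metis card_mono distinct_card)

lemma bfs_inv_parent_N:
  assumes "bfs_inv Q \<pi> hh i" "x \<in> set Q"
  shows "\<pi> x \<in> N x"
proof (cases "x = r")
  case True
  then show ?thesis using assms by (auto simp: bfs_inv_def nbrs_def)
next
  case False
  then have "(\<pi> x, x) \<in> scanned Q hh i" using assms by (auto simp: bfs_inv_def)
  moreover have "x \<in> N (\<pi> x)" if "(\<pi> x, x) \<in> scanned Q hh i"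
  proof (cases "hh < length Q")
    case True
    then have "Q ! hh \<in> T" "i \<le> dg (Q ! hh)" using assms(1) by (auto simp: bfs_inv_def)
    then have "nbf (Q ! hh) ` {..<i} \<subseteq> N (Q ! hh)"
      using bij_betw_imp_surj_on[OF nbf[of "Q ! hh"]] by (metis image_mono lessThan_subset_iff)
    then show ?thesis using that by (auto simp: scanned_def)
  next
    case False
    then show ?thesis using assms(1) that by (auto simp: bfs_inv_def scanned_def)
  qed
  ultimately show ?thesis by (simp add: nbrs_sym[of x])
qed

lemma bfs_inv_parent_edge:
  assumes "bfs_inv Q \<pi> hh i" "x \<in> set Q" "x \<noteq> r"
  shows "\<pi> x \<in> set Q" "{\<pi> x, x} \<in> E"
proof -
  obtain k where "k < length Q" "Q ! k = x" using assms(2) by (meson in_set_conv_nth)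
  then have "0 < k" using assms by (auto simp: bfs_inv_def intro: gr0I)
  then show 1: "\<pi> x \<in> set Q"
    using assms(1) \<open>k < length Q\<close> \<open>Q ! k = x\<close> unfolding bfs_inv_def
    by (metis dual_order.strict_trans nth_mem)
  then have "\<pi> x \<in> T" "x \<in> T" using assms by (auto simp: bfs_inv_def)
  then have "\<pi> x \<noteq> out" using out by auto
  then have "\<pi> x \<in> nbrs E x" using N_T[OF \<open>x \<in> T\<close> bfs_inv_parent_N[OF assms(1,2)]] by simp
  then show "{\<pi> x, x} \<in> E" by (simp add: nbrs_def insert_commute)
qed

text \<open>Stated for any \<open>F\<close> that contains the tree edges: the search step applies it
  to \<open>E\<close> with one edge deleted, to obtain a walk that avoids that edge.\<close>

lemma bfs_inv_connected:
  assumes inv: "bfs_inv Q \<pi> hh i" and "x \<in> set Q"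
    and F: "\<And>z. z \<in> set Q \<Longrightarrow> z \<noteq> r \<Longrightarrow> {\<pi> z, z} \<in> F"
  shows "x \<in> component F r"
proof -
  have "k < length Q \<Longrightarrow> Q ! k \<in> component F r" for k
  proof (induction k rule: less_induct)
    case (less k)
    show ?case
    proof (cases "k = 0")
      case True
      then show ?thesis using inv by (simp add: bfs_inv_def component_refl)
    next
      case False
      then obtain j where j: "j < k" "\<pi> (Q ! k) = Q ! j"
        using inv less.prems by (auto simp: bfs_inv_def)
      have "Q ! k \<noteq> r" using inv False less.prems
        by (metis bfs_inv_def length_greater_0_conv nth_eq_iff_index_eq)
      then have "Q ! k \<in> nbrs F (Q ! j)"
        using F[of "Q ! k"] less.prems j(2) by (auto simp: nbrs_def)
      then show ?thesis using less.IH[OF j(1)] j(1) less.prems component_step by fastforce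
    qed
  qed
  then show ?thesis using \<open>x \<in> set Q\<close> by (metis in_set_conv_nth)
qed

lemma scanned_Suc:
  "hh < length Q \<Longrightarrow> scanned Q hh (Suc i) = insert (Q ! hh, nbf (Q ! hh) i) (scanned Q hh i)"
  by (auto simp: scanned_def lessThan_Suc)

lemma bfs_step_parent:
  assumes inv: "bfs_inv Q \<pi> hh i" and hh: "hh < length Q" and i: "i < dg (Q ! hh)"
    and y: "nbf (Q ! hh) i = \<pi> (Q ! hh)"
  shows "bfs_inv Q \<pi> hh (Suc i)" "bfs_pot Q \<pi> hh (Suc i) + 1 = bfs_pot Q \<pi> hh i"
proof -
  show "bfs_inv Q \<pi> hh (Suc i)"
    using inv hh i y unfolding bfs_inv_def scanned_Suc[OF hh] by auto
  have "Q ! hh \<in> T" using inv hh by (auto simp: bfs_inv_def)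
  then have "inj_on (nbf (Q ! hh)) {..<dg (Q ! hh)}" using nbf bij_betw_imp_inj_on by blast
  then have "\<pi> (Q ! hh) \<notin> nbf (Q ! hh) ` {..<i}"
    unfolding y[symmetric] using i by (rule inj_on_lessThan_notin)
  moreover have "\<pi> (Q ! hh) \<in> nbf (Q ! hh) ` {..<Suc i}"
    unfolding y[symmetric] by simp
  moreover have "hh < card T" using hh bfs_inv_length[OF inv] by simp
  ultimately show "bfs_pot Q \<pi> hh (Suc i) + 1 = bfs_pot Q \<pi> hh i"
    using hh by (simp add: bfs_pot_def)
qed

lemma bfs_step_child:
  assumes inv: "bfs_inv Q \<pi> hh i" and hh: "hh < length Q" and i: "i < dg (Q ! hh)"
    and y: "nbf (Q ! hh) i = y" "y \<noteq> \<pi> (Q ! hh)"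
  shows "bfs_inv (Q @ [y]) (\<pi>(y := Q ! hh)) hh (Suc i)"
    "bfs_pot (Q @ [y]) (\<pi>(y := Q ! hh)) hh (Suc i) + 1 = bfs_pot Q \<pi> hh i"
proof -
  define x where "x = Q ! hh"
  have xQ: "x \<in> set Q" using hh by (simp add: x_def)
  have xT: "x \<in> T" using inv xQ by (auto simp: bfs_inv_def)
  have bij: "bij_betw (nbf x) {..<dg x} (N x)" by (rule nbf[OF xT])
  have yN: "y \<in> N x" using bij_betwE[OF bij] i y(1) by (auto simp: x_def)
  have y_new_dart: "y \<notin> nbf x ` {..<i}"
    using inj_on_lessThan_notin[OF bij_betw_imp_inj_on[OF bij], of i] i y(1) by (simp add: x_def)
  have dist: "distinct Q" using inv by (simp add: bfs_inv_def)
  have "y \<noteq> out"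
  proof
    assume "y = out"
    then have "x = r" using yN xT N_eq[OF xT] component_step[OF xT, of out] out
      by (auto split: if_splits)
    then show False using \<open>y = out\<close> y(2) inv by (simp add: x_def bfs_inv_def)
  qed
  then have yT: "y \<in> T" and yE: "{x, y} \<in> E" using N_T[OF xT yN] by (auto simp: nbrs_def)
  have y_not_scanned: "(x, y) \<notin> scanned Q hh i"
    using y_new_dart hh dist by (auto simp: scanned_def x_def nth_eq_iff_index_eq)
  \<comment> \<open>If \<open>y\<close> were queued, tree edges would join \<open>x\<close> and
    \<open>y\<close> through the root without the edge \<open>xy\<close>: it is no tree edge, since
    \<open>y\<close> is not the parent of \<open>x\<close> and \<open>xy\<close> has not yet been
    examined from \<open>x\<close>. This contradicts \<open>forest_bridge\<close>.\<close>
  have yQ: "y \<notin> set Q"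
  proof
    assume "y \<in> set Q"
    have *: "{\<pi> z, z} \<in> E - {{x, y}}" if z: "z \<in> set Q" "z \<noteq> r" for z
    proof -
      have "{\<pi> z, z} \<noteq> {x, y}"
      proof
        assume "{\<pi> z, z} = {x, y}"
        then consider "\<pi> z = x" "z = y" | "\<pi> z = y" "z = x" by (auto simp: doubleton_eq_iff)
        then show False
        proof cases
          case 1
          then show False using inv z y_not_scanned by (auto simp: bfs_inv_def)
        next
          case 2
          then show False using y(2) by (simp add: x_def)
        qed
      qed
      then show ?thesis using bfs_inv_parent_edge(2)[OF inv z] by simp
    qed
    have "y \<in> component (E - {{x, y}}) r" "x \<in> component (E - {{x, y}}) r"
      using bfs_inv_connected[OF inv _ *] xQ \<open>y \<in> set Q\<close> by auto
    then have "y \<in> component (E - {{x, y}}) x" by (meson component_sym component_trans)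
    then show False using forest_bridge[OF forest yE] by simp
  qed
  then have yx: "y \<noteq> x" "y \<noteq> r" using xQ inv by (auto simp: bfs_inv_def)
  have len: "hh < length (Q @ [y])" using hh by simp
  have sc: "scanned (Q @ [y]) hh (Suc i) = insert (x, y) (scanned Q hh i)"
  proof -
    have "(Q @ [y]) ! k = Q ! k" if "k \<le> hh" for k
      using hh that by (simp add: nth_append)
    then have "scanned (Q @ [y]) hh i = scanned Q hh i"
      by (simp add: scanned_def cong: conj_cong)
    then show ?thesis using scanned_Suc[OF len, of i] hh y(1) by (simp add: nth_append x_def)
  qed
  have sc_fst: "a \<in> set Q" if "(a, b) \<in> scanned Q hh i" for a b
    using that hh by (auto simp: scanned_def)
  show inv': "bfs_inv (Q @ [y]) (\<pi>(y := Q ! hh)) hh (Suc i)"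
    unfolding bfs_inv_def sc
  proof (intro conjI)
    show "\<forall>k<length (Q @ [y]). 0 < k \<longrightarrow>
        (\<exists>j<k. (\<pi>(y := Q ! hh)) ((Q @ [y]) ! k) = (Q @ [y]) ! j)"
    proof (intro allI impI)
      fix k assume k: "k < length (Q @ [y])" "0 < k"
      show "\<exists>j<k. (\<pi>(y := Q ! hh)) ((Q @ [y]) ! k) = (Q @ [y]) ! j"
      proof (cases "k < length Q")
        case True
        then obtain j where "j < k" "\<pi> (Q ! k) = Q ! j" using inv k by (auto simp: bfs_inv_def)
        moreover have "Q ! k \<noteq> y" using yQ True by auto
        ultimately show ?thesis using True by (auto simp: nth_append intro!: exI[of _ j])
      next
        case False
        then have "k = length Q" using k by simp
        then show ?thesis using hh by (auto simp: nth_append intro!: exI[of _ hh])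
      qed
    qed
    show "\<forall>(a, b)\<in>insert (x, y) (scanned Q hh i).
        b \<noteq> (\<pi>(y := Q ! hh)) a \<longrightarrow> b \<in> set (Q @ [y]) \<and> (\<pi>(y := Q ! hh)) b = a"
    proof (intro ballI, clarify)
      fix a b
      assume ab: "(a, b) \<in> insert (x, y) (scanned Q hh i)" "b \<noteq> (\<pi>(y := Q ! hh)) a"
      show "b \<in> set (Q @ [y]) \<and> (\<pi>(y := Q ! hh)) b = a"
      proof (cases "(a, b) = (x, y)")
        case True
        then show ?thesis by (simp add: x_def)
      next
        case False
        then have 1: "(a, b) \<in> scanned Q hh i" using ab(1) by blast
        then have "a \<noteq> y" using sc_fst yQ by auto
        then have "b \<in> set Q" "\<pi> b = a" using 1 ab(2) inv by (auto simp: bfs_inv_def)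
        then show ?thesis using yQ by auto
      qed
    qed
    show "\<forall>b\<in>set (Q @ [y]). b \<noteq> r \<longrightarrow>
        ((\<pi>(y := Q ! hh)) b, b) \<in> insert (x, y) (scanned Q hh i)"
      using inv yQ by (auto simp: bfs_inv_def x_def)
    show "(Q @ [y]) ! 0 = r" "distinct (Q @ [y])" "set (Q @ [y]) \<subseteq> T"
      using inv yT yQ by (auto simp: bfs_inv_def nth_append)
    show "(\<pi>(y := Q ! hh)) r = out" "hh \<le> length (Q @ [y])"
      using inv yx(2) by (auto simp: bfs_inv_def)
    show "if hh < length (Q @ [y]) then Suc i \<le> dg ((Q @ [y]) ! hh) else Suc i = 0"
      using hh i by (simp add: nth_append)
  qed simp
  have "hh < card T" "length Q < card T" using hh bfs_inv_length[OF inv'] by auto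
  moreover have "(y = \<pi> (Q ! hh)) = False" using y(2) by simp
  moreover have "nbf (Q ! hh) ` {..<Suc i} = insert y (nbf (Q ! hh) ` {..<i})"
    using y(1) by (auto simp: lessThan_Suc)
  ultimately show "bfs_pot (Q @ [y]) (\<pi>(y := Q ! hh)) hh (Suc i) + 1 = bfs_pot Q \<pi> hh i"
    using hh yx(1) y(2) by (auto simp: bfs_pot_def nth_append x_def)
qed

text \<open>A vertex is left only after its whole list has been examined, parent included. So the
  correction in the potential is active at that moment, and losing it together with the vertex
  changes the potential by 2 - 1 = 1.\<close>

lemma bfs_step_advance:
  assumes inv: "bfs_inv Q \<pi> hh i" and hh: "hh < length Q" and i: "\<not> i < dg (Q ! hh)"
  shows "bfs_inv Q \<pi> (Suc hh) 0" "bfs_pot Q \<pi> (Suc hh) 0 + 1 = bfs_pot Q \<pi> hh i"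
proof -
  have i': "i = dg (Q ! hh)" using inv hh i by (simp add: bfs_inv_def)
  have "Q ! hh \<in> T" using inv hh by (auto simp: bfs_inv_def)
  then have all: "nbf (Q ! hh) ` {..<i} = N (Q ! hh)"
    using bij_betw_imp_surj_on[OF nbf] i' by blast
  have "scanned Q (Suc hh) 0 = scanned Q hh i"
    using all by (auto simp: scanned_def less_Suc_eq)
  then show "bfs_inv Q \<pi> (Suc hh) 0"
    using inv hh unfolding bfs_inv_def by auto
  have "\<pi> (Q ! hh) \<in> nbf (Q ! hh) ` {..<i}"
    unfolding all using bfs_inv_parent_N[OF inv] hh by simp
  moreover have "hh < card T" using hh bfs_inv_length[OF inv] by simp
  ultimately show "bfs_pot Q \<pi> (Suc hh) 0 + 1 = bfs_pot Q \<pi> hh i"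
    using hh by (auto simp: bfs_pot_def)
qed

lemma bfs_finished:
  assumes inv: "bfs_inv Q \<pi> (length Q) i"
  shows "set Q = T" "bfs_pot Q \<pi> (length Q) i = 0" "length Q = card T"
    "\<And>x y. x \<in> T \<Longrightarrow> y \<in> N x \<Longrightarrow> y = \<pi> x \<or> y \<in> T \<and> \<pi> y = x"
    "\<And>x. x \<in> T \<Longrightarrow> \<pi> x \<in> N x"
proof -
  have sc: "y = \<pi> x \<or> y \<in> set Q \<and> \<pi> y = x" if "x \<in> set Q" "y \<in> N x" for x y
  proof -
    obtain k where "k < length Q" "x = Q ! k" using \<open>x \<in> set Q\<close> by (metis in_set_conv_nth)
    then have "(x, y) \<in> scanned Q (length Q) i" using \<open>y \<in> N x\<close> by (auto simp: scanned_def)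
    then show ?thesis using inv unfolding bfs_inv_def by blast
  qed
  have "y \<in> set Q" if "y \<in> T" for y
    using that
  proof (induction rule: component_induct)
    case refl
    then show ?case using inv by (auto simp: bfs_inv_def intro: nth_mem[of 0, simplified])
  next
    case (step y z)
    then have "z \<in> T" by (blast intro: component_step)
    then have "z \<noteq> out" using out by auto
    have "z \<in> N y" using step(2) by (auto simp: nbrs_def)
    then show ?case
      using sc[OF step(3)] bfs_inv_parent_edge(1)[OF inv step(3)] inv \<open>z \<noteq> out\<close>
      by (cases "y = r") (auto simp: bfs_inv_def)
  qed
  then show T: "set Q = T" using inv by (auto simp: bfs_inv_def)
  show len: "length Q = card T" unfolding T[symmetric]
    using inv by (simp add: bfs_inv_def distinct_card)
  then show "bfs_pot Q \<pi> (length Q) i = 0" by (simp add: bfs_pot_def)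
  show "\<And>x y. x \<in> T \<Longrightarrow> y \<in> N x \<Longrightarrow> y = \<pi> x \<or> y \<in> T \<and> \<pi> y = x" using sc T by simp
  show "\<And>x. x \<in> T \<Longrightarrow> \<pi> x \<in> N x" using bfs_inv_parent_N[OF inv] T by simp
qed

lemma bfs_exists: "\<exists>Q \<pi>. bfs_inv Q \<pi> (length Q) 0"
proof -
  have "\<exists>Q' \<pi>'. bfs_inv Q' \<pi>' (length Q') 0" if "bfs_inv Q \<pi> hh i" for Q \<pi> hh i
    using that
  proof (induction "bfs_pot Q \<pi> hh i" arbitrary: Q \<pi> hh i rule: less_induct)
    case less
    show ?case
    proof (cases "hh < length Q")
      case hh: True
      show ?thesis
      proof (cases "i < dg (Q ! hh)")
        case i: True
        show ?thesis
        proof (cases "nbf (Q ! hh) i = \<pi> (Q ! hh)")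
          case True
          show ?thesis using bfs_step_parent[OF less.prems hh i True] less.hyps by (metis less_add_one)
        next
          case False
          show ?thesis using bfs_step_child[OF less.prems hh i refl False] less.hyps
            by (metis less_add_one)
        qed
      next
        case False
        show ?thesis using bfs_step_advance[OF less.prems hh False] less.hyps by (metis less_add_one)
      qed
    next
      case False
      then have "hh = length Q" "i = 0" using less.prems by (auto simp: bfs_inv_def)
      then show ?thesis using less.prems by blast
    qed
  qed
  then show ?thesis using bfs_inv_init by blast
qed

text \<open>The position in the queue serves as a rank. All later recursions and inductions over the
  tree rest on this order alone.\<close>

lemma bfs_index:
  assumes inv: "bfs_inv Q \<pi> (length Q) i"
  shows "\<exists>ix :: 'a \<Rightarrow> nat. \<forall>x \<in> T. \<pi> x \<in> T \<longrightarrow> ix (\<pi> x) < ix x"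
proof -
  have dist: "distinct Q" and Q0: "Q ! 0 = r" and pir: "\<pi> r = out"
    using inv unfolding bfs_inv_def by blast+
  have ord: "\<forall>k<length Q. 0 < k \<longrightarrow> (\<exists>j<k. \<pi> (Q ! k) = Q ! j)"
    using inv unfolding bfs_inv_def by blast
  define ix where "ix = the_inv_into {..<length Q} ((!) Q)"
  have ix_nth: "ix (Q ! k) = k" if "k < length Q" for k
    unfolding ix_def using dist that by (intro the_inv_into_f_f) (auto simp: inj_on_nth)
  have "ix (\<pi> x) < ix x" if x: "x \<in> T" "\<pi> x \<in> T" for x
  proof -
    obtain k where k: "k < length Q" "x = Q ! k"
      using x(1) bfs_finished(1)[OF inv] by (metis in_set_conv_nth)
    have "k \<noteq> 0" using x(2) Q0 pir out k by metis
    then obtain j where "j < k" "\<pi> x = Q ! j" using ord k by auto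
    then show ?thesis using ix_nth k by simp
  qed
  then show ?thesis by blast
qed

text \<open>Each vertex other than the root owns the edge to its parent. Two owners of one edge
  would be each other's parent, against the order of the index.\<close>

lemma card_T_le: "card T \<le> card (tree_edges E r) + 1"
proof -
  obtain Q \<pi> where inv: "bfs_inv Q \<pi> (length Q) 0" using bfs_exists by blast
  have T: "set Q = T" by (rule bfs_finished(1)[OF inv])
  obtain ix :: "'a \<Rightarrow> nat" where ix: "\<And>x. x \<in> T \<Longrightarrow> \<pi> x \<in> T \<Longrightarrow> ix (\<pi> x) < ix x"
    using bfs_index[OF inv] by blast
  have edge: "\<pi> y \<in> T" "{\<pi> y, y} \<in> E" if "y \<in> T - {r}" for y
    using bfs_inv_parent_edge[OF inv, of y] that T by auto
  have "inj_on (\<lambda>y. {\<pi> y, y}) (T - {r})"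
  proof (rule inj_onI, rule ccontr)
    fix y z assume yz: "y \<in> T - {r}" "z \<in> T - {r}" "{\<pi> y, y} = {\<pi> z, z}" "y \<noteq> z"
    then have par: "\<pi> y = z" "\<pi> z = y" by (auto simp: doubleton_eq_iff)
    show False using ix[of y] ix[of z] par yz by simp
  qed
  then have "card (T - {r}) = card ((\<lambda>y. {\<pi> y, y}) ` (T - {r}))" by (simp add: card_image)
  also have "\<dots> \<le> card (tree_edges E r)"
  proof (rule card_mono)
    have "E \<subseteq> Pow V" using simple by (auto simp: simple_graph_def)
    then show "finite (tree_edges E r)"
      using simple by (auto simp: simple_graph_def tree_edges_def intro: finite_subset[of _ "Pow V"])
    show "(\<lambda>y. {\<pi> y, y}) ` (T - {r}) \<subseteq> tree_edges E r"
      using edge by (auto simp: tree_edges_def)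
  qed
  finally show ?thesis using finite_T component_refl[of r E] by (simp add: card_Diff_singleton)
qed

end

section \<open>Subtree sizes and thresholds\<close>

text \<open>The recursion passes from a vertex to its children, whose index is larger; finiteness of
  \<open>T\<close> bounds the index and makes this well-founded.\<close>

lemma subtree_size_exists:
  fixes ix :: "'a \<Rightarrow> nat"
  assumes "finite T" and ix: "\<And>y. y \<in> T \<Longrightarrow> \<pi> y \<in> T \<Longrightarrow> ix (\<pi> y) < ix y"
  shows "\<exists>sz :: 'a \<Rightarrow> nat. \<forall>x \<in> T. sz x = 1 + (\<Sum>y | y \<in> T \<and> \<pi> y = x. sz y)"
proof -
  define S where "S = {(y, x). y \<in> T \<and> x \<in> T \<and> \<pi> y = x}"
  define H where "H f x = 1 + (\<Sum>y | y \<in> T \<and> \<pi> y = x. f y)" for f :: "'a \<Rightarrow> nat" and x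
  have "Max (ix ` T) - ix y < Max (ix ` T) - ix x" if "(y, x) \<in> S" for y x
  proof -
    have "y \<in> T" "ix x < ix y" using that ix by (auto simp: S_def)
    moreover then have "ix y \<le> Max (ix ` T)" using \<open>finite T\<close> by simp
    ultimately show ?thesis by linarith
  qed
  then have "wf S" by (intro wf_subset[OF wf_measure[of "\<lambda>x. Max (ix ` T) - ix x"]]) auto
  then have "wfrec S H x = H (cut (wfrec S H) S x) x" for x by (rule wfrec)
  moreover have "H (cut f S x) x = H f x" if "x \<in> T" for f x
    unfolding H_def using that by (intro arg_cong[of _ _ "(+) 1"] sum.cong) (auto simp: cut_def S_def)
  ultimately have "\<forall>x \<in> T. wfrec S H x = H (wfrec S H) x" by metis
  then show ?thesis unfolding H_def by blast
qed

text \<open>Largest subtree allowed for a task of level \<open>k\<close>. The second summand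
  provides for \<open>2 ^ Suc k\<close> double steps, each of which removes at least
  \<open>(d - 2) * Suc (level_size d k)\<close> vertices.\<close>

fun level_size :: "nat \<Rightarrow> nat \<Rightarrow> nat" where
  "level_size d 0 = 0"
| "level_size d (Suc k) = level_size d k + 2 ^ Suc k * (d - 2) * Suc (level_size d k)"

text \<open>The \<open>2 ^ k\<close> double steps along the chain cost two edges each, leaving it three.\<close>

fun level_cost :: "nat \<Rightarrow> nat" where
  "level_cost 0 = 0"
| "level_cost (Suc k) = 2 * 2 ^ Suc k + 3 + 2 * level_cost k"

text \<open>A refinement of \<open>level_cost\<close> by the current size \<open>n\<close>. The
  quotient counts the double steps that this size still admits, so the cost can drop by two with
  each of them.\<close>

fun task_cost :: "nat \<Rightarrow> nat \<Rightarrow> nat \<Rightarrow> nat" where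
  "task_cost d 0 n = 0"
| "task_cost d (Suc k) n = 2 * (n div ((d - 2) * Suc (level_size d k))) + 3 + 2 * level_cost k"

text \<open>The part \<open>level_size d j\<close> of the threshold is smaller than one block
  \<open>b\<close>, hence it adds no further double step and the quotient is at most
  \<open>2 ^ Suc j\<close>.\<close>

lemma task_cost_le:
  assumes "3 \<le> d" "n \<le> level_size d k"
  shows "task_cost d k n \<le> level_cost k"
proof (cases k)
  case 0
  then show ?thesis by simp
next
  case (Suc j)
  define b where "b = (d - 2) * Suc (level_size d j)"
  have "Suc (level_size d j) \<le> b"
    using assms(1) mult_le_mono1[of 1 "d - 2" "Suc (level_size d j)"] by (simp add: b_def)
  moreover have "n \<le> level_size d j + 2 ^ Suc j * b"
    using assms(2) unfolding Suc b_def level_size.simps mult.assoc .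
  moreover have "(2 ^ Suc j + 1) * b = 2 ^ Suc j * b + b" by (rule distrib_right[of _ 1 b, simplified mult_1])
  ultimately have "n < (2 ^ Suc j + 1) * b" by linarith
  then have "n div b < 2 ^ Suc j + 1" by (simp add: less_mult_imp_div_less)
  then show ?thesis unfolding Suc task_cost.simps level_cost.simps b_def[symmetric] by simp
qed

text \<open>What the recolouring needs of the search: parents, an index that increases away from the
  root, and subtree sizes. The neighbourhoods \<open>nb\<close> are those with the new edge, which
  is why \<open>r\<close> has the parent \<open>out\<close> outside \<open>T\<close>.\<close>

locale recolor_tree =
  fixes d :: nat and nb :: "'a \<Rightarrow> 'a set" and T :: "'a set" and \<pi> :: "'a \<Rightarrow> 'a"
    and r out :: 'a and ix :: "'a \<Rightarrow> nat" and sz :: "'a \<Rightarrow> nat"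
  assumes d3: "3 \<le> d" and finT: "finite T" and rT: "r \<in> T" and outT: "out \<notin> T"
    and pir: "\<pi> r = out"
    and nbT: "\<And>x y. x \<in> T \<Longrightarrow> y \<in> nb x \<Longrightarrow> y = \<pi> x \<or> y \<in> T \<and> \<pi> y = x"
    and pi_nb: "\<And>x. x \<in> T \<Longrightarrow> \<pi> x \<in> nb x"
    and nb_sym: "\<And>x y. y \<in> nb x \<longleftrightarrow> x \<in> nb y"
    and ix: "\<And>x. x \<in> T \<Longrightarrow> \<pi> x \<in> T \<Longrightarrow> ix (\<pi> x) < ix x"
    and pi_T: "\<And>x. x \<in> T \<Longrightarrow> x \<noteq> r \<Longrightarrow> \<pi> x \<in> T"
    and sz: "\<And>x. x \<in> T \<Longrightarrow> sz x = 1 + (\<Sum>y | y \<in> T \<and> \<pi> y = x. sz y)"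
begin

text \<open>The index excludes that a vertex is both parent and child of another, which turns the
  alternative in \<open>nbT\<close> into an exclusive one.\<close>

lemma child_iff: "x \<in> T \<Longrightarrow> y \<in> nb x \<Longrightarrow> y \<noteq> \<pi> x \<longleftrightarrow> y \<in> T \<and> \<pi> y = x"
  using nbT[of x y] ix[of x] ix[of y] by fastforce

lemma pi_neq: "x \<in> T \<Longrightarrow> \<pi> x \<noteq> x"
  using ix[of x] by auto

lemma child_nb: "y \<in> T \<Longrightarrow> \<pi> y = x \<Longrightarrow> y \<in> nb x"
  using pi_nb[of y] nb_sym by metis

lemma sz_pos: "x \<in> T \<Longrightarrow> 0 < sz x"
  using sz by simp

text \<open>Summing the size equation over \<open>T\<close>, every vertex except the root reappears
  once on the right as a child. Cancelling leaves the size of the root.\<close>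

lemma sz_root: "sz r = card T"
proof -
  have "(\<Sum>x\<in>T. sz x) = (\<Sum>x\<in>T. 1 + (\<Sum>y | y \<in> T \<and> \<pi> y = x. sz y))"
    using sz by (intro sum.cong) auto
  also have "\<dots> = card T + (\<Sum>x\<in>T. \<Sum>y | y \<in> T \<and> \<pi> y = x. sz y)"
    unfolding sum.distrib by simp
  also have "(\<Sum>x\<in>T. \<Sum>y | y \<in> T \<and> \<pi> y = x. sz y) =
      (\<Sum>x\<in>T. \<Sum>y | y \<in> T - {r} \<and> \<pi> y = x. sz y)"
    using pir outT by (intro sum.cong refl) auto
  also have "\<dots> = (\<Sum>y\<in>T - {r}. sz y)"
    using finT pi_T by (intro sum.group) auto
  finally show ?thesis using finT rT by (simp add: sum.remove[of T r])
qed

section \<open>Descendants and disjoint subtrees\<close>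

definition below :: "'a \<Rightarrow> 'a set" where
  "below w = {z. (z, w) \<in> {(a, \<pi> a) |a. a \<in> T \<and> \<pi> a \<in> T}\<^sup>*}"

lemma below_refl: "w \<in> below w"
  by (simp add: below_def)

lemma below_parent: "z \<in> below w \<Longrightarrow> z = w \<or> z \<in> T \<and> \<pi> z \<in> T \<and> \<pi> z \<in> below w"
  unfolding below_def by (auto elim: converse_rtranclE)

lemma below_child: "z \<in> T \<Longrightarrow> \<pi> z \<in> T \<Longrightarrow> \<pi> z \<in> below w \<Longrightarrow> z \<in> below w"
  unfolding below_def by (auto intro: converse_rtrancl_into_rtrancl)

lemma below_trans: "a \<in> below b \<Longrightarrow> b \<in> below c \<Longrightarrow> a \<in> below c"
  unfolding below_def by auto

lemma below_ix: "z \<in> below w \<Longrightarrow> ix w \<le> ix z"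
proof -
  assume "z \<in> below w"
  then have "(z, w) \<in> {(a, \<pi> a) |a. a \<in> T \<and> \<pi> a \<in> T}\<^sup>*" by (simp add: below_def)
  then show ?thesis by (induction rule: converse_rtrancl_induct) (use ix in fastforce)+
qed

text \<open>Open tasks are kept pairwise \<open>apart\<close>: they work in disjoint subtrees, so a
  step for one of them leaves the others intact.\<close>

definition apart :: "'a \<Rightarrow> 'a \<Rightarrow> bool" where
  "apart a b \<longleftrightarrow> a \<notin> below b \<and> b \<notin> below a"

lemma apart_child:
  assumes "apart a w" "x \<in> T" "\<pi> x = w" "w \<in> T"
  shows "apart a x"
proof -
  have "x \<in> below w" using below_child[of x w] assms below_refl by simp
  then have "a \<notin> below x" using assms(1) below_trans by (auto simp: apart_def)
  moreover have "x \<notin> below a"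
  proof
    assume "x \<in> below a"
    then have "x = a \<or> w \<in> below a" using below_parent[of x a] assms(3) by auto
    then show False using assms(1) \<open>x \<in> below w\<close> by (auto simp: apart_def)
  qed
  ultimately show ?thesis by (simp add: apart_def)
qed

lemma apart_siblings:
  assumes "x \<in> T" "y \<in> T" "\<pi> x = w" "\<pi> y = w" "x \<noteq> y" "w \<in> T"
  shows "apart x y"
proof -
  have "x \<notin> below y" if "x \<in> T" "y \<in> T" "\<pi> x = w" "\<pi> y = w" "x \<noteq> y" for x y
    using below_parent[of x y] below_ix[of w y] ix[of y] that assms(6) by fastforce
  from this[of x y] this[of y x] show ?thesis using assms by (auto simp: apart_def)
qed

lemma apart_sym: "apart a b \<Longrightarrow> apart b a"
  by (simp add: apart_def)

text \<open>Size of the branch entered from \<open>x\<close> by colour \<open>c\<close>. As a sum it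
  makes sense for every colour: for valid views it has at most one summand, and it vanishes when
  \<open>c\<close> is free at \<open>x\<close> or belongs to the parent edge.\<close>

definition wt :: "('a \<Rightarrow> 'a \<Rightarrow> nat) \<Rightarrow> 'a \<Rightarrow> nat \<Rightarrow> nat" where
  "wt h x c = (\<Sum>y | y \<in> T \<and> \<pi> y = x \<and> h x y = c. sz y)"

definition valid :: "('a \<Rightarrow> 'a \<Rightarrow> nat) \<Rightarrow> bool" where
  "valid h \<longleftrightarrow> (\<forall>x. inj_on (h x) (nb x) \<and> (\<forall>y \<in> nb x. h x y < d))"

lemma sz_eq_wt:
  assumes "valid h" "x \<in> T"
  shows "sz x = 1 + (\<Sum>c<d. wt h x c)"
proof -
  have "(\<Sum>c<d. wt h x c) = (\<Sum>c<d. \<Sum>y | y \<in> {y. y \<in> T \<and> \<pi> y = x} \<and> h x y = c. sz y)"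
    unfolding wt_def by (intro sum.cong) auto
  also have "\<dots> = (\<Sum>y | y \<in> T \<and> \<pi> y = x. sz y)"
    using finT assms child_nb by (intro sum.group) (auto simp: valid_def)
  finally show ?thesis using sz[OF assms(2)] by simp
qed

lemma wt_parent:
  assumes "valid h" "x \<in> T"
  shows "wt h x (h x (\<pi> x)) = 0"
proof -
  have "y = \<pi> x" if "y \<in> T" "\<pi> y = x" "h x y = h x (\<pi> x)" for y
    using assms that child_nb pi_nb inj_onD[of "h x" "nb x" y "\<pi> x"] by (auto simp: valid_def)
  then have "{y. y \<in> T \<and> \<pi> y = x \<and> h x y = h x (\<pi> x)} = {}"
    using child_iff[OF assms(2)] child_nb by blast
  then show ?thesis unfolding wt_def by (simp only: sum.empty)
qed

lemma wt_child:
  assumes "valid h" "x \<in> T" "y \<in> T" "\<pi> y = x"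
  shows "wt h x (h x y) = sz y"
proof -
  have "{z. z \<in> T \<and> \<pi> z = x \<and> h x z = h x y} = {y}"
    using assms child_nb inj_onD[of "h x" "nb x"] by (auto simp: valid_def)
  then show ?thesis unfolding wt_def by simp
qed

text \<open>The branches that can be entered from \<open>w\<close> via distinct colours \<open>c\<close> are disjoint.\<close>

lemma sz_split:
  assumes h: "valid h" and w: "w \<in> T" and x: "x \<in> T" "\<pi> x = w"
    and p: "h w (\<pi> w) = p" and q: "h w x = q" "h x w = q" and pq: "p \<noteq> q"
  shows "sz w = 2 + wt h x p + (\<Sum>c\<in>{..<d} - {p, q}. wt h w c + wt h x c)"
proof -
  have lt: "p < d" "q < d" using h w x p q child_nb pi_nb by (auto simp: valid_def)
  have split: "(\<Sum>c<d. f c) = f p + f q + (\<Sum>c\<in>{..<d} - {p, q}. f c)" for f :: "nat \<Rightarrow> nat"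
  proof -
    have "(\<Sum>c<d. f c) = f p + (\<Sum>c\<in>{..<d} - {p}. f c)" using lt by (intro sum.remove) auto
    also have "(\<Sum>c\<in>{..<d} - {p}. f c) = f q + (\<Sum>c\<in>{..<d} - {p} - {q}. f c)"
      using lt pq by (intro sum.remove) auto
    also have "{..<d} - {p} - {q} = {..<d} - {p, q}" by auto
    finally show ?thesis by simp
  qed
  have "wt h w p = 0" using wt_parent[OF h w] p by simp
  moreover have "wt h w q = sz x" using wt_child[OF h w x] q by simp
  moreover have "wt h x q = 0" using wt_parent[OF h x(1)] q x by simp
  ultimately show ?thesis
    using sz_eq_wt[OF h w] sz_eq_wt[OF h x(1)] split[of "wt h w"] split[of "wt h x"]
    by (simp add: sum.distrib)
qed

end

section \<open>Moving disagreements down the tree\<close>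

definition swp :: "nat \<Rightarrow> nat \<Rightarrow> nat \<Rightarrow> nat" where
  "swp p q c = (if c = p then q else if c = q then p else c)"

type_synonym 'a view = "'a \<Rightarrow> 'a \<Rightarrow> nat"
type_synonym 'a task = "'a \<times> nat \<times> nat \<times> nat"

definition flip :: "'a view \<Rightarrow> 'a \<Rightarrow> nat \<Rightarrow> nat \<Rightarrow> 'a view" where
  "flip h w p q = h(w := (\<lambda>y. swp p q (h w y)))"

context recolor_tree begin

lemma valid_flip: "valid h \<Longrightarrow> p < d \<Longrightarrow> q < d \<Longrightarrow> valid (flip h w p q)"
  unfolding valid_def flip_def
  by (auto simp: inj_on_def swp_def split: if_splits)

text \<open>
  Here \<open>h x y\<close> is the colour of the edge \<open>xy\<close> in the view of \<open>x\<close>. A task \<open>(w, p, q, k)\<close> says that the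
  parent edge of \<open>w\<close> still has colour \<open>p\<close> for \<open>w\<close> but already colour \<open>q\<close> for its parent; \<open>k\<close> is
  its level.
\<close>

definition task_ok :: "'a set set \<Rightarrow> 'a view \<Rightarrow> 'a task \<Rightarrow> bool" where
  "task_ok X h = (\<lambda>(w, p, q, k). w \<in> T \<and> h w (\<pi> w) = p \<and> h (\<pi> w) w = q \<and> p \<noteq> q \<and>
     sz w \<le> level_size d k \<and> {w, \<pi> w} \<in> X)"

definition agree :: "'a set \<Rightarrow> 'a view \<Rightarrow> 'a \<Rightarrow> 'a \<Rightarrow> bool" where
  "agree P h a b \<longleftrightarrow> h a b = h b a \<or> a \<in> P \<and> b = \<pi> a \<or> b \<in> P \<and> a = \<pi> b"

text \<open>The set \<open>X\<close> collects the edges that have been touched so far.\<close>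

definition rc_inv :: "('a set \<Rightarrow> nat) \<Rightarrow> nat \<Rightarrow> 'a set set \<Rightarrow> 'a view \<Rightarrow>
    'a task list \<Rightarrow> bool" where
  "rc_inv col R X h ts \<longleftrightarrow> valid h \<and> (\<forall>t \<in> set ts. task_ok X h t) \<and>
     sorted_wrt apart (map fst ts) \<and>
     (\<forall>a b. b \<in> nb a \<longrightarrow> agree (fst ` set ts) h a b) \<and>
     (\<forall>a b. b \<in> nb a \<and> {a, b} \<notin> X \<longrightarrow> h a b = col {a, b}) \<and> finite X \<and>
     card X + (\<Sum>(w, p, q, k)\<leftarrow>ts. task_cost d k (sz w)) \<le> R"

lemma agree_sym: "agree P h a b \<longleftrightarrow> agree P h b a"
  by (auto simp: agree_def)

lemma task_ok_lt:
  assumes "valid h" "task_ok X h (w, p, q, k)"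
  shows "p < d" "q < d"
  using assms pi_nb[of w] nb_sym[of w "\<pi> w"] by (auto simp: valid_def task_ok_def)

lemma valid_injD: "valid h \<Longrightarrow> y \<in> nb x \<Longrightarrow> z \<in> nb x \<Longrightarrow> h x y = h x z \<Longrightarrow> y = z"
  unfolding valid_def by (meson inj_onD)

lemma apart_irrefl: "\<not> apart w w"
  by (simp add: apart_def below_refl)

text \<open>After the swap the parent edge has colour \<open>q\<close> at both ends. No other edge
  at \<open>w\<close> is affected: \<open>q\<close> is free there, and by injectivity only the
  parent edge has colour \<open>p\<close>.\<close>

lemma rc_step_free:
  assumes inv: "rc_inv col R X h ((w, p, q, k) # ts)" and free: "q \<notin> h w ` nb w"
  shows "rc_inv col R X (flip h w p q) ts"
proof -
  have val: "valid h" and tok: "task_ok X h (w, p, q, k)"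
    and apw: "\<And>v. v \<in> fst ` set ts \<Longrightarrow> apart w v"
    using inv by (auto simp: rc_inv_def)
  have w: "w \<in> T" "h w (\<pi> w) = p" "h (\<pi> w) w = q" "p \<noteq> q" "{w, \<pi> w} \<in> X"
    using tok by (auto simp: task_ok_def)
  have pw: "\<pi> w \<noteq> w" using pi_neq w by simp
  have other: "flip h w p q w b = h w b" if "b \<in> nb w" "b \<noteq> \<pi> w" for b
    using that free w valid_injD[OF val, of b w "\<pi> w"] pi_nb[OF w(1)]
    by (auto simp: flip_def swp_def image_iff)
  have same: "flip h w p q a = h a" if "a \<noteq> w" for a
    using that by (simp add: flip_def)
  have par: "flip h w p q w (\<pi> w) = q" using w by (simp add: flip_def swp_def)
  have notin: "w \<notin> fst ` set ts" using apw apart_irrefl by blast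
  have ag_w: "agree (fst ` set ts) (flip h w p q) w b" if b: "b \<in> nb w" for b
  proof (cases "b = \<pi> w")
    case True
    then show ?thesis using par same[OF pw] w by (simp add: agree_def)
  next
    case False
    then have "agree (fst ` set ((w, p, q, k) # ts)) h w b"
      using inv b unfolding rc_inv_def by blast
    moreover have "b \<noteq> w" using child_iff[OF w(1) b] False pi_neq by auto
    ultimately show ?thesis using other[OF b False] same[of b] False by (auto simp: agree_def)
  qed
  have ag: "agree (fst ` set ts) (flip h w p q) a b" if b: "b \<in> nb a" for a b
  proof (cases "a = w \<or> b = w")
    case True
    then show ?thesis using ag_w[of a] ag_w[of b] b nb_sym[of a b] agree_sym by metis
  next
    case False
    have "agree (fst ` set ((w, p, q, k) # ts)) h a b"
      using inv b unfolding rc_inv_def by blast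
    then show ?thesis using False same[of a] same[of b] by (auto simp: agree_def)
  qed
  have tasks: "task_ok X (flip h w p q) t" if t: "t \<in> set ts" for t
  proof -
    obtain v p' q' k' where tv: "t = (v, p', q', k')" by (cases t)
    have v: "task_ok X h t" using inv t by (auto simp: rc_inv_def)
    have vw: "apart w v" using apw t tv by force
    then have "v \<noteq> w" using apart_irrefl by blast
    moreover have "\<pi> v \<noteq> w"
      using vw below_child[of v w] below_refl v tv w(1) by (auto simp: apart_def task_ok_def)
    ultimately show ?thesis using v same[of v] same[of "\<pi> v"] by (simp add: tv task_ok_def)
  qed
  have out: "flip h w p q a b = col {a, b}" if "b \<in> nb a" "{a, b} \<notin> X" for a b
  proof (cases "a = w")
    case True
    then have "b \<noteq> \<pi> w" using that w by auto
    then show ?thesis using other[of b] that inv True by (simp add: rc_inv_def)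
  next
    case False
    then show ?thesis using same[OF False] that inv by (simp add: rc_inv_def)
  qed
  show ?thesis
    unfolding rc_inv_def
    using valid_flip[OF val task_ok_lt[OF val tok]] tasks ag out inv
    by (auto simp: rc_inv_def)
qed

text \<open>This is the next vertex of the Kempe chain. It is a child because the parent edge has
  colour \<open>p \<noteq> q\<close>, and its view of the edge agrees because \<open>x\<close> lies
  below \<open>w\<close> and therefore carries no task.\<close>

lemma task_child:
  assumes inv: "rc_inv col R X h ((w, p, q, k) # ts)" and x: "x \<in> nb w" "h w x = q"
  shows "x \<in> T" "\<pi> x = w" "h x w = q" "w \<in> nb x" "x \<noteq> w" "\<pi> w \<noteq> x"
proof -
  have w: "w \<in> T" "h w (\<pi> w) = p" "p \<noteq> q"
    using inv by (auto simp: rc_inv_def task_ok_def)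
  then have "x \<noteq> \<pi> w" using x by auto
  then show 1: "x \<in> T" "\<pi> x = w" using child_iff[OF w(1) x(1)] by auto
  show "w \<in> nb x" using x nb_sym by metis
  show "x \<noteq> w" using 1 pi_neq by metis
  show "\<pi> w \<noteq> x" using \<open>x \<noteq> \<pi> w\<close> by simp
  have "x \<in> below w" using below_child[OF 1(1)] 1 w(1) below_refl by simp
  then have "x \<notin> fst ` set ((w, p, q, k) # ts)"
    using inv \<open>x \<noteq> w\<close> by (auto simp: rc_inv_def apart_def)
  moreover have "agree (fst ` set ((w, p, q, k) # ts)) h w x"
    using inv x(1) unfolding rc_inv_def by blast
  ultimately show "h x w = q" using x(2) \<open>x \<noteq> \<pi> w\<close> by (auto simp: agree_def)
qed

text \<open>
  Three swaps, of \<open>p\<close> with \<open>c\<close> and \<open>c\<close> with \<open>q\<close> at \<open>w\<close> and of \<open>q\<close> with \<open>c\<close> at \<open>x\<close>, cover both ways to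
  proceed: for \<open>c = p\<close> the first one is void and the other two follow the Kempe chain.
\<close>

lemma rc_step_used:
  assumes inv: "rc_inv col R X h ((w, p, q, k) # ts)" and x: "x \<in> nb w" "h w x = q"
    and c: "c < d" "c \<noteq> q"
    and ys: "ys = [] \<and> (c \<noteq> p \<longrightarrow> c \<notin> h w ` nb w) \<or>
      ys = [(y, c, p, k')] \<and> c \<noteq> p \<and> y \<in> nb w \<and> h w y = c"
    and zs: "zs = [] \<and> c \<notin> h x ` nb x \<or> zs = [(z, c, q, k')] \<and> z \<in> nb x \<and> h x z = c"
    and size: "wt h x c \<le> level_size d k'" "c \<noteq> p \<Longrightarrow> wt h w c \<le> level_size d k'"
    and cost: "(if c = p then 2 else 3) + (\<Sum>(w, p, q, k)\<leftarrow>zs @ ys. task_cost d k (sz w))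
      \<le> task_cost d k (sz w)"
  shows "\<exists>X'. rc_inv col R X' (flip (flip (flip h w p c) w c q) x q c) (zs @ ys @ ts)"
proof -
  define h' where "h' = flip (flip (flip h w p c) w c q) x q c"
  \<comment> \<open>The parent edges of the new tasks are counted now, since their upper ends
    already see new colours; the parent edge of \<open>w\<close> was counted when its own task was
    opened. Hence at most three edges are added, and at most two for \<open>c = p\<close>.\<close>
  define X' where "X' = insert {w, x} (X \<union> (\<lambda>(v, _). {v, \<pi> v}) ` set (zs @ ys))"
  have val: "valid h" and tok: "task_ok X h (w, p, q, k)"
    and apw: "\<And>v. v \<in> fst ` set ts \<Longrightarrow> apart w v" and finX: "finite X"
    using inv by (auto simp: rc_inv_def)
  have w: "w \<in> T" "h w (\<pi> w) = p" "h (\<pi> w) w = q" "p \<noteq> q" "{w, \<pi> w} \<in> X" "\<pi> w \<in> nb w"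
    using tok pi_nb by (auto simp: task_ok_def)
  note xs = task_child[OF inv x]
  have lt: "p < d" "q < d" using task_ok_lt[OF val tok] by auto
  have pw: "\<pi> w \<noteq> w" using pi_neq w by simp
  have same: "h' a = h a" if "a \<noteq> w" "a \<noteq> x" for a
    using that by (simp add: flip_def h'_def)
  \<comment> \<open>At \<open>w\<close> the two swaps compose to \<open>p\<close> to
    \<open>q\<close>, \<open>q\<close> to \<open>c\<close>, \<open>c\<close> to \<open>p\<close>:
    the parent edge is repaired, \<open>wx\<close> receives \<open>c\<close>, and the branch of
    colour \<open>c\<close> is handed \<open>p\<close>. For \<open>c = p\<close> this is the swap of
    \<open>p\<close> and \<open>q\<close>.\<close>
  have hw: "h' w b = swp c q (swp p c (h w b))" for b
    using xs(5) by (simp add: h'_def flip_def)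
  have hx: "h' x b = swp q c (h x b)" for b
    using xs(5) by (simp add: h'_def flip_def)
  have w_par: "h' w (\<pi> w) = q" using w by (simp add: hw swp_def)
  have w_x: "h' w x = c" using x w c by (simp add: hw swp_def)
  have x_w: "h' x w = c" using xs by (simp add: hx swp_def)
  have w_other: "h' w b = h w b \<and> h w b \<noteq> c \<or> c \<noteq> p \<and> ys = [(b, c, p, k')] \<and> h w b = c \<and> h' w b = p"
    if b: "b \<in> nb w" "b \<noteq> \<pi> w" "b \<noteq> x" for b
  proof -
    have "h w b \<noteq> p" "h w b \<noteq> q"
      using valid_injD[OF val] b w x by metis+
    moreover have "ys = [(b, c, p, k')]" if "h w b = c"
      using ys b that \<open>h w b \<noteq> p\<close> valid_injD[OF val] by (auto simp: image_iff)
    ultimately show ?thesis using w(4) c by (auto simp: hw swp_def)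
  qed
  have x_other: "h' x b = h x b \<and> h x b \<noteq> c \<or> zs = [(b, c, q, k')] \<and> h x b = c \<and> h' x b = q"
    if b: "b \<in> nb x" "b \<noteq> w" for b
  proof -
    have "h x b \<noteq> q"
      using valid_injD[OF val] b xs by metis
    moreover have "zs = [(b, c, q, k')]" if "h x b = c"
      using zs b that valid_injD[OF val] by (auto simp: image_iff)
    ultimately show ?thesis using c by (auto simp: hx swp_def)
  qed
  have below_notin: "b \<notin> fst ` set ts" if "b \<in> below w" for b
    using apw that by (auto simp: apart_def)
  have x_below: "x \<in> below w" using below_child[of x w] xs w below_refl by simp
  have w_child: "b \<in> T" "\<pi> b = w" "b \<noteq> w" "h b w = h w b" "b \<in> below w"
    if b: "b \<in> nb w" "b \<noteq> \<pi> w" for b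
  proof -
    show 1: "b \<in> T" "\<pi> b = w" using child_iff[OF w(1) b(1)] b by auto
    then show 2: "b \<noteq> w" using pi_neq by metis
    show 3: "b \<in> below w" using below_child[of b w] 1 w below_refl by simp
    have "agree (fst ` set ((w, p, q, k) # ts)) h w b"
      using inv b unfolding rc_inv_def by blast
    then show "h b w = h w b" using below_notin[OF 3] 2 b by (auto simp: agree_def)
  qed
  have x_child: "b \<in> T" "\<pi> b = x" "b \<noteq> w" "b \<noteq> x" "h b x = h x b" "b \<in> below w"
    if b: "b \<in> nb x" "b \<noteq> w" for b
  proof -
    show 1: "b \<in> T" "\<pi> b = x" using child_iff[OF xs(1) b(1)] b xs by auto
    then show 2: "b \<noteq> w" "b \<noteq> x" using b 1(2) pi_neq[OF 1(1)] by auto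
    show 3: "b \<in> below w" using below_child[of b w] 1 xs x_below by simp
    have "agree (fst ` set ((w, p, q, k) # ts)) h x b"
      using inv b unfolding rc_inv_def by blast
    then show "h b x = h x b"
      using below_notin[OF 3] below_notin[OF x_below] 2 1 b xs by (auto simp: agree_def)
  qed
  have y_cases: "y \<in> nb w \<and> h w y = c \<and> y \<noteq> \<pi> w \<and> y \<noteq> x \<and> c \<noteq> p" if "ys \<noteq> []"
    using that ys w x c by auto
  have z_cases: "z \<in> nb x \<and> h x z = c \<and> z \<noteq> w" if "zs \<noteq> []"
    using that zs xs c by auto
  have y_eq: "ys \<noteq> [] \<Longrightarrow> ys = [(y, c, p, k')]" using ys by auto
  have z_eq: "zs \<noteq> [] \<Longrightarrow> zs = [(z, c, q, k')]" using zs by auto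
  define P where "P = fst ` set (zs @ ys @ ts)"
  have ag_w: "agree P h' w b" if b: "b \<in> nb w" for b
  proof (cases "b = \<pi> w")
    case True
    then show ?thesis using w_par same[OF pw xs(6)] w by (simp add: agree_def)
  next
    case False
    note wc = w_child[OF b False]
    show ?thesis
    proof (cases "b = x")
      case True
      then show ?thesis using w_x x_w by (simp add: agree_def)
    next
      case bx: False
      from w_other[OF b False bx] show ?thesis
        using same[OF wc(3) bx] wc by (auto simp: agree_def P_def)
    qed
  qed
  have ag_x: "agree P h' x b" if b: "b \<in> nb x" for b
  proof (cases "b = w")
    case True
    then show ?thesis using w_x x_w by (simp add: agree_def)
  next
    case False
    note xc = x_child[OF b False]
    from x_other[OF b False] show ?thesis
      using same[OF xc(3,4)] xc by (auto simp: agree_def P_def)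
  qed
  have ag: "agree P h' a b" if b: "b \<in> nb a" for a b
  proof (cases "a \<in> {w, x} \<or> b \<in> {w, x}")
    case True
    then show ?thesis using ag_w ag_x b nb_sym[of a b] agree_sym[of P h'] by blast
  next
    case False
    have "agree (fst ` set ((w, p, q, k) # ts)) h a b"
      using inv b unfolding rc_inv_def by blast
    then show ?thesis using False same[of a] same[of b] by (auto simp: agree_def P_def)
  qed
  have tasks: "task_ok X' h' t" if t: "t \<in> set (zs @ ys @ ts)" for t
  proof -
    consider "t \<in> set ts" | "ys \<noteq> []" "t = (y, c, p, k')" | "zs \<noteq> []" "t = (z, c, q, k')"
      using t ys zs by auto
    then show ?thesis
    proof cases
      case 1
      obtain v p' q' k' where tv: "t = (v, p', q', k')" by (cases t)
      have v: "task_ok X h t" using inv 1 by (auto simp: rc_inv_def)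
      have vw: "v \<notin> below w" using below_notin[of v] 1 tv by force
      then have "v \<noteq> w" "v \<noteq> x" using below_refl x_below by auto
      moreover have "\<pi> v \<noteq> w" "\<pi> v \<noteq> x"
        using vw below_child[of v w] below_refl x_below v tv w(1) xs(1)
        by (auto simp: task_ok_def)
      ultimately show ?thesis using v same[of v] same[of "\<pi> v"]
        by (simp add: tv task_ok_def X'_def)
    next
      case 2
      note yc = y_cases[OF 2(1)]
      note wc = w_child[of y] 
      have "sz y = wt h w c" using wt_child[OF val w(1), of y] wc yc by auto
      moreover have "h' w y = p" using w_other[of y] yc by auto
      moreover have "{y, w} \<in> X'" using y_eq[OF 2(1)] wc yc by (auto simp: X'_def)
      ultimately show ?thesis
        using 2 yc wc same[of y] size by (auto simp: task_ok_def)
    next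
      case 3
      note zc = z_cases[OF 3(1)]
      note xc = x_child[of z]
      have "sz z = wt h x c" using wt_child[OF val xs(1), of z] xc zc by auto
      moreover have "h' x z = q" using x_other[of z] zc by auto
      moreover have "{z, x} \<in> X'" using z_eq[OF 3(1)] xc zc by (auto simp: X'_def)
      ultimately show ?thesis
        using 3 zc xc same[of z] size c by (auto simp: task_ok_def)
    qed
  qed
  have out: "h' a b = col {a, b}" if b: "b \<in> nb a" "{a, b} \<notin> X'" for a b
  proof -
    have X: "{a, b} \<notin> X" "{a, b} \<noteq> {w, x}" using b by (auto simp: X'_def)
    then have *: "h a b = col {a, b}" using inv b by (simp add: rc_inv_def)
    consider "a = w" | "a = x" | "a \<noteq> w" "a \<noteq> x" by blast
    then show ?thesis
    proof cases
      case 1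
      then have "b \<noteq> \<pi> w" "b \<noteq> x" using X w by auto
      then show ?thesis using w_other[of b] w_child[of b] b 1 *
        by (auto simp: X'_def insert_commute)
    next
      case 2
      then have "b \<noteq> w" using X by auto
      then show ?thesis using x_other[of b] x_child[of b] b 2 *
        by (auto simp: X'_def insert_commute)
    next
      case 3
      then show ?thesis using * same by simp
    qed
  qed
  have sorted: "sorted_wrt apart (map fst (zs @ ys @ ts))"
  proof -
    have y_ts: "apart y v" if "ys \<noteq> []" "v \<in> fst ` set ts" for v
      using apart_child[of v w y] apart_sym apw[OF that(2)] y_cases[OF that(1)] w_child[of y] w
      by blast
    have x_ts: "apart x v" if "v \<in> fst ` set ts" for v
      using apart_child[of v w x] apart_sym apw[OF that] xs w by blast
    have z_ts: "apart z v" if "zs \<noteq> []" "v \<in> fst ` set ts" for v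
      using apart_child[of v x z] apart_sym x_ts[OF that(2)] z_cases[OF that(1)] x_child[of z] xs
      by blast
    have z_y: "apart z y" if "zs \<noteq> []" "ys \<noteq> []"
      using apart_siblings[of x y w] apart_child[of y x z] apart_sym
        z_cases[OF that(1)] y_cases[OF that(2)] x_child[of z] w_child[of y] xs w
      by metis
    have "sorted_wrt apart (map fst ts)" using inv by (simp add: rc_inv_def)
    then show ?thesis
      using y_ts z_ts z_y y_eq z_eq by (cases "ys = []"; cases "zs = []") auto
  qed
  have cardX: "card X' + (\<Sum>(w, p, q, k)\<leftarrow>zs @ ys @ ts. task_cost d k (sz w)) \<le> R"
  proof -
    have "card ((\<lambda>(v, _). {v, \<pi> v}) ` set (zs @ ys)) \<le> card (set (zs @ ys))"
      by (rule card_image_le) simp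
    also have "\<dots> \<le> length (zs @ ys)" by (rule card_length)
    also have "\<dots> \<le> (if c = p then 1 else 2)" using ys zs by auto
    finally have "card X' \<le> card X + (if c = p then 2 else 3)"
      using card_Un_le[of X "(\<lambda>(v, _). {v, \<pi> v}) ` set (zs @ ys)"]
        card_insert_le_m1[of "card X + (if c = p then 2 else 3)"
          "X \<union> (\<lambda>(v, _). {v, \<pi> v}) ` set (zs @ ys)" "{w, x}"]
      unfolding X'_def by (auto split: if_splits)
    moreover have "card X + (task_cost d k (sz w) + (\<Sum>(w, p, q, k)\<leftarrow>ts. task_cost d k (sz w))) \<le> R"
      using inv by (simp add: rc_inv_def)
    ultimately show ?thesis using cost by simp
  qed
  have "valid h'" unfolding h'_def using val lt c by (intro valid_flip) auto
  moreover have "finite X'" using finX by (simp add: X'_def)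
  ultimately have "rc_inv col R X' h' (zs @ ys @ ts)"
    unfolding rc_inv_def P_def[symmetric] using tasks sorted ag out cardX by blast
  then show ?thesis unfolding h'_def by blast
qed

text \<open>Every colour rejected before \<open>c\<close>, other than \<open>p\<close> and
  \<open>q\<close>, has a nonempty branch at \<open>w\<close> or at \<open>x\<close>, and these
  branches are separate summands in \<open>sz_split\<close>. Together with \<open>w\<close> and
  \<open>x\<close> they account for \<open>max 2 c\<close> vertices outside the branches of colour
  \<open>c\<close>, to which the search for \<open>c\<close> can be charged.\<close>

lemma scan_le_sz:
  assumes h: "valid h" and w: "w \<in> T" and x: "x \<in> T" "\<pi> x = w"
    and p: "h w (\<pi> w) = p" and q: "h w x = q" "h x w = q" and pq: "p \<noteq> q"
    and c: "c < d" "c \<noteq> p" "c \<noteq> q"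
    and bad: "\<And>c'. c' < c \<Longrightarrow> c' \<noteq> p \<Longrightarrow> c' \<noteq> q \<Longrightarrow> 0 < wt h w c' + wt h x c'"
  shows "wt h w c + wt h x c + max 2 c \<le> sz w"
proof -
  define f where "f c = wt h w c + wt h x c" for c
  have "card ({..<c} - {p, q}) \<ge> c - 2"
  proof -
    have "card {..<c} - card {p, q} \<le> card ({..<c} - {p, q})" by (rule diff_card_le_card_Diff) simp
    moreover have "card {p, q} = 2" using pq by simp
    ultimately show ?thesis by simp
  qed
  moreover have "(\<Sum>c'\<in>{..<c} - {p, q}. 1) \<le> (\<Sum>c'\<in>{..<c} - {p, q}. f c')"
    using bad by (intro sum_mono) (auto simp: f_def Suc_le_eq)
  moreover have "f c + (\<Sum>c'\<in>{..<c} - {p, q}. f c') = (\<Sum>c'\<in>insert c ({..<c} - {p, q}). f c')"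
    by simp
  moreover have "\<dots> \<le> (\<Sum>c'\<in>{..<d} - {p, q}. f c')"
    using c by (intro sum_mono2) auto
  ultimately show ?thesis using sz_split[OF h w x p q pq] by (simp add: f_def)
qed

text \<open>All \<open>d - 2\<close> third colours fail here, and each failure contributes weight
  \<open>m\<close>. What is left for the next task is the branch of colour \<open>p\<close> at
  \<open>x\<close>, two steps along the chain.\<close>

lemma no_branch_le_sz:
  assumes h: "valid h" and w: "w \<in> T" and x: "x \<in> T" "\<pi> x = w"
    and p: "h w (\<pi> w) = p" and q: "h w x = q" "h x w = q" and pq: "p \<noteq> q"
    and bad: "\<And>c. c < d \<Longrightarrow> c \<noteq> p \<Longrightarrow> c \<noteq> q \<Longrightarrow> m \<le> wt h w c + wt h x c"
  shows "wt h x p + 2 + (d - 2) * m \<le> sz w"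
proof -
  have "card ({..<d} - {p, q}) \<ge> d - 2"
  proof -
    have "card {..<d} - card {p, q} \<le> card ({..<d} - {p, q})" by (rule diff_card_le_card_Diff) simp
    moreover have "card {p, q} = 2" using pq by simp
    ultimately show ?thesis by simp
  qed
  then have "(d - 2) * m \<le> card ({..<d} - {p, q}) * m" by simp
  also have "\<dots> = (\<Sum>c\<in>{..<d} - {p, q}. m)" by simp
  also have "\<dots> \<le> (\<Sum>c\<in>{..<d} - {p, q}. wt h w c + wt h x c)"
    using bad by (intro sum_mono) auto
  finally show ?thesis using sz_split[OF h w x p q pq] by simp
qed

text \<open>Both branches have to respect the threshold, because the choice of \<open>c\<close> may
  open a task in each of them.\<close>

definition fits :: "'a view \<Rightarrow> 'a \<Rightarrow> nat \<Rightarrow> nat \<Rightarrow> 'a \<Rightarrow> nat \<Rightarrow> nat \<Rightarrow> bool" where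
  "fits h w p q x k c \<longleftrightarrow> c \<noteq> p \<and> c \<noteq> q \<and>
     wt h w c \<le> level_size d k \<and> wt h x c \<le> level_size d k"

text \<open>Here \<open>n\<close> counts the colours that a search for \<open>c\<close> rejects.\<close>

definition branch :: "'a view \<Rightarrow> 'a \<Rightarrow> nat \<Rightarrow> nat \<Rightarrow> 'a \<Rightarrow> nat \<Rightarrow> nat \<Rightarrow> nat \<Rightarrow> nat \<Rightarrow> bool" where
  "branch h w p q x k c k' n \<longleftrightarrow>
     c < d \<and> fits h w p q x k c \<and> k' = k \<and> (\<forall>c'<c. \<not> fits h w p q x k c') \<and> n = c \<or>
     c = p \<and> k' = Suc k \<and> (\<forall>c<d. \<not> fits h w p q x k c) \<and> n = d"

definition next_tasks :: "'a view \<Rightarrow> 'a \<Rightarrow> nat \<Rightarrow> nat \<Rightarrow> nat \<Rightarrow>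
    'a task list \<Rightarrow> bool" where
  "next_tasks h x c q k zs \<longleftrightarrow> zs = [] \<and> c \<notin> h x ` nb x \<or>
     (\<exists>z. zs = [(z, c, q, k)] \<and> z \<in> nb x \<and> h x z = c)"

text \<open>Two accounts are kept. For the recourse, a fitting colour spends the 3 and the two
  \<open>level_cost k\<close> in \<open>task_cost\<close>, while a chain step spends one unit of the
  quotient. For the time, new sizes and rejected colours together stay within the old size;
  \<open>max 2\<close> records that \<open>w\<close> and \<open>x\<close> are lost even if the
  search succeeds at once.\<close>

lemma rc_step:
  assumes inv: "rc_inv col R X h ((w, p, q, Suc k) # ts)" and x: "x \<in> nb w" "h w x = q"
    and c: "branch h w p q x k c k' n"
    and ys: "if c = p then ys = [] else next_tasks h w c p k' ys"
    and zs: "next_tasks h x c q k' zs"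
  shows "\<exists>X'. rc_inv col R X' (flip (flip (flip h w p c) w c q) x q c) (zs @ ys @ ts)"
    and "(\<Sum>t\<leftarrow>zs @ ys. sz (fst t)) + max 2 n \<le> sz w"
proof -
  have val: "valid h" and tok: "task_ok X h (w, p, q, Suc k)"
    using inv by (auto simp: rc_inv_def)
  have w: "w \<in> T" "h w (\<pi> w) = p" "p \<noteq> q" "sz w \<le> level_size d (Suc k)"
    using tok by (auto simp: task_ok_def)
  note xs = task_child[OF inv x]
  note lt = task_ok_lt[OF val tok]
  have cd: "c < d" "c \<noteq> q" using c lt w by (auto simp: branch_def fits_def)
  have zs': "zs = [] \<or> (\<exists>z. zs = [(z, c, q, k')] \<and> sz z = wt h x c)"
  proof -
    have "sz z = wt h x c" if "z \<in> nb x" "h x z = c" for z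
    proof -
      have "z \<noteq> w" using that xs cd by auto
      then have "z \<in> T \<and> \<pi> z = x" using child_iff[OF xs(1) that(1)] xs by simp
      then show ?thesis using wt_child[OF val xs(1), of z] that by simp
    qed
    then show ?thesis using zs by (auto simp: next_tasks_def)
  qed
  have ys': "ys = [] \<or> c \<noteq> p \<and> (\<exists>y. ys = [(y, c, p, k')] \<and> sz y = wt h w c)"
  proof -
    have "sz y = wt h w c" if "y \<in> nb w" "h w y = c" "c \<noteq> p" for y
    proof -
      have "y \<noteq> \<pi> w" using that w by auto
      then have "y \<in> T \<and> \<pi> y = w" using child_iff[OF w(1) that(1)] by simp
      then show ?thesis using wt_child[OF val w(1), of y] that by simp
    qed
    then show ?thesis using ys by (auto simp: next_tasks_def split: if_splits)
  qed
  have sums: "(\<Sum>t\<leftarrow>zs @ ys. sz (fst t)) \<le> wt h x c + (if c = p then 0 else wt h w c)"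
    using zs' ys' by auto
  have key: "(if c = p then 2 else 3) + (\<Sum>(w, p, q, k)\<leftarrow>zs @ ys. task_cost d k (sz w))
        \<le> task_cost d (Suc k) (sz w) \<and>
      wt h x c \<le> level_size d k' \<and> (c \<noteq> p \<longrightarrow> wt h w c \<le> level_size d k') \<and>
      (\<Sum>t\<leftarrow>zs @ ys. sz (fst t)) + max 2 n \<le> sz w"
    using c unfolding branch_def
  proof
    assume A: "c < d \<and> fits h w p q x k c \<and> k' = k \<and> (\<forall>c'<c. \<not> fits h w p q x k c') \<and> n = c"
    have "0 < wt h w c' + wt h x c'" if "c' < c" "c' \<noteq> p" "c' \<noteq> q" for c'
      using A that by (auto simp: fits_def)
    then have 1: "wt h w c + wt h x c + max 2 c \<le> sz w"
      using A by (intro scan_le_sz[OF val w(1) xs(1,2) w(2) x(2) xs(3) w(3)]) (auto simp: fits_def)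
    have "task_cost d k (wt h x c) \<le> level_cost k" "task_cost d k (wt h w c) \<le> level_cost k"
      using A by (auto simp: fits_def intro!: task_cost_le[OF d3])
    then have "(\<Sum>(w, p, q, k)\<leftarrow>zs @ ys. task_cost d k (sz w)) \<le> 2 * level_cost k"
      using zs' ys' A by auto
    then show ?thesis using A 1 sums by (auto simp: fits_def)
  next
    assume A: "c = p \<and> k' = Suc k \<and> (\<forall>c<d. \<not> fits h w p q x k c) \<and> n = d"
    define b where "b = (d - 2) * Suc (level_size d k)"
    have "Suc (level_size d k) \<le> wt h w c + wt h x c" if "c < d" "c \<noteq> p" "c \<noteq> q" for c
      using A that by (auto simp: fits_def not_le Suc_le_eq trans_less_add1 trans_less_add2)
    then have 1: "wt h x p + 2 + b \<le> sz w"
      unfolding b_def by (intro no_branch_le_sz[OF val w(1) xs(1,2) w(2) x(2) xs(3) w(3)]) auto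
    \<comment> \<open>The \<open>d\<close> colours of an unsuccessful search are paid by
      \<open>w\<close>, \<open>x\<close> and one vertex for each of the \<open>d - 2\<close> third
      colours.\<close>
    have "d - 2 \<le> b" by (simp add: b_def)
    then have 2: "wt h x p + d \<le> sz w" using 1 by simp
    have "0 < b" using d3 by (simp add: b_def)
    have "(wt h x p + b) div b \<le> sz w div b" using 1 by (intro div_le_mono) simp
    then have "wt h x p div b + 1 \<le> sz w div b" using \<open>0 < b\<close> by simp
    then have "2 + task_cost d (Suc k) (wt h x p) \<le> task_cost d (Suc k) (sz w)"
      unfolding task_cost.simps b_def[symmetric] by simp
    moreover have "ys = []" using ys' A by auto
    ultimately show ?thesis
      using zs' A 2 w(4) sums d3 by auto
  qed
  show "(\<Sum>t\<leftarrow>zs @ ys. sz (fst t)) + max 2 n \<le> sz w" using key by simp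
  obtain y z where yz: "ys = [] \<and> (c \<noteq> p \<longrightarrow> c \<notin> h w ` nb w) \<or>
      ys = [(y, c, p, k')] \<and> c \<noteq> p \<and> y \<in> nb w \<and> h w y = c"
    "zs = [] \<and> c \<notin> h x ` nb x \<or> zs = [(z, c, q, k')] \<and> z \<in> nb x \<and> h x z = c"
    using ys zs unfolding next_tasks_def by (cases "c = p") auto
  show "\<exists>X'. rc_inv col R X' (flip (flip (flip h w p c) w c q) x q c) (zs @ ys @ ts)"
    by (rule rc_step_used[OF inv x cd yz]) (use key in auto)
qed

text \<open>Level 0 admits only empty subtrees, so it never holds a task: a colour that fits at
  level 0 leads to no branch at all.\<close>

lemma rc_inv_level:
  assumes "rc_inv col R X h ((w, p, q, k) # ts)"
  shows "\<exists>j. k = Suc j"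
proof (cases k)
  case 0
  then have "sz w = 0" "w \<in> T" using assms by (auto simp: rc_inv_def task_ok_def)
  then show ?thesis using sz_pos[of w] by simp
qed simp

text \<open>The steps are those of the program, taken here for vertices of any type, where no memory
  layout is available. Each of them lowers the total size of the open tasks.\<close>

lemma rc_exists:
  assumes "rc_inv col R X h ts"
  shows "\<exists>X' h'. rc_inv col R X' h' [] \<and> (\<forall>x. x \<notin> T \<longrightarrow> h' x = h x)"
  using assms
proof (induction "\<Sum>t\<leftarrow>ts. sz (fst t)" arbitrary: X h ts rule: less_induct)
  case less
  show ?case
  proof (cases ts)
    case Nil
    then show ?thesis using less.prems by blast
  next
    case (Cons t ts')
    obtain w p q l where t: "t = (w, p, q, l)" by (cases t)
    obtain k where k: "l = Suc k"
      using rc_inv_level less.prems unfolding Cons t by blast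
    note inv = less.prems[unfolded Cons t k]
    have w: "w \<in> T" using inv by (auto simp: rc_inv_def task_ok_def)
    show ?thesis
    proof (cases "q \<in> h w ` nb w")
      case False
      have "\<exists>X' h'. rc_inv col R X' h' [] \<and> (\<forall>x. x \<notin> T \<longrightarrow> h' x = flip h w p q x)"
        using sz_pos[OF w] by (intro less.hyps[OF _ rc_step_free[OF inv False]]) (simp add: Cons t)
      moreover have "flip h w p q v = h v" if "v \<notin> T" for v
        using that w by (auto simp: flip_def)
      ultimately show ?thesis by metis
    next
      case True
      then obtain x where x: "x \<in> nb w" "h w x = q" by auto
      have xT: "x \<in> T" using task_child[OF inv x] by simp
      have "\<exists>c k' n. branch h w p q x k c k' n"
      proof (cases "\<exists>c<d. fits h w p q x k c")
        case True
        then have "fits h w p q x k (LEAST c. fits h w p q x k c)"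
          "(LEAST c. fits h w p q x k c) < d"
          by (blast intro: LeastI, metis (full_types) Least_le le_less_trans)
        then show ?thesis using not_less_Least[of _ "fits h w p q x k"] unfolding branch_def by blast
      qed (auto simp: branch_def)
      then obtain c k' n where c: "branch h w p q x k c k' n" by blast
      have nt: "\<exists>zs. next_tasks h x c q k' zs" for x c q
        unfolding next_tasks_def by (cases "c \<in> h x ` nb x") auto
      then obtain ys where ys: "if c = p then ys = [] else next_tasks h w c p k' ys" by metis
      obtain zs where zs: "next_tasks h x c q k' zs" using nt by blast
      obtain X' where inv': "rc_inv col R X' (flip (flip (flip h w p c) w c q) x q c) (zs @ ys @ ts')"
        using rc_step(1)[OF inv x c ys zs] by blast
      have "\<exists>X'' h'. rc_inv col R X'' h' [] \<and>
          (\<forall>v. v \<notin> T \<longrightarrow> h' v = flip (flip (flip h w p c) w c q) x q c v)"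
        using rc_step(2)[OF inv x c ys zs] by (intro less.hyps[OF _ inv']) (simp add: Cons t)
      moreover have "flip (flip (flip h w p c) w c q) x q c v = h v" if "v \<notin> T" for v
        using that w xT by (auto simp: flip_def)
      ultimately show ?thesis by metis
    qed
  qed
qed

end

section \<open>The recourse bound\<close>

definition least_level :: "nat \<Rightarrow> nat \<Rightarrow> nat" where
  "least_level d n = (LEAST k. n \<le> level_size d k)"

text \<open>The inner \<open>Suc\<close> passes from edges to vertices of a tree; the outer one
  counts the new edge, which belongs to the touched edges from the start.\<close>

definition recourse_bound :: "nat \<Rightarrow> nat \<Rightarrow> nat" where
  "recourse_bound d N = Suc (level_cost (least_level d (Suc N)))"

section \<open>Growth of thresholds and costs\<close>

lemma level_size_ge:
  assumes "3 \<le> d" shows "k \<le> level_size d k"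
proof (induction k)
  case (Suc k)
  have "1 * 1 * 1 \<le> 2 ^ Suc k * (d - 2) * Suc (level_size d k)"
    using assms by (intro mult_le_mono) auto
  then show ?case using Suc by simp
qed simp

lemma le_least_level: "3 \<le> d \<Longrightarrow> n \<le> level_size d (least_level d n)"
  unfolding least_level_def by (rule LeastI[of _ n]) (rule level_size_ge)

lemma least_level_le: "n \<le> level_size d k \<Longrightarrow> least_level d n \<le> k"
  unfolding least_level_def by (rule Least_le)

lemma level_cost_mono: "mono level_cost"
  by (rule incseq_SucI) simp

text \<open>Adding 3 absorbs the constant of the recurrence: from one level to the next,
  \<open>level_cost k + 3\<close> doubles and gains \<open>2 * 2 ^ Suc k\<close>.\<close>

lemma level_cost_le: "level_cost k + 3 \<le> (2 * k + 3) * 2 ^ k"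
  by (induction k) (simp_all add: algebra_simps)

text \<open>From level \<open>k\<close> to the next, \<open>Suc (level_size d k)\<close> grows at
  least by the factor \<open>2 ^ Suc k * (d - 2)\<close>. The logarithms of these factors add up to
  a triangular number and \<open>k\<close> copies of \<open>log 2 (d - 2)\<close>.\<close>

lemma level_size_log:
  assumes "3 \<le> d"
  shows "real k * (real k + 1) / 2 + real k * log 2 (real d - 2) \<le> log 2 (Suc (level_size d k))"
proof (induction k)
  case (Suc k)
  define s where "s = real (Suc (level_size d k))"
  have s: "s > 0" by (simp add: s_def)
  have pos: "real d - 2 > 0" using assms by simp
  have "real (2 ^ Suc k * (d - 2) * Suc (level_size d k)) \<le> real (Suc (level_size d (Suc k)))"
    by (simp only: of_nat_le_iff level_size.simps le_add2)
  moreover have "real (2 ^ Suc k * (d - 2) * Suc (level_size d k)) = 2 ^ Suc k * ((real d - 2) * s)"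
    using assms unfolding s_def by (simp only: of_nat_mult of_nat_power of_nat_diff) simp
  ultimately have "log 2 (2 ^ Suc k * ((real d - 2) * s)) \<le> log 2 (Suc (level_size d (Suc k)))"
    using s pos by (subst log_le_cancel_iff) (auto simp del: level_size.simps of_nat_Suc)
  moreover have "log 2 (2 ^ Suc k * ((real d - 2) * s)) = real (Suc k) + log 2 (real d - 2) + log 2 s"
    using s pos by (simp add: log_mult log_nat_power del: power_Suc)
  ultimately have "log 2 s + (real (Suc k) + log 2 (real d - 2)) \<le> log 2 (Suc (level_size d (Suc k)))"
    by linarith
  moreover have "real (Suc k) * (real (Suc k) + 1) / 2 + real (Suc k) * log 2 (real d - 2) =
      (real k * (real k + 1) / 2 + real k * log 2 (real d - 2)) + (real (Suc k) + log 2 (real d - 2))"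
    by (simp add: field_simps)
  ultimately show ?case using Suc unfolding s_def by argo
qed simp

lemma recourse_bound_le:
  assumes d: "3 \<le> d" and N: "N \<ge> 1"
    and L: "L = sqrt (2 * log 2 (real N))" "L \<ge> 1" "(log 2 (real d - 2))\<^sup>2 + 1 \<le> 2 * L"
  shows "real (recourse_bound d N) \<le>
    72 * (1 / (real d - 2) * sqrt (log 2 (real N)) * 2 powr sqrt (2 * log 2 (real N)))"
proof -
  define lam where "lam = log 2 (real d - 2)"
  have pos: "real d - 2 > 0" "real d - 2 \<ge> 1" using d by auto
  then have lam: "lam \<ge> 0" by (simp add: lam_def)
  define k where "k = least_level d (Suc N)"
  have "k \<noteq> 0" using le_least_level[OF d, of "Suc N"] by (cases k) (auto simp: k_def)
  then obtain m where m: "k = Suc m" by (cases k) auto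
  \<comment> \<open>The level just below the least one is too small for \<open>Suc N\<close>
    vertices; this bounds \<open>m\<close> from above.\<close>
  have "\<not> Suc N \<le> level_size d m"
    using least_level_le[of "Suc N" d m] m by (auto simp: k_def)
  then have "Suc (level_size d m) \<le> 2 * N" using N by simp
  then have "log 2 (Suc (level_size d m)) \<le> log 2 (2 * real N)"
    using N by (subst log_le_cancel_iff) auto
  also have "\<dots> = 1 + log 2 N" using N by (simp add: log_mult)
  finally have "log 2 (Suc (level_size d m)) \<le> 1 + log 2 N" .
  moreover define A where "A = real m * (real m + 1) / 2 + real m * lam"
  ultimately have "A \<le> 1 + log 2 N"
    using level_size_log[OF d, of m] unfolding lam_def by argo
  moreover have "(real m + lam)\<^sup>2 + real m = 2 * A + lam\<^sup>2"
    by (simp add: A_def power2_eq_square field_simps)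
  ultimately have "(real m + lam)\<^sup>2 + real m \<le> 2 + 2 * log 2 N + lam\<^sup>2" by argo
  moreover have "2 * log 2 N = L\<^sup>2" using L(1) N by simp
  \<comment> \<open>The sum \<open>2 + L^2 + lam^2\<close> is at most \<open>(L + 1)^2\<close>
    exactly when \<open>lam^2 + 1 \<le> 2 L\<close>; this is where the third condition on
    \<open>L\<close> comes from.\<close>
  ultimately have "(real m + lam)\<^sup>2 \<le> (L + 1)\<^sup>2"
    using L(3) unfolding lam_def[symmetric] by (simp add: power2_eq_square algebra_simps)
  then have ml: "real m + lam \<le> L + 1" by (rule power2_le_imp_le) (use L(2) in linarith)
  have "2 ^ k = 2 * 2 powr real m" by (simp add: m powr_realpow)
  also have "\<dots> \<le> 2 * 2 powr (L + 1 - lam)" using ml by simp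
  also have "\<dots> = 4 * 2 powr L / (real d - 2)"
    using pos by (simp add: powr_diff powr_add lam_def)
  finally have 1: "2 ^ k \<le> 4 * 2 powr L / (real d - 2)" .
  \<comment> \<open>Indeed \<open>2 k + 3 = 2 m + 5 \<le> 2 L + 7\<close> and
    \<open>L \<ge> 1\<close>. With the factor 4 from above and
    \<open>L = sqrt 2 * sqrt (log 2 N)\<close>, the constant is
    \<open>36 * sqrt 2 < 72\<close>.\<close>
  have 2: "real (2 * k + 3) \<le> 9 * L" using ml lam L(2) m by simp
  have "real (recourse_bound d N) \<le> real ((2 * k + 3) * 2 ^ k)"
    using level_cost_le[of k] unfolding recourse_bound_def k_def[symmetric] by linarith
  also have "\<dots> = real (2 * k + 3) * 2 ^ k" by simp
  also have "\<dots> \<le> (9 * L) * (4 * 2 powr L / (real d - 2))"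
    using 1 2 by (intro mult_mono) auto
  also have "L = sqrt 2 * sqrt (log 2 N)" using L(1) by (simp add: real_sqrt_mult)
  then have "(9 * L) * (4 * 2 powr L / (real d - 2)) =
      36 * sqrt 2 * (1 / (real d - 2) * sqrt (log 2 N) * 2 powr L)"
    by simp
  also have "\<dots> \<le> 72 * (1 / (real d - 2) * sqrt (log 2 N) * 2 powr L)"
    using pos N sqrt2_less_2 by (intro mult_right_mono) auto
  finally show ?thesis using L(1) by simp
qed

text \<open>From \<open>N \<ge> 2 powr c^2\<close> follows
  \<open>sqrt (2 * log 2 N) \<ge> c\<close>, more than \<open>recourse_bound_le\<close> asks for.
  The start of the range depends on \<open>d\<close>; the constant 72 does not.\<close>

lemma recourse_bound_eventually:
  assumes d: "3 \<le> d"
  shows "\<forall>\<^sub>F N in sequentially. real (recourse_bound d N) \<le>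
    72 * (1 / (real d - 2) * sqrt (log 2 (real N)) * 2 powr sqrt (2 * log 2 (real N)))"
proof -
  define c where "c = (log 2 (real d - 2))\<^sup>2 + 1"
  have c: "c \<ge> 1" by (simp add: c_def)
  show ?thesis
  proof (rule eventually_sequentiallyI)
    fix N assume N: "nat \<lceil>2 powr (c\<^sup>2)\<rceil> \<le> N"
    then have N': "2 powr (c\<^sup>2) \<le> real N" by linarith
    moreover have "0 < 2 powr (c\<^sup>2)" by simp
    ultimately have "0 < real N" by linarith
    then have "c\<^sup>2 \<le> log 2 N" using N' by (simp add: le_log_iff)
    then have "c\<^sup>2 \<le> 2 * log 2 N" using zero_le_power2[of c] by linarith
    then have L: "c \<le> sqrt (2 * log 2 N)" by (rule real_le_rsqrt)
    show "real (recourse_bound d N) \<le>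
        72 * (1 / (real d - 2) * sqrt (log 2 (real N)) * 2 powr sqrt (2 * log 2 (real N)))"
    proof (rule recourse_bound_le[OF d _ refl])
      show "1 \<le> N" using \<open>0 < real N\<close> by simp
      show "1 \<le> sqrt (2 * log 2 N)" using L c by linarith
      show "(log 2 (real d - 2))\<^sup>2 + 1 \<le> 2 * sqrt (2 * log 2 N)"
        using L c unfolding c_def by linarith
    qed
  qed
qed

context bfs_tree begin

lemma bfs_recolor_tree:
  assumes "3 \<le> d" and inv: "bfs_inv Q \<pi> (length Q) i"
  shows "\<exists>ix sz. recolor_tree d N T \<pi> r out ix sz"
proof -
  note fin = bfs_finished[OF inv]
  have pir: "\<pi> r = out" using inv unfolding bfs_inv_def by blast
  obtain ix :: "'a \<Rightarrow> nat" where ix: "\<forall>x \<in> T. \<pi> x \<in> T \<longrightarrow> ix (\<pi> x) < ix x"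
    using bfs_index[OF inv] by blast
  obtain sz :: "'a \<Rightarrow> nat" where sz: "\<forall>x \<in> T. sz x = 1 + (\<Sum>y | y \<in> T \<and> \<pi> y = x. sz y)"
    using subtree_size_exists[of T \<pi> ix] finite_T ix by blast
  have "recolor_tree d N T \<pi> r out ix sz"
  proof
    show "\<pi> x \<in> T" if "x \<in> T" "x \<noteq> r" for x
      using bfs_inv_parent_edge(1)[OF inv, of x] fin(1) that by simp
    show "y \<in> N x \<longleftrightarrow> x \<in> N y" for x y by (rule nbrs_sym)
  qed (use assms finite_T component_refl[of r E] out pir fin ix sz in auto)
  then show ?thesis by blast
qed

end

section \<open>Linking two trees\<close>

text \<open>A colouring is a function of the unordered pair; the symmetry of \<open>h\<close> makes
  the choice of an orientation irrelevant.\<close>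

lemma coloring_of_half:
  fixes h :: "'a \<Rightarrow> 'a \<Rightarrow> nat"
  assumes E: "simple_graph V E" and sym: "\<And>x y. y \<in> nbrs E x \<Longrightarrow> h x y = h y x"
    and inj: "\<And>x. inj_on (h x) (nbrs E x)" and lt: "\<And>x y. y \<in> nbrs E x \<Longrightarrow> h x y < d"
  shows "\<exists>col. (\<forall>x y. {x, y} \<in> E \<longrightarrow> col {x, y} = h x y) \<and> proper_coloring d E col"
proof -
  define col where "col f = (SOME c. \<exists>x y. f = {x, y} \<and> y \<in> nbrs E x \<and> c = h x y)" for f
  have col: "col {x, y} = h x y" if "{x, y} \<in> E" for x y
  proof -
    have y: "y \<in> nbrs E x" using that by (simp add: nbrs_def)
    show ?thesis unfolding col_def
    proof (rule some_equality)
      fix c assume "\<exists>x' y'. {x, y} = {x', y'} \<and> y' \<in> nbrs E x' \<and> c = h x' y'"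
      then show "c = h x y" using sym[OF y] by (auto simp: doubleton_eq_iff)
    qed (use y in blast)
  qed
  moreover have "proper_coloring d E col"
    unfolding proper_coloring_def
  proof (intro conjI ballI impI)
    fix f assume "f \<in> E"
    then obtain x y where "f = {x, y}" using E unfolding simple_graph_def by blast
    then show "col f < d" using col lt \<open>f \<in> E\<close> by (auto simp: nbrs_def)
  next
    fix f g assume fg: "f \<in> E" "g \<in> E" "f \<noteq> g \<and> f \<inter> g \<noteq> {}"
    then obtain x where x: "x \<in> f" "x \<in> g" by blast
    have "\<exists>y. f = {x, y}" if "f \<in> E" "x \<in> f" for f
    proof -
      obtain a b where "f = {a, b}" using E \<open>f \<in> E\<close> unfolding simple_graph_def by blast
      then show ?thesis using \<open>x \<in> f\<close> by auto
    qed
    then obtain y z where yz: "f = {x, y}" "g = {x, z}" using fg x by metis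
    then have "h x y \<noteq> h x z" using inj_onD[OF inj, of x y z] fg by (auto simp: nbrs_def)
    then show "col f \<noteq> col g" using col yz fg by simp
  qed
  ultimately show ?thesis by blast
qed

text \<open>The colours of the new edge as seen from its two ends are chosen independently.\<close>

definition half_coloring :: "('a set \<Rightarrow> nat) \<Rightarrow> 'a \<Rightarrow> 'a \<Rightarrow> nat \<Rightarrow> nat \<Rightarrow> 'a \<Rightarrow> 'a \<Rightarrow> nat" where
  "half_coloring col u v a b x y =
     (if x = u \<and> y = v then a else if x = v \<and> y = u then b else col {x, y})"

locale link =
  fixes d :: nat and V :: "'a set" and E :: "'a set set" and col :: "'a set \<Rightarrow> nat" and u v :: 'a
  assumes inst: "link_instance d V E col u v" and d3: "3 \<le> d"
begin

abbreviation E' :: "'a set set" where "E' \<equiv> insert {u, v} E"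

abbreviation H :: "nat \<Rightarrow> nat \<Rightarrow> 'a \<Rightarrow> 'a \<Rightarrow> nat" where "H \<equiv> half_coloring col u v"

lemma forest: "forest V E" and proper: "proper_coloring d E col"
  and uv_V: "u \<in> V" "v \<in> V" and v_notin: "v \<notin> component E u"
  and deg_le: "max_degree_le V (insert {u, v} E) d"
  using inst by (auto simp: link_instance_def)

lemma simple: "simple_graph V E"
  using forest by (simp add: forest_def)

lemma u_neq_v: "u \<noteq> v"
  using v_notin component_refl by metis

lemma new_edge: "{u, v} \<notin> E"
  using v_notin component_step[OF component_refl, of v E u] by (auto simp: nbrs_def)

lemma simple': "simple_graph V E'"
  using simple uv_V u_neq_v by (auto simp: simple_graph_def)

lemma nbrs_insert:
  "nbrs E' x =
    nbrs E x \<union> (if x = u then {v} else {}) \<union> (if x = v then {u} else {})"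
  by (auto simp: nbrs_def doubleton_eq_iff)

lemma nbrs_uv: "v \<notin> nbrs E u" "u \<notin> nbrs E v"
  using new_edge by (auto simp: nbrs_def insert_commute)

lemma col_lt: "y \<in> nbrs E x \<Longrightarrow> col {x, y} < d"
  using proper by (simp add: proper_coloring_def nbrs_def)

lemma col_inj: "inj_on (\<lambda>y. col {x, y}) (nbrs E x)"
proof (rule inj_onI, rule ccontr)
  fix y z assume "y \<in> nbrs E x" "z \<in> nbrs E x" "col {x, y} = col {x, z}" "y \<noteq> z"
  then show False using proper by (auto simp: proper_coloring_def nbrs_def doubleton_eq_iff)
qed

lemma degree_less: "w \<in> {u, v} \<Longrightarrow> degree E w < d"
proof -
  assume w: "w \<in> {u, v}"
  then have "nbrs E' w = insert (if w = u then v else u) (nbrs E w)"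
    using u_neq_v by (auto simp: nbrs_insert)
  moreover have "(if w = u then v else u) \<notin> nbrs E w" using w nbrs_uv by auto
  ultimately have "degree E' w = Suc (degree E w)"
    using finite_nbrs[OF simple, of w]
    by (simp add: degree_eq_card_nbrs[OF simple] degree_eq_card_nbrs[OF simple'])
  moreover have "degree E' w \<le> d"
    using deg_le w uv_V by (auto simp: max_degree_le_def)
  ultimately show ?thesis by simp
qed

definition free :: "'a \<Rightarrow> nat \<Rightarrow> bool" where
  "free w c \<longleftrightarrow> c < d \<and> (\<forall>y \<in> nbrs E w. col {w, y} \<noteq> c)"

lemma free_exists: "w \<in> {u, v} \<Longrightarrow> \<exists>c. free w c"
proof (rule ccontr)
  assume w: "w \<in> {u, v}" and "\<nexists>c. free w c"
  then have "{..<d} \<subseteq> (\<lambda>y. col {w, y}) ` nbrs E w" by (auto simp: free_def)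
  then have "card {..<d} \<le> card (nbrs E w)"
    using finite_nbrs[OF simple, of w]
    by (meson card_image_le card_mono finite_imageI le_trans)
  then show False using degree_less[OF w] by (simp add: degree_eq_card_nbrs[OF simple])
qed

lemma half_valid:
  assumes "free u a" "free v b"
  shows "inj_on (H a b x) (nbrs E' x)"
    "y \<in> nbrs E' x \<Longrightarrow> H a b x y < d"
proof -
  have new: "y \<in> nbrs E x \<Longrightarrow> \<not> (x = u \<and> y = v)" "y \<in> nbrs E x \<Longrightarrow> \<not> (x = v \<and> y = u)" for x y
    using nbrs_uv by auto
  show "inj_on (H a b x) (nbrs E' x)"
  proof (rule inj_onI)
    fix y z
    assume y: "y \<in> nbrs E' x" and z: "z \<in> nbrs E' x"
      and eq: "H a b x y = H a b x z"
    show "y = z"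
      using y z eq new[of y x] new[of z x] assms u_neq_v inj_onD[OF col_inj[of x], of y z]
      by (auto simp: nbrs_insert half_coloring_def free_def split: if_splits)
  qed
  show "y \<in> nbrs E' x \<Longrightarrow> H a b x y < d"
    using assms u_neq_v col_lt by (auto simp: nbrs_insert half_coloring_def free_def split: if_splits)
qed

lemma neighbour_enum_exists:
  "\<exists>nbf. \<forall>x. bij_betw (nbf x) {..<card (nbrs E' x)} (nbrs E' x)"
  unfolding lessThan_atLeast0
  by (intro choice allI ex_bij_betw_nat_finite finite_nbrs[OF simple'])

lemma root_cases:
  assumes "(r, out) = (u, v) \<or> (r, out) = (v, u)"
  shows "{r, out} = {u, v}" "r \<in> V" "out \<notin> component E r"
  using assms uv_V v_notin component_sym[of u E v] by auto

lemma bfs_tree_link: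
  assumes "(r, out) = (u, v) \<or> (r, out) = (v, u)"
    and "\<And>x. x \<in> component E r \<Longrightarrow> bij_betw (nbf x) {..<dg x} (nbrs E' x)"
  shows "bfs_tree V E r out nbf dg"
  using root_cases[OF assms(1)] assms(2) forest by unfold_locales auto

text \<open>The only possible disagreement at the start is on the new edge, the parent edge of
  \<open>r\<close>. The end \<open>out\<close> keeps its colour \<open>q\<close>, and the single
  task asks \<open>r\<close> to adopt it; if the two free colours coincide, nothing has to be
  done.\<close>

lemma rc_inv_init:
  assumes rt: "recolor_tree d (nbrs E') T \<pi> r out ix sz"
    and ro: "(r, out) = (u, v) \<or> (r, out) = (v, u)"
    and ab: "free u a" "free v b" and pq: "p = H a b r out"
      "q = H a b out r"
    and k: "sz r \<le> level_size d k" and R: "Suc (level_cost k) \<le> R"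
  shows "recolor_tree.rc_inv d (nbrs E') T \<pi> sz col R {{u, v}}
    (H a b) (if p = q then [] else [(r, p, q, k)])"
proof -
  interpret recolor_tree d "nbrs E'" T \<pi> r out ix sz by (rule rt)
  have col: "H a b x y = col {x, y}"
    if "\<not> (x = u \<and> y = v)" "\<not> (x = v \<and> y = u)" for x y
    unfolding half_coloring_def by (simp only: that if_False)
  have eq: "H a b x y = H a b y x"
    if xy: "\<not> (x = u \<and> y = v)" "\<not> (x = v \<and> y = u)" for x y
  proof -
    have "{y, x} = {x, y}" by auto
    moreover have "H a b y x = col {y, x}" by (rule col) (use xy in blast)+
    ultimately show ?thesis using col[OF xy] by argo
  qed
  have 1: "valid (H a b)"
    using half_valid[OF ab] unfolding valid_def by blast
  have 2: "task_ok {{u, v}} (H a b) (r, p, q, k)" if "p \<noteq> q"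
    using rT pq pir k that root_cases(1)[OF ro] by (simp add: task_ok_def)
  have 3: "agree (fst ` set (if p = q then [] else [(r, p, q, k)])) (H a b) x y"
    for x y
  proof (cases "x = u \<and> y = v \<or> x = v \<and> y = u")
    case True
    then show ?thesis using pq ro pir by (auto simp: agree_def)
  next
    case False
    then show ?thesis using eq[of x y] by (auto simp: agree_def)
  qed
  have 4: "H a b x y = col {x, y}" if "{x, y} \<noteq> {u, v}" for x y
    by (rule col) (use that in \<open>auto simp: doubleton_eq_iff\<close>)
  have 5: "task_cost d k (sz r) \<le> level_cost k" by (rule task_cost_le[OF d3 k])
  show ?thesis
    unfolding rc_inv_def using 1 2 3 4 5 R by auto
qed

text \<open>Without open tasks all views agree, and an edge outside \<open>X\<close> still has its
  old colour, so \<open>card X\<close> bounds the recourse.\<close>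

lemma rc_inv_final:
  assumes rt: "recolor_tree d (nbrs E') T \<pi> r out ix sz"
    and inv: "recolor_tree.rc_inv d (nbrs E') T \<pi> sz col R X h []"
  shows "\<exists>col'. (\<forall>x y. {x, y} \<in> E' \<longrightarrow> col' {x, y} = h x y) \<and>
    proper_coloring d E' col' \<and> recourse E col col' \<le> R"
proof -
  interpret recolor_tree d "nbrs E'" T \<pi> r out ix sz by (rule rt)
  have h: "h x y = h y x" "h x y < d" if "y \<in> nbrs E' x" for x y
    using inv that by (auto simp: rc_inv_def agree_def valid_def)
  have "inj_on (h x) (nbrs E' x)" for x
    using inv by (auto simp: rc_inv_def valid_def)
  then obtain col' where col': "\<And>x y. {x, y} \<in> E' \<Longrightarrow> col' {x, y} = h x y"
      "proper_coloring d E' col'"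
    using coloring_of_half[OF simple', of h d] h by blast
  have "{f \<in> E. col' f \<noteq> col f} \<subseteq> X"
  proof
    fix f assume f: "f \<in> {f \<in> E. col' f \<noteq> col f}"
    then obtain x y where xy: "f = {x, y}" using simple unfolding simple_graph_def by blast
    then have "y \<in> nbrs E' x" "h x y \<noteq> col {x, y}"
      using f col'(1)[of x y] by (auto simp: nbrs_def)
    then show "f \<in> X" using inv xy unfolding rc_inv_def by blast
  qed
  moreover have "finite X" "card X \<le> R" using inv by (auto simp: rc_inv_def)
  ultimately have "recourse E col col' \<le> R"
    unfolding recourse_def by (meson card_mono le_trans)
  then show ?thesis using col' by blast
qed

lemma link_recolor:
  "\<exists>col'. proper_coloring d E' col' \<and>
    recourse E col col' \<le> recourse_bound d (smaller_size E u v)"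
proof -
  obtain r out where ro: "(r, out) = (u, v) \<or> (r, out) = (v, u)"
    and small: "card (tree_edges E r) = smaller_size E u v"
    unfolding smaller_size_def min_def by (metis (full_types))
  obtain nbf where nbf: "\<forall>x. bij_betw (nbf x) {..<card (nbrs E' x)}
      (nbrs E' x)"
    using neighbour_enum_exists by blast
  interpret bfs_tree V E r out nbf "\<lambda>x. card (nbrs E' x)"
    by (rule bfs_tree_link[OF ro nbf[rule_format]])
  obtain Q \<pi> where inv: "bfs_inv Q \<pi> (length Q) 0" using bfs_exists by blast
  obtain ix sz where rt: "recolor_tree d (nbrs E') (component E r) \<pi> r out ix sz"
    using bfs_recolor_tree[OF d3 inv] root_cases(1)[OF ro] by auto
  interpret rt: recolor_tree d "nbrs E'" "component E r" \<pi> r out ix sz by (rule rt)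
  obtain a b where ab: "free u a" "free v b" using free_exists by blast
  define k where "k = least_level d (Suc (smaller_size E u v))"
  have "sz r \<le> level_size d k"
    using le_least_level[OF d3, of "Suc (smaller_size E u v)"] card_T_le rt.sz_root small
    by (simp add: k_def)
  from rc_inv_init[OF rt ro ab refl refl this order_refl]
  obtain X h where "rt.rc_inv col (Suc (level_cost k)) X h []"
    using rt.rc_exists by blast
  from rc_inv_final[OF rt this] show ?thesis by (auto simp: k_def recourse_bound_def)
qed

end

section \<open>Colour tables in memory\<close>

text \<open>The analogue of \<open>represents\<close> for views. It also describes states in which
  the ends of an edge disagree, or in which only one end knows the edge, since each block concerns
  its own vertex alone.\<close>

definition rep :: "nat \<Rightarrow> nat set \<Rightarrow> (nat \<Rightarrow> nat set) \<Rightarrow> nat view \<Rightarrow>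
    (string \<Rightarrow> nat \<Rightarrow> nat) \<Rightarrow> bool" where
  "rep d V nb h A \<longleftrightarrow> (\<forall>x\<in>V.
     A ''row'' x = x * d \<and> A ''deg'' x = card (nb x) \<and>
     (\<forall>c<d. A ''pos'' (x * d + c) < d \<and> A ''cols'' (x * d + A ''pos'' (x * d + c)) = c \<and>
        (A ''pos'' (x * d + c) < card (nb x) \<longleftrightarrow> c \<in> h x ` nb x)) \<and>
     (\<forall>y \<in> nb x. A ''nbr'' (x * d + h x y) = y))"

lemma represents_iff_rep:
  assumes "simple_graph V E" "\<And>x y. {x, y} \<in> E \<Longrightarrow> col {x, y} = h x y"
  shows "represents d V E col s \<longleftrightarrow> rep d V (nbrs E) h (arr s)"
proof -
  have "(\<exists>y. {x, y} \<in> E \<and> col {x, y} = c) \<longleftrightarrow> c \<in> h x ` nbrs E x" for x c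
    using assms(2) by (auto simp: nbrs_def)
  moreover have "(\<forall>y. {x, y} \<in> E \<longrightarrow> F (x * d + col {x, y}) = y) \<longleftrightarrow>
      (\<forall>y \<in> nbrs E x. F (x * d + h x y) = y)" for x and F :: "nat \<Rightarrow> nat"
    using assms(2) by (auto simp: nbrs_def)
  ultimately show ?thesis
    unfolding represents_def rep_def degree_eq_card_nbrs[OF assms(1)] by simp
qed

lemma rep_cong:
  assumes "rep d V nb h A" "\<And>a. a \<in> {''row'', ''deg'', ''pos'', ''cols'', ''nbr''} \<Longrightarrow> B a = A a"
  shows "rep d V nb h B"
  using assms by (simp add: rep_def)

lemma rep_upd [simp]:
  assumes "a \<notin> {''row'', ''deg'', ''pos'', ''cols'', ''nbr''}"
  shows "rep d V nb h (A(a := f)) = rep d V nb h A"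
proof -
  have *: "(A(a := f)) b = A b" if "b \<in> {''row'', ''deg'', ''pos'', ''cols'', ''nbr''}" for b
    using assms that by (metis fun_upd_other)
  show ?thesis
    by (rule iffI; erule rep_cong) (rule *[symmetric] *, assumption)+
qed

lemma block_inj:
  fixes c c' d :: nat
  assumes "x * d + c = y * d + c'" "c < d" "c' < d"
  shows "x = y" "c = c'"
proof -
  have "(x * d + c) div d = x" "(y * d + c') div d = y" using assms(2,3) by simp_all
  then show "x = y" using assms(1) by metis
  then show "c = c'" using assms(1) by simp
qed

text \<open>Having \<open>cols\<close> as a left inverse, \<open>pos\<close> is injective on the
  finite set of colours and therefore bijective; so \<open>cols\<close> inverts it from the other
  side too.\<close>

lemma rep_cols:
  assumes "rep d V nb h A" "x \<in> V" "i < d"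
  shows "A ''cols'' (x * d + i) < d" "A ''pos'' (x * d + A ''cols'' (x * d + i)) = i"
proof -
  define P where "P c = A ''pos'' (x * d + c)" for c
  have P: "P c < d" "A ''cols'' (x * d + P c) = c" if "c < d" for c
    using assms(1,2) that by (auto simp: rep_def P_def)
  have "inj_on P {..<d}" using P(2) by (metis inj_onI lessThan_iff)
  moreover have "P ` {..<d} \<subseteq> {..<d}" using P(1) by auto
  ultimately have "P ` {..<d} = {..<d}" by (intro endo_inj_surj) auto
  then obtain c where "c < d" "i = P c" using assms(3) by (auto simp: set_eq_iff image_iff)
  then show "A ''cols'' (x * d + i) < d" "A ''pos'' (x * d + A ''cols'' (x * d + i)) = i"
    using P by (auto simp: P_def)
qed

lemma rep_used:
  assumes "rep d V nb h A" "x \<in> V" "c < d"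
  shows "A ''pos'' (x * d + c) < A ''deg'' x \<longleftrightarrow> c \<in> h x ` nb x"
    "y \<in> nb x \<Longrightarrow> A ''nbr'' (x * d + h x y) = y"
  using assms by (simp_all add: rep_def)

lemma rep_row: "rep d V nb h A \<Longrightarrow> x \<in> V \<Longrightarrow> A ''row'' x = x * d"
  by (simp add: rep_def)

definition table_nb :: "(string \<Rightarrow> nat \<Rightarrow> nat) \<Rightarrow> nat \<Rightarrow> nat \<Rightarrow> nat" where
  "table_nb A x i = A ''nbr'' (A ''row'' x + A ''cols'' (A ''row'' x + i))"

text \<open>The first \<open>deg[x]\<close> entries of \<open>cols\<close> are the used colours, and
  reading \<open>nbr\<close> along them lists each neighbour once. This supplies the enumeration for
  the search.\<close>

lemma rep_table_nb:
  assumes rep: "rep d V nb h A" and x: "x \<in> V"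
    and inj: "inj_on (h x) (nb x)" and lt: "\<And>y. y \<in> nb x \<Longrightarrow> h x y < d"
  shows "bij_betw (table_nb A x) {..<A ''deg'' x} (nb x)"
proof -
  have row: "A ''row'' x = x * d" and deg: "A ''deg'' x = card (nb x)"
    using rep x by (auto simp: rep_def)
  have "card (nb x) = card (h x ` nb x)" using inj by (simp add: card_image)
  also have "\<dots> \<le> card {..<d}" by (rule card_mono) (use lt in auto)
  finally have le: "card (nb x) \<le> d" by simp
  have *: "table_nb A x i \<in> nb x \<and> A ''pos'' (x * d + h x (table_nb A x i)) = i"
    if "i < card (nb x)" for i
  proof -
    define c where "c = A ''cols'' (x * d + i)"
    have c: "c < d" "A ''pos'' (x * d + c) = i"
      using rep_cols[OF rep x, of i] that le by (auto simp: c_def)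
    then have "c \<in> h x ` nb x" using rep_used(1)[OF rep x] that deg by auto
    then obtain y where y: "y \<in> nb x" "c = h x y" by blast
    then have "table_nb A x i = y"
      using rep x by (simp add: table_nb_def row c_def[symmetric] rep_def)
    then show ?thesis using y c by simp
  qed
  show ?thesis
    unfolding bij_betw_def deg
  proof
    show "inj_on (table_nb A x) {..<card (nb x)}"
      using * by (metis inj_onI lessThan_iff)
    show "table_nb A x ` {..<card (nb x)} = nb x"
    proof
      show "nb x \<subseteq> table_nb A x ` {..<card (nb x)}"
      proof
        fix y assume y: "y \<in> nb x"
        then have "A ''pos'' (x * d + h x y) < card (nb x)"
          "A ''cols'' (x * d + A ''pos'' (x * d + h x y)) = h x y"
          "A ''nbr'' (x * d + h x y) = y"
          using rep x lt[OF y] by (auto simp: rep_def)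
        then show "y \<in> table_nb A x ` {..<card (nb x)}"
          by (intro image_eqI[of _ _ "A ''pos'' (x * d + h x y)"]) (auto simp: table_nb_def row)
      qed
    qed (use * in auto)
  qed
qed

text \<open>The first free colour stands right behind the used ones, so raising
  \<open>deg[x]\<close> by one turns it into a used colour; no entry of \<open>cols\<close> or
  \<open>pos\<close> has to move.\<close>

lemma rep_add:
  assumes rep: "rep d V nb h A" and x: "x \<in> V"
    and y: "y \<notin> nb x" and fin: "finite (nb x)" and deg: "card (nb x) < d"
    and lt: "\<And>z. z \<in> nb x \<Longrightarrow> h x z < d" "\<And>x z. x \<in> V \<Longrightarrow> z \<in> nb x \<Longrightarrow> h x z < d"
    and c: "c = A ''cols'' (A ''row'' x + A ''deg'' x)"
    and B: "B = A(''nbr'' := (A ''nbr'')(A ''row'' x + c := y),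
      ''deg'' := (A ''deg'')(x := A ''deg'' x + 1))"
  shows "c < d" "c \<notin> h x ` nb x"
    "rep d V (nb(x := insert y (nb x))) (h(x := (h x)(y := c))) B"
proof -
  have row: "A ''row'' x = x * d" and dg: "A ''deg'' x = card (nb x)"
    using rep x by (auto simp: rep_def)
  show cd: "c < d" using rep_cols(1)[OF rep x deg] by (simp add: c row dg)
  have pos: "A ''pos'' (x * d + c) = card (nb x)"
    using rep_cols(2)[OF rep x deg] by (simp add: c row dg)
  show notin: "c \<notin> h x ` nb x" using rep x cd pos by (fastforce simp: rep_def)
  have img: "(h(x := (h x)(y := c))) x ` (nb(x := insert y (nb x))) x = insert c (h x ` nb x)"
    using y by auto
  show "rep d V (nb(x := insert y (nb x))) (h(x := (h x)(y := c))) B"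
    unfolding rep_def
  proof (intro ballI)
    fix z assume z: "z \<in> V"
    have nbr: "B ''nbr'' (z * d + c') = (if z = x \<and> c' = c then y else A ''nbr'' (z * d + c'))"
      if "c' < d" for c'
      using block_inj[of z d c' x c] that cd by (auto simp: B row)
    have same: "B ''row'' = A ''row''" "B ''pos'' = A ''pos''" "B ''cols'' = A ''cols''"
      by (simp_all add: B)
    show "B ''row'' z = z * d \<and> B ''deg'' z = card ((nb(x := insert y (nb x))) z) \<and>
      (\<forall>c'<d. B ''pos'' (z * d + c') < d \<and> B ''cols'' (z * d + B ''pos'' (z * d + c')) = c' \<and>
        (B ''pos'' (z * d + c') < card ((nb(x := insert y (nb x))) z) \<longleftrightarrow>
          c' \<in> (h(x := (h x)(y := c))) z ` (nb(x := insert y (nb x))) z)) \<and>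
      (\<forall>y' \<in> (nb(x := insert y (nb x))) z.
        B ''nbr'' (z * d + (h(x := (h x)(y := c))) z y') = y')"
    proof (cases "z = x")
      case False
      then have "B ''deg'' z = A ''deg'' z" by (simp add: B)
      then show ?thesis using False rep z nbr lt(2)[OF z] by (simp add: same rep_def)
    next
      case True
      have "B ''deg'' x = card (insert y (nb x))" using fin y by (simp add: B dg)
      moreover have "A ''pos'' (x * d + c') < card (insert y (nb x)) \<longleftrightarrow>
          c' \<in> insert c (h x ` nb x)" if "c' < d" for c'
      proof -
        have "A ''pos'' (x * d + c') = card (nb x) \<longleftrightarrow> c' = c"
          using rep x that cd pos unfolding rep_def by metis
        moreover have "A ''pos'' (x * d + c') < card (nb x) \<longleftrightarrow> c' \<in> h x ` nb x"
          using rep x that by (simp add: rep_def)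
        ultimately show ?thesis using fin y by (auto simp: less_Suc_eq)
      qed
      moreover have "B ''nbr'' (x * d + ((h x)(y := c)) y') = y'" if "y' \<in> insert y (nb x)" for y'
      proof (cases "y' = y")
        case True
        then show ?thesis using nbr[of c] \<open>z = x\<close> cd by simp
      next
        case False
        then have "y' \<in> nb x" using that by simp
        moreover then have "h x y' \<noteq> c" using notin by auto
        ultimately show ?thesis using False nbr[of "h x y'"] \<open>z = x\<close> lt rep x by (simp add: rep_def)
      qed
      ultimately show ?thesis
        using True img rep x by (simp add: same rep_def)
    qed
  qed
qed

text \<open>Swapping two colours conjugates the tables, whether or not the colours are used.\<close>

definition flip_tables :: "nat \<Rightarrow> nat \<Rightarrow> nat \<Rightarrow> (string \<Rightarrow> nat \<Rightarrow> nat) \<Rightarrow> string \<Rightarrow> nat \<Rightarrow> nat" where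
  "flip_tables w p q A =
    (let R = A ''row'' w; i = A ''pos'' (R + p); j = A ''pos'' (R + q) in
     A(''cols'' := (A ''cols'')(R + i := q, R + j := p),
       ''pos'' := (A ''pos'')(R + p := j, R + q := i),
       ''nbr'' := (A ''nbr'')(R + p := A ''nbr'' (R + q), R + q := A ''nbr'' (R + p))))"

text \<open>On the block of \<open>w\<close>, \<open>pos\<close> and \<open>nbr\<close> are
  precomposed with \<open>swp p q\<close> and \<open>cols\<close> is postcomposed; the clauses of
  \<open>rep\<close> follow because \<open>swp p q\<close> is an involution. The case
  \<open>p = q\<close>, in which nothing changes, is included.\<close>

lemma rep_flip:
  assumes rep: "rep d V nb h A" and w: "w \<in> V" and p: "p < d" and q: "q < d"
    and lt: "\<And>x z. x \<in> V \<Longrightarrow> z \<in> nb x \<Longrightarrow> h x z < d"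
  shows "rep d V nb (flip h w p q) (flip_tables w p q A)"
proof -
  define B where "B = flip_tables w p q A"
  define i where "i = A ''pos'' (w * d + p)"
  define j where "j = A ''pos'' (w * d + q)"
  have row: "A ''row'' w = w * d" by (rule rep_row[OF rep w])
  have ij: "i < d" "j < d" "A ''cols'' (w * d + i) = p" "A ''cols'' (w * d + j) = q"
    using rep w p q by (auto simp: rep_def i_def j_def)
  have B: "B ''row'' = A ''row''" "B ''deg'' = A ''deg''"
    "B ''cols'' = (A ''cols'')(w * d + i := q, w * d + j := p)"
    "B ''pos'' = (A ''pos'')(w * d + p := j, w * d + q := i)"
    "B ''nbr'' = (A ''nbr'')(w * d + p := A ''nbr'' (w * d + q), w * d + q := A ''nbr'' (w * d + p))"
    by (simp_all add: B_def flip_tables_def Let_def row i_def j_def)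
  have swp_lt: "swp p q c < d" if "c < d" for c using that p q by (simp add: swp_def)
  have swp2: "swp p q (swp p q c) = c" for c by (simp add: swp_def)
  have other: "B a (z * d + c) = A a (z * d + c)"
    if "z \<noteq> w" "c < d" "a \<in> {''cols'', ''pos'', ''nbr''}" for a z c
    using that ij p q block_inj[of z d c w] by (auto simp: B)
  have pos: "B ''pos'' (w * d + c) = A ''pos'' (w * d + swp p q c)" for c
    by (auto simp: B swp_def i_def j_def)
  have nbr: "B ''nbr'' (w * d + c) = A ''nbr'' (w * d + swp p q c)" for c
    by (auto simp: B swp_def)
  have cols: "B ''cols'' (w * d + k) = swp p q (A ''cols'' (w * d + k))" if "k < d" for k
  proof -
    have "A ''cols'' (w * d + k) = p \<longleftrightarrow> k = i" "A ''cols'' (w * d + k) = q \<longleftrightarrow> k = j"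
      using rep_cols(2)[OF rep w that] ij by (auto simp: i_def j_def)
    then show ?thesis by (auto simp: B swp_def)
  qed
  have "rep d V nb (flip h w p q) B"
    unfolding rep_def
  proof (intro ballI)
    fix z assume z: "z \<in> V"
    show "B ''row'' z = z * d \<and> B ''deg'' z = card (nb z) \<and>
      (\<forall>c<d. B ''pos'' (z * d + c) < d \<and> B ''cols'' (z * d + B ''pos'' (z * d + c)) = c \<and>
        (B ''pos'' (z * d + c) < card (nb z) \<longleftrightarrow> c \<in> flip h w p q z ` nb z)) \<and>
      (\<forall>y \<in> nb z. B ''nbr'' (z * d + flip h w p q z y) = y)"
    proof (cases "z = w")
      case False
      then show ?thesis using rep z lt[OF z] other[OF False]
        by (simp add: rep_def B(1,2) flip_def)
    next
      case True
      have "A ''pos'' (w * d + swp p q c) < card (nb w) \<longleftrightarrow> c \<in> flip h w p q w ` nb w"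
        if "c < d" for c
      proof -
        have "c \<in> flip h w p q w ` nb w \<longleftrightarrow> swp p q c \<in> h w ` nb w"
          using swp2 by (auto simp: flip_def image_iff) metis
        then show ?thesis using rep w swp_lt[OF that] by (simp add: rep_def)
      qed
      then show ?thesis using True rep w swp_lt
        by (simp add: rep_def B(1,2) pos cols nbr swp2 flip_def)
    qed
  qed
  then show ?thesis by (simp add: B_def)
qed

text \<open>Keeps the simplifier from executing a continuation before its start state is known.\<close>

lemma exec_weak_cong: "c = c' \<Longrightarrow> s = s' \<Longrightarrow> exec c s Q = exec c' s' Q"
  by simp

section \<open>Straight-line programs on the tables\<close>

primrec block :: "com list \<Rightarrow> com" where
  "block [] = Skip"
| "block (c # cs) = Seq c (block cs)"

definition slot :: "string \<Rightarrow> string \<Rightarrow> string \<Rightarrow> expr" where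
  "slot a w c = Arr a (Plus (Arr ''row'' (Reg w)) (Reg c))"

definition set_slot :: "string \<Rightarrow> string \<Rightarrow> string \<Rightarrow> expr \<Rightarrow> com" where
  "set_slot a w c e = SetArr a (Plus (Arr ''row'' (Reg w)) (Reg c)) e"

definition flip_code :: com where
  "flip_code = block
    [SetReg ''i'' (slot ''pos'' ''fw'' ''fp''), SetReg ''j'' (slot ''pos'' ''fw'' ''fq''),
     set_slot ''cols'' ''fw'' ''i'' (Reg ''fq''), set_slot ''cols'' ''fw'' ''j'' (Reg ''fp''),
     set_slot ''pos'' ''fw'' ''fp'' (Reg ''j''), set_slot ''pos'' ''fw'' ''fq'' (Reg ''i''),
     SetReg ''m'' (slot ''nbr'' ''fw'' ''fp''), set_slot ''nbr'' ''fw'' ''fp'' (slot ''nbr'' ''fw'' ''fq''),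
     set_slot ''nbr'' ''fw'' ''fq'' (Reg ''m'')]"

lemma exec_flip_code:
  "exec flip_code s Q \<longleftrightarrow>
    Q 10 (s\<lparr>reg := (reg s)(''i'' := arr s ''pos'' (arr s ''row'' (reg s ''fw'') + reg s ''fp''),
                         ''j'' := arr s ''pos'' (arr s ''row'' (reg s ''fw'') + reg s ''fq''),
                         ''m'' := arr s ''nbr'' (arr s ''row'' (reg s ''fw'') + reg s ''fp'')),
            arr := flip_tables (reg s ''fw'') (reg s ''fp'') (reg s ''fq'') (arr s)\<rparr>)"
  by (simp add: flip_code_def exec_simps slot_def set_slot_def cong: exec_weak_cong del: One_nat_def)
    (simp only: flip_tables_def Let_def)

definition flip_call :: "string \<Rightarrow> string \<Rightarrow> string \<Rightarrow> com" where
  "flip_call w p q =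
    block [SetReg ''fw'' (Reg w), SetReg ''fp'' (Reg p), SetReg ''fq'' (Reg q), flip_code]"

lemma flip_tables_other:
  "a \<notin> {''cols'', ''pos'', ''nbr''} \<Longrightarrow> flip_tables w p q A a = A a"
  by (simp add: flip_tables_def Let_def)

lemma exec_flip_call:
  assumes "w \<notin> {''fw'', ''fp'', ''fq''}" "p \<notin> {''fw'', ''fp'', ''fq''}" "q \<notin> {''fw'', ''fp'', ''fq''}"
    and "\<And>s'. arr s' = flip_tables (reg s w) (reg s p) (reg s q) (arr s) \<Longrightarrow>
      (\<And>z. z \<notin> {''fw'', ''fp'', ''fq'', ''i'', ''j'', ''m''} \<Longrightarrow> reg s' z = reg s z) \<Longrightarrow> Q 14 s'"
  shows "exec (flip_call w p q) s Q"
proof -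
  have ne: "''fw'' \<noteq> p" "''fw'' \<noteq> q" "''fp'' \<noteq> q" using assms(2,3) by auto
  show ?thesis
    unfolding flip_call_def
    by (simp add: exec_simps exec_flip_code ne ne[symmetric] cong: exec_weak_cong del: One_nat_def)
      (rule assms(4); simp)
qed

section \<open>Searching two trees in parallel\<close>

text \<open>The prefix \<open>a\<close> keeps the variables of the two interleaved searches apart.\<close>

definition bfs_init :: "char \<Rightarrow> string \<Rightarrow> string \<Rightarrow> com" where
  "bfs_init a r out = block
    [SetArr (a # ''q'') (Const 0) (Reg r), SetArr (a # ''p'') (Reg r) (Reg out),
     SetReg (a # ''h'') (Const 0), SetReg (a # ''i'') (Const 0), SetReg (a # ''t'') (Const 1)]"

text \<open>Under truncated subtraction at most one of the two differences is nonzero, so the sum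
  vanishes only for equal arguments.\<close>

definition neq :: "expr \<Rightarrow> expr \<Rightarrow> test" where
  "neq e e' = Less (Const 0) (Plus (Minus e e') (Minus e' e))"

lemma eval_neq [simp]: "eval_test (neq e e') s \<longleftrightarrow> eval_expr e s \<noteq> eval_expr e' s"
  by (auto simp: neq_def)

definition bfs_step :: "char \<Rightarrow> com" where
  "bfs_step a = Seq (SetReg ''x'' (Arr (a # ''q'') (Reg (a # ''h''))))
    (If (Less (Reg (a # ''i'')) (Arr ''deg'' (Reg ''x'')))
      (block
        [SetReg ''y'' (Arr ''nbr'' (Plus (Arr ''row'' (Reg ''x''))
           (Arr ''cols'' (Plus (Arr ''row'' (Reg ''x'')) (Reg (a # ''i'')))))),
         SetReg (a # ''i'') (Plus (Reg (a # ''i'')) (Const 1)),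
         If (neq (Reg ''y'') (Arr (a # ''p'') (Reg ''x'')))
           (block [SetArr (a # ''q'') (Reg (a # ''t'')) (Reg ''y''),
              SetArr (a # ''p'') (Reg ''y'') (Reg ''x''),
              SetReg (a # ''t'') (Plus (Reg (a # ''t'')) (Const 1))])
           Skip])
      (block [SetReg (a # ''h'') (Plus (Reg (a # ''h'')) (Const 1)), SetReg (a # ''i'') (Const 0)]))"

definition bfs_loop :: "char \<Rightarrow> com" where
  "bfs_loop a = While (Less (Reg (a # ''h'')) (Reg (a # ''t''))) (bfs_step a)"

definition bfs_mem :: "char \<Rightarrow> nat list \<Rightarrow> (nat \<Rightarrow> nat) \<Rightarrow> nat \<Rightarrow> nat \<Rightarrow> ram \<Rightarrow> bool" where
  "bfs_mem a Q \<pi> hh i s \<longleftrightarrow> reg s (a # ''h'') = hh \<and> reg s (a # ''i'') = i \<and>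
     reg s (a # ''t'') = length Q \<and> (\<forall>k < length Q. arr s (a # ''q'') k = Q ! k) \<and>
     (\<forall>x \<in> set Q. arr s (a # ''p'') x = \<pi> x)"

text \<open>Programs are composed through such frames, which list what may have changed, so that no
  proof has to carry a complete final state.\<close>

definition bfs_frame :: "char \<Rightarrow> ram \<Rightarrow> ram \<Rightarrow> bool" where
  "bfs_frame a s s' \<longleftrightarrow>
     (\<forall>z. z \<notin> {a # ''h'', a # ''i'', a # ''t'', ''x'', ''y''} \<longrightarrow> reg s' z = reg s z) \<and>
     (\<forall>z. z \<notin> {a # ''q'', a # ''p''} \<longrightarrow> arr s' z = arr s z)"

lemma bfs_frame_trans: "bfs_frame a s s' \<Longrightarrow> bfs_frame a s' s'' \<Longrightarrow> bfs_frame a s s''"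
  by (simp add: bfs_frame_def)

lemma bfs_mem_frame:
  assumes "bfs_mem a Q \<pi> hh i s" "bfs_frame b s s'" "a \<noteq> b"
  shows "bfs_mem a Q \<pi> hh i s'"
  using assms by (simp add: bfs_mem_def bfs_frame_def)

lemma exec_bfs_init:
  assumes "reg s r = x" "reg s out = y"
  shows "exec (bfs_init a r out) s
    (\<lambda>t s'. t = 6 \<and> bfs_mem a [x] (\<pi>(x := y)) 0 0 s' \<and> bfs_frame a s s')"
  using assms unfolding bfs_init_def
  by (simp add: exec_simps bfs_mem_def bfs_frame_def cong: exec_weak_cong del: One_nat_def)

text \<open>The tables \<open>A\<close> are fixed once, so that the enumeration of neighbours stays
  the same during the search; \<open>searching\<close> asserts that memory still holds them.\<close>

locale bfs_ram = bfs_tree V E r out "table_nb A" "A ''deg''"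
  for V :: "nat set" and E r out and A :: "string \<Rightarrow> nat \<Rightarrow> nat"
begin

definition searching :: "char \<Rightarrow> nat list \<Rightarrow> (nat \<Rightarrow> nat) \<Rightarrow> nat \<Rightarrow> nat \<Rightarrow> ram \<Rightarrow> bool" where
  "searching a Q \<pi> hh i s \<longleftrightarrow> bfs_inv Q \<pi> hh i \<and> bfs_mem a Q \<pi> hh i s \<and>
     (\<forall>z \<in> {''row'', ''deg'', ''cols'', ''nbr''}. arr s z = A z)"

lemma exec_bfs_step:
  assumes "searching a Q \<pi> hh i s" "hh < length Q"
  shows "exec (bfs_step a) s (\<lambda>t s'. t \<le> 12 \<and> bfs_frame a s s' \<and>
    (\<exists>Q' \<pi>' hh' i'. searching a Q' \<pi>' hh' i' s' \<and> bfs_pot Q' \<pi>' hh' i' + 1 = bfs_pot Q \<pi> hh i))"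
proof -
  have inv: "bfs_inv Q \<pi> hh i" and mem: "bfs_mem a Q \<pi> hh i s"
    and tab: "\<And>z. z \<in> {''row'', ''deg'', ''cols'', ''nbr''} \<Longrightarrow> arr s z = A z"
    using assms(1) by (auto simp: searching_def)
  define x where "x = Q ! hh"
  define y where "y = table_nb A x i"
  have xQ: "x \<in> set Q" using assms(2) by (simp add: x_def)
  have s: "reg s (a # ''h'') = hh" "reg s (a # ''i'') = i" "reg s (a # ''t'') = length Q"
    "arr s (a # ''q'') hh = x" "arr s (a # ''p'') x = \<pi> x"
    "arr s ''deg'' = A ''deg''" "arr s ''row'' = A ''row''" "arr s ''cols'' = A ''cols''"
    "arr s ''nbr'' = A ''nbr''"
    "A ''nbr'' (A ''row'' x + A ''cols'' (A ''row'' x + i)) = y"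
    using mem assms(2) xQ tab by (auto simp: bfs_mem_def x_def y_def table_nb_def)
  show ?thesis
  proof (cases "i < A ''deg'' x")
    case i: True
    show ?thesis
    proof (cases "y = \<pi> x")
      case True
      have "bfs_inv Q \<pi> hh (Suc i)" "bfs_pot Q \<pi> hh (Suc i) + 1 = bfs_pot Q \<pi> hh i"
        using bfs_step_parent[OF inv assms(2)] i True by (auto simp: x_def y_def)
      then show ?thesis
        using i True mem tab unfolding bfs_step_def
        by (simp add: exec_simps s cong: exec_weak_cong del: One_nat_def)
          (auto simp: bfs_frame_def searching_def bfs_mem_def intro!: exI[of _ Q] exI[of _ \<pi>])
    next
      case False
      have 1: "bfs_inv (Q @ [y]) (\<pi>(y := x)) hh (Suc i)"
          "bfs_pot (Q @ [y]) (\<pi>(y := x)) hh (Suc i) + 1 = bfs_pot Q \<pi> hh i"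
        using bfs_step_child[OF inv assms(2)] i False by (auto simp: x_def y_def)
      have mem': "\<forall>k<Suc (length Q). ((arr s (a # ''q''))(length Q := y)) k = (Q @ [y]) ! k"
        using mem by (auto simp: bfs_mem_def nth_append)
      show ?thesis
        using i False 1 mem mem' tab unfolding bfs_step_def
        by (simp add: exec_simps s cong: exec_weak_cong del: One_nat_def)
          (auto simp: bfs_frame_def searching_def bfs_mem_def
            intro!: exI[of _ "Q @ [y]"] exI[of _ "\<pi>(y := x)"])
    qed
  next
    case False
    then have "bfs_inv Q \<pi> (Suc hh) 0" "bfs_pot Q \<pi> (Suc hh) 0 + 1 = bfs_pot Q \<pi> hh i"
      using bfs_step_advance[OF inv assms(2)] by (auto simp: x_def)
    then show ?thesis
      using False mem tab unfolding bfs_step_def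
      by (simp add: exec_simps s cong: exec_weak_cong del: One_nat_def)
        (auto simp: bfs_frame_def searching_def bfs_mem_def intro!: exI[of _ Q] exI[of _ \<pi>])
  qed
qed

lemma searching_frame:
  assumes "searching a Q \<pi> hh i s" "bfs_frame b s s'" "a \<noteq> b"
  shows "searching a Q \<pi> hh i s'"
  using assms bfs_mem_frame by (auto simp: searching_def bfs_frame_def)

lemma searching_init:
  assumes "bfs_mem a [r] (\<pi>(r := out)) 0 0 s"
    "\<And>z. z \<in> {''row'', ''deg'', ''cols'', ''nbr''} \<Longrightarrow> arr s z = A z"
  shows "searching a [r] (\<pi>(r := out)) 0 0 s"
  using assms bfs_inv_init by (auto simp: searching_def)

lemma card_T_pos: "0 < card T"
  using finite_T component_refl[of r E] by (auto simp: card_gt_0_iff)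

lemma bfs_pot_init: "bfs_pot [r] \<pi> 0 0 + 1 = 3 * card T"
  using card_T_pos by (simp add: bfs_pot_def)

text \<open>A step takes at most 12 units and the test one more, hence 13 for each unit of
  potential.\<close>

lemma exec_bfs_loop:
  assumes "searching a Q \<pi> hh i s"
  shows "exec (bfs_loop a) s (\<lambda>t s'. t \<le> 13 * bfs_pot Q \<pi> hh i + 1 \<and> bfs_frame a s s' \<and>
    (\<exists>Q' \<pi>'. searching a Q' \<pi>' (length Q') 0 s'))"
proof -
  define I where "I = (\<lambda>(Q, \<pi>, hh, i) s'. searching a Q \<pi> hh i s' \<and> bfs_frame a s s')"
  define pot where "pot = (\<lambda>(Q, \<pi>, hh, i). 13 * bfs_pot Q \<pi> hh i)"
  show ?thesis
    unfolding bfs_loop_def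
  proof (rule exec_While[where I = I and pot = pot and g = "(Q, \<pi>, hh, i)"])
    show "I (Q, \<pi>, hh, i) s" using assms by (simp add: I_def bfs_frame_def)
  next
    fix g s'
    assume I: "I g s'" and test: "eval_test (Less (Reg (a # ''h'')) (Reg (a # ''t''))) s'"
    obtain Q \<pi> hh i where g: "g = (Q, \<pi>, hh, i)" by (cases g)
    have 1: "searching a Q \<pi> hh i s'" "bfs_frame a s s'" using I by (auto simp: I_def g)
    then have "hh < length Q" using test by (simp add: searching_def bfs_mem_def)
    from exec_bfs_step[OF 1(1) this]
    show "exec (bfs_step a) s' (\<lambda>t s''. \<exists>g'. I g' s'' \<and> pot g' + t < pot g)"
    proof (rule exec_mono, goal_cases post)
      case (post t s'')
      then obtain Q' \<pi>' hh' i' where "searching a Q' \<pi>' hh' i' s''" "t \<le> 12"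
          "bfs_frame a s' s''" "bfs_pot Q' \<pi>' hh' i' + 1 = bfs_pot Q \<pi> hh i"
        by blast
      then show ?case
        using bfs_frame_trans[OF 1(2)]
        by (intro exI[of _ "(Q', \<pi>', hh', i')"]) (simp add: I_def pot_def g)
    qed
  next
    fix g' t and s' :: ram
    assume *: "I g' s'" "\<not> eval_test (Less (Reg (a # ''h'')) (Reg (a # ''t''))) s'"
      "t + pot g' \<le> Suc (pot (Q, \<pi>, hh, i))"
    obtain Q' \<pi>' hh' i' where "g' = (Q', \<pi>', hh', i')" by (cases g')
    note 1 = *[unfolded this]
    from 1(1,2) have "searching a Q' \<pi>' hh' i' s'" "hh' = length Q'" "i' = 0"
      by (auto simp: I_def searching_def bfs_mem_def bfs_inv_def split: if_splits)
    then show "t \<le> 13 * bfs_pot Q \<pi> hh i + 1 \<and> bfs_frame a s s' \<and>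
        (\<exists>Q' \<pi>'. searching a Q' \<pi>' (length Q') 0 s')"
      using 1 by (auto simp: I_def pot_def)
  qed
qed

end

text \<open>The truncated subtraction computes the minimum of the two numbers of queued vertices.\<close>

definition both_pending :: "char \<Rightarrow> char \<Rightarrow> test" where
  "both_pending a b =
    (let m = Minus (Reg (a # ''t'')) (Reg (a # ''h'')); n = Minus (Reg (b # ''t'')) (Reg (b # ''h''))
     in Less (Const 0) (Minus m (Minus m n)))"

lemma eval_both_pending [simp]:
  "eval_test (both_pending a b) s \<longleftrightarrow>
     reg s (a # ''h'') < reg s (a # ''t'') \<and> reg s (b # ''h'') < reg s (b # ''t'')"
  by (auto simp: both_pending_def Let_def)

definition race_frame :: "char \<Rightarrow> char \<Rightarrow> ram \<Rightarrow> ram \<Rightarrow> bool" where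
  "race_frame a b s s' \<longleftrightarrow>
     (\<forall>z. z \<notin> {a # ''h'', a # ''i'', a # ''t'', b # ''h'', b # ''i'', b # ''t'', ''x'', ''y''} \<longrightarrow>
       reg s' z = reg s z) \<and>
     (\<forall>z. z \<notin> {a # ''q'', a # ''p'', b # ''q'', b # ''p''} \<longrightarrow> arr s' z = arr s z)"

text \<open>Each round lowers both potentials by exactly one, so their difference stays three times
  the difference of the tree sizes. The search that ends has potential 0, hence the smaller tree. A
  round costs at most 12 + 12 + 1 = 25 units.\<close>

lemma exec_race:
  assumes 1: "bfs_ram V E u v A" and 2: "bfs_ram V E v u A" and ab: "a \<noteq> b"
    and s1: "bfs_ram.searching E u v A a [u] (\<pi>1(u := v)) 0 0 s"
    and s2: "bfs_ram.searching E v u A b [v] (\<pi>2(v := u)) 0 0 s"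
  shows "exec (While (both_pending a b) (Seq (bfs_step a) (bfs_step b))) s (\<lambda>t s'.
    t \<le> 75 * min (card (component E u)) (card (component E v)) + 1 \<and>
    race_frame a b s s' \<and>
    (if reg s' (a # ''h'') < reg s' (a # ''t'') then card (component E v) \<le> card (component E u)
     else card (component E u) \<le> card (component E v)))"
proof -
  interpret u: bfs_ram V E u v A by (rule 1)
  interpret v: bfs_ram V E v u A by (rule 2)
  have F_frame: "race_frame a b s s''" if "race_frame a b s s'" "bfs_frame a s' s'' \<or> bfs_frame b s' s''" for s' s'' :: ram
    using that unfolding race_frame_def bfs_frame_def by (elim disjE) simp_all
  let ?m = "card (component E u)" and ?n = "card (component E v)"
  define I where "I = (\<lambda>((Q1, \<pi>1, h1, i1), (Q2, \<pi>2, h2, i2)) s'.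
    u.searching a Q1 \<pi>1 h1 i1 s' \<and> v.searching b Q2 \<pi>2 h2 i2 s' \<and> race_frame a b s s' \<and>
    u.bfs_pot Q1 \<pi>1 h1 i1 + 3 * ?n = v.bfs_pot Q2 \<pi>2 h2 i2 + 3 * ?m)"
  define pot where "pot = (\<lambda>((Q1, \<pi>1, h1, i1), (Q2, \<pi>2, h2, i2)).
    25 * min (u.bfs_pot Q1 \<pi>1 h1 i1) (v.bfs_pot Q2 \<pi>2 h2 i2))"
  let ?g = "(([u], \<pi>1(u := v), 0, 0), ([v], \<pi>2(v := u), 0, 0))"
  have init: "u.bfs_pot [u] (\<pi>1(u := v)) 0 0 + 1 = 3 * ?m"
    "v.bfs_pot [v] (\<pi>2(v := u)) 0 0 + 1 = 3 * ?n"
    by (rule u.bfs_pot_init, rule v.bfs_pot_init)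
  show ?thesis
  proof (rule exec_While[where I = I and pot = pot and g = ?g])
    show "I ?g s" using s1 s2 init by (simp add: I_def race_frame_def)
  next
    fix g s'
    assume I: "I g s'" and test: "eval_test (both_pending a b) s'"
    obtain Q1 \<pi>1 h1 i1 Q2 \<pi>2 h2 i2 where g: "g = ((Q1, \<pi>1, h1, i1), (Q2, \<pi>2, h2, i2))"
      by (metis surj_pair)
    have *: "u.searching a Q1 \<pi>1 h1 i1 s'" "v.searching b Q2 \<pi>2 h2 i2 s'" "race_frame a b s s'"
        "u.bfs_pot Q1 \<pi>1 h1 i1 + 3 * ?n = v.bfs_pot Q2 \<pi>2 h2 i2 + 3 * ?m"
      using I by (auto simp: I_def g)
    have lt: "h1 < length Q1" "h2 < length Q2"
      using test *(1,2) by (auto simp: u.searching_def v.searching_def bfs_mem_def)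
    show "exec (Seq (bfs_step a) (bfs_step b)) s' (\<lambda>t s''. \<exists>g'. I g' s'' \<and> pot g' + t < pot g)"
      unfolding exec_Seq
    proof (rule exec_mono[OF u.exec_bfs_step[OF *(1) lt(1)]], goal_cases post)
      case (post t1 s1)
      then obtain Q1' \<pi>1' h1' i1' where t1: "t1 \<le> 12" and f1: "bfs_frame a s' s1"
        and s1: "u.searching a Q1' \<pi>1' h1' i1' s1"
        and p1: "u.bfs_pot Q1' \<pi>1' h1' i1' + 1 = u.bfs_pot Q1 \<pi>1 h1 i1"
        by blast
      have "v.searching b Q2 \<pi>2 h2 i2 s1" using v.searching_frame[OF *(2) f1] ab by simp
      from v.exec_bfs_step[OF this lt(2)]
      show ?case
      proof (rule exec_mono, goal_cases post)
        case (post t2 s2)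
        then obtain Q2' \<pi>2' h2' i2' where t2: "t2 \<le> 12" and f2: "bfs_frame b s1 s2"
          and s2: "v.searching b Q2' \<pi>2' h2' i2' s2"
          and p2: "v.bfs_pot Q2' \<pi>2' h2' i2' + 1 = v.bfs_pot Q2 \<pi>2 h2 i2"
          by blast
        have "u.searching a Q1' \<pi>1' h1' i1' s2" using u.searching_frame[OF s1 f2] ab by simp
        moreover have "race_frame a b s s2" using F_frame *(3) f1 f2 by blast
        ultimately have "I ((Q1', \<pi>1', h1', i1'), (Q2', \<pi>2', h2', i2')) s2"
          using s2 *(4) p1 p2 by (simp add: I_def)
        moreover have "pot ((Q1', \<pi>1', h1', i1'), (Q2', \<pi>2', h2', i2')) + (t1 + t2) < pot g"
          using t1 t2 p1 p2 by (simp add: pot_def g min_def)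
        ultimately show ?case by blast
      qed
    qed
  next
    fix g t and s' :: ram
    assume g': "I g s'" "\<not> eval_test (both_pending a b) s'" "t + pot g \<le> Suc (pot ?g)"
    obtain Q1 \<pi>1' h1 i1 Q2 \<pi>2' h2 i2 where g: "g = ((Q1, \<pi>1', h1, i1), (Q2, \<pi>2', h2, i2))"
      by (metis surj_pair)
    have *: "u.searching a Q1 \<pi>1' h1 i1 s'" "v.searching b Q2 \<pi>2' h2 i2 s'" "race_frame a b s s'"
        "u.bfs_pot Q1 \<pi>1' h1 i1 + 3 * ?n = v.bfs_pot Q2 \<pi>2' h2 i2 + 3 * ?m"
      using g'(1) by (auto simp: I_def g)
    have r: "reg s' (a # ''h'') = h1" "reg s' (a # ''t'') = length Q1"
        "reg s' (b # ''h'') = h2" "reg s' (b # ''t'') = length Q2"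
      using *(1,2) by (auto simp: u.searching_def v.searching_def bfs_mem_def)
    have le: "h1 \<le> length Q1" "h2 \<le> length Q2"
      using *(1,2) unfolding u.searching_def v.searching_def u.bfs_inv_def v.bfs_inv_def by blast+
    have "u.bfs_pot Q1 \<pi>1' h1 i1 = 0" if "\<not> h1 < length Q1"
      using *(1) le that u.bfs_finished(2)[of Q1 \<pi>1' i1] by (simp add: u.searching_def)
    moreover have "v.bfs_pot Q2 \<pi>2' h2 i2 = 0" if "\<not> h2 < length Q2"
      using *(2) le that v.bfs_finished(2)[of Q2 \<pi>2' i2] by (simp add: v.searching_def)
    ultimately have "if h1 < length Q1 then ?n \<le> ?m else ?m \<le> ?n"
      using *(4) g'(2) r by (auto split: if_splits)
    moreover have "t \<le> 75 * min ?m ?n + 1"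
      using g'(3) init by (simp add: pot_def min_def split: if_splits)
    ultimately show "t \<le> 75 * min ?m ?n + 1 \<and>
      race_frame a b s s' \<and>
      (if reg s' (a # ''h'') < reg s' (a # ''t'') then ?n \<le> ?m else ?m \<le> ?n)"
      using *(3) r by (simp add: race_frame_def)
  qed
qed

section \<open>Computing sizes and thresholds\<close>

definition ones_body :: "char \<Rightarrow> com" where
  "ones_body a = Seq (SetArr ''size'' (Arr (a # ''q'') (Reg ''k'')) (Const 1))
     (SetReg ''k'' (Plus (Reg ''k'') (Const 1)))"

definition sums_body :: "char \<Rightarrow> com" where
  "sums_body a = block
    [SetReg ''k'' (Minus (Reg ''k'') (Const 1)), SetReg ''x'' (Arr (a # ''q'') (Reg ''k'')),
     SetArr ''size'' (Arr (a # ''p'') (Reg ''x''))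
       (Plus (Arr ''size'' (Arr (a # ''p'') (Reg ''x''))) (Arr ''size'' (Reg ''x'')))]"

text \<open>The queue is read backwards: children stand behind their parent, so a size is complete
  by the time it is added to that of the parent.\<close>

definition size_code :: "char \<Rightarrow> com" where
  "size_code a = block
    [SetReg ''k'' (Const 0), While (Less (Reg ''k'') (Reg (a # ''t''))) (ones_body a),
     While (Less (Const 0) (Reg ''k'')) (sums_body a)]"

definition size_frame :: "ram \<Rightarrow> ram \<Rightarrow> bool" where
  "size_frame s s' \<longleftrightarrow> (\<forall>z. z \<notin> {''k'', ''x''} \<longrightarrow> reg s' z = reg s z) \<and>
     (\<forall>z. z \<noteq> ''size'' \<longrightarrow> arr s' z = arr s z)"

lemma exec_size_ones:
  assumes q: "\<And>k. k < length Q \<Longrightarrow> arr s (a # ''q'') k = Q ! k" and t: "reg s (a # ''t'') = length Q"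
    and k0: "reg s ''k'' = 0"
  shows "exec (While (Less (Reg ''k'') (Reg (a # ''t''))) (ones_body a)) s
    (\<lambda>t s'. t \<le> 3 * length Q + 1 \<and> size_frame s s' \<and> reg s' ''k'' = length Q \<and>
      (\<forall>j < length Q. arr s' ''size'' (Q ! j) = 1))"
proof -
  define I where "I k s' \<longleftrightarrow> reg s' ''k'' = k \<and> k \<le> length Q \<and> size_frame s s' \<and>
    (\<forall>j < k. arr s' ''size'' (Q ! j) = 1)" for k and s' :: ram
  show ?thesis
  proof (rule exec_While[where I = I and pot = "\<lambda>k. 3 * (length Q - k)" and g = 0])
    show "I 0 s" using k0 by (simp add: I_def size_frame_def)
  next
    fix k and s' :: ram
    assume I: "I k s'" and test: "eval_test (Less (Reg ''k'') (Reg (a # ''t''))) s'"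
    have s': "reg s' ''k'' = k" "reg s' (a # ''t'') = length Q" "arr s' (a # ''q'') = arr s (a # ''q'')"
      using I t by (auto simp: I_def size_frame_def)
    then have k: "k < length Q" using test by simp
    then have "arr s (a # ''q'') k = Q ! k" by (rule q)
    then show "exec (ones_body a) s'
      (\<lambda>t s'. \<exists>k'. I k' s' \<and> 3 * (length Q - k') + t < 3 * (length Q - k))"
      using I k
      by (simp add: ones_body_def exec_simps s' cong: exec_weak_cong)
        (auto simp: I_def size_frame_def less_Suc_eq intro!: exI[of _ "Suc k"])
  next
    fix k n and s' :: ram
    assume I: "I k s'" "\<not> eval_test (Less (Reg ''k'') (Reg (a # ''t''))) s'"
      "n + 3 * (length Q - k) \<le> Suc (3 * (length Q - 0))"
    then have "k = length Q" using t by (auto simp: I_def size_frame_def)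
    then show "n \<le> 3 * length Q + 1 \<and> size_frame s s' \<and> reg s' ''k'' = length Q \<and>
      (\<forall>j < length Q. arr s' ''size'' (Q ! j) = 1)"
      using I by (simp add: I_def)
  qed
qed

context bfs_ram begin

lemma exec_size_code:
  assumes sr: "searching a Q \<pi> (length Q) 0 s"
    and sz: "\<And>x. x \<in> T \<Longrightarrow> sz x = 1 + (\<Sum>y | y \<in> T \<and> \<pi> y = x. sz y)"
  shows "exec (size_code a) s (\<lambda>t s'. t \<le> 10 * card T + 10 \<and> size_frame s s' \<and>
    (\<forall>x \<in> T. arr s' ''size'' x = sz x))"
proof -
  have inv: "bfs_inv Q \<pi> (length Q) 0" and mem: "bfs_mem a Q \<pi> (length Q) 0 s"
    using sr by (auto simp: searching_def)
  note fin = bfs_finished[OF inv]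
  have dist: "distinct Q" and Q0: "Q ! 0 = r" and pir: "\<pi> r = out"
    using inv unfolding bfs_inv_def by blast+
  have ord: "\<forall>k<length Q. 0 < k \<longrightarrow> (\<exists>j<k. \<pi> (Q ! k) = Q ! j)"
    using inv unfolding bfs_inv_def by blast
  have later: "j < k" if "k < length Q" "j < length Q" "\<pi> (Q ! k) = Q ! j" for k j
  proof -
    have "Q ! j \<in> T" using that(2) fin(1) nth_mem by blast
    then have "k \<noteq> 0" using that(3) Q0 pir out by metis
    then obtain l where l: "l < k" "\<pi> (Q ! k) = Q ! l" using ord \<open>k < length Q\<close> by auto
    then have "l = j" using that dist nth_eq_iff_index_eq[of Q l j] by simp
    then show ?thesis using l(1) by simp
  qed
  define S where "S k x = (\<Sum>y | y \<in> set (drop k Q) \<and> \<pi> y = x. sz y)" for k x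
  have S_step: "S k x = (if \<pi> (Q ! k) = x then sz (Q ! k) else 0) + S (Suc k) x"
    if "k < length Q" for k x
  proof -
    have k: "drop k Q = Q ! k # drop (Suc k) Q" using that by (rule Cons_nth_drop_Suc[symmetric])
    then have "Q ! k \<notin> set (drop (Suc k) Q)" using dist distinct_drop[of Q k] by simp
    moreover have "{y. y \<in> set (drop k Q) \<and> \<pi> y = x} =
        (if \<pi> (Q ! k) = x then {Q ! k} else {}) \<union> {y. y \<in> set (drop (Suc k) Q) \<and> \<pi> y = x}"
      unfolding k by auto
    ultimately show ?thesis unfolding S_def by simp
  qed
  \<comment> \<open>For \<open>k \<le> Suc j\<close> all children of \<open>Q ! j\<close> are among
    the entries from \<open>k\<close> on. The case \<open>k = Suc j\<close> serves when the size is
    passed on, \<open>k = 0\<close> at the end.\<close>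
  have sz_S: "sz (Q ! j) = 1 + S k (Q ! j)" if "j < length Q" "k \<le> Suc j" for j k
  proof -
    have "y \<in> set (drop k Q)" if y: "y \<in> T" "\<pi> y = Q ! j" for y
    proof -
      obtain i where i: "i < length Q" "y = Q ! i" using y fin(1) by (metis in_set_conv_nth)
      then have "k \<le> i" using later[of i j] y \<open>j < length Q\<close> \<open>k \<le> Suc j\<close> by simp
      then show ?thesis using i nth_mem[of "i - k" "drop k Q"] by simp
    qed
    then have "{y. y \<in> set (drop k Q) \<and> \<pi> y = Q ! j} = {y. y \<in> T \<and> \<pi> y = Q ! j}"
      using in_set_dropD fin(1) by fastforce
    then show ?thesis using sz[of "Q ! j"] that(1) fin(1) nth_mem[of j Q] by (simp add: S_def)
  qed
  define I where "I s k s' \<longleftrightarrow> reg s' ''k'' = k \<and> k \<le> length Q \<and> size_frame s s' \<and>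
    (\<forall>j < length Q. arr s' ''size'' (Q ! j) = 1 + S k (Q ! j))" for k and s s' :: ram
  have loop: "exec (While (Less (Const 0) (Reg ''k'')) (sums_body a)) s1
      (\<lambda>t s'. t \<le> 5 * length Q + 1 \<and> size_frame s s' \<and> (\<forall>x \<in> T. arr s' ''size'' x = sz x))"
    if s1: "size_frame s s1" "reg s1 ''k'' = length Q" "\<forall>j < length Q. arr s1 ''size'' (Q ! j) = 1"
    for s1
  proof -
    show ?thesis
    proof (rule exec_While[where I = "I s" and pot = "\<lambda>k. 5 * k" and g = "length Q"])
      show "I s (length Q) s1" using s1 by (simp add: I_def S_def)
    next
      fix k and s' :: ram
      assume I: "I s k s'" and "eval_test (Less (Const 0) (Reg ''k'')) s'"
      then obtain l where k: "k = Suc l" by (cases k) (auto simp: I_def)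
      have l: "l < length Q" using I by (simp add: I_def k)
      have s': "reg s' ''k'' = Suc l" "arr s' (a # ''q'') l = Q ! l"
        "arr s' (a # ''p'') (Q ! l) = \<pi> (Q ! l)"
        using I k l mem nth_mem[OF l] by (auto simp: I_def size_frame_def bfs_mem_def)
      have szl: "arr s' ''size'' (Q ! l) = sz (Q ! l)"
        using I sz_S[OF l, of "Suc l"] l by (simp add: I_def k)
      \<comment> \<open>For \<open>l = 0\<close> the addition goes to the cell of
        \<open>out\<close>, which lies outside the tree and disturbs none of the recorded
        sizes.\<close>
      have new: "((arr s' ''size'')(\<pi> (Q ! l) := arr s' ''size'' (\<pi> (Q ! l)) + sz (Q ! l))) (Q ! j)
          = 1 + S l (Q ! j)" if "j < length Q" for j
        using I that S_step[OF l, of "Q ! j"] by (auto simp: I_def k)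
      show "exec (sums_body a) s' (\<lambda>t s'. \<exists>k'. I s k' s' \<and> 5 * k' + t < 5 * k)"
        by (simp add: sums_body_def exec_simps s' szl cong: exec_weak_cong del: One_nat_def)
          (use I l new in \<open>auto simp: I_def k size_frame_def intro!: exI[of _ l]\<close>)
    next
      fix k n and s' :: ram
      assume "I s k s'" "\<not> eval_test (Less (Const 0) (Reg ''k'')) s'" "n + 5 * k \<le> Suc (5 * length Q)"
      then have "I s 0 s'" "n \<le> 5 * length Q + 1" by (auto simp: I_def)
      moreover then have "\<forall>x \<in> T. arr s' ''size'' x = sz x"
        using sz_S[of _ 0] unfolding fin(1)[symmetric] by (auto simp: I_def in_set_conv_nth)
      ultimately show "n \<le> 5 * length Q + 1 \<and> size_frame s s' \<and> (\<forall>x \<in> T. arr s' ''size'' x = sz x)"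
        by (simp add: I_def)
    qed
  qed
  define s0 where "s0 = s\<lparr>reg := (reg s)(''k'' := 0)\<rparr>"
  have f0: "size_frame s s0" by (simp add: size_frame_def s0_def)
  have 1: "exec (While (Less (Reg ''k'') (Reg (a # ''t''))) (ones_body a)) s0
    (\<lambda>t s'. t \<le> 3 * length Q + 1 \<and> size_frame s0 s' \<and> reg s' ''k'' = length Q \<and>
      (\<forall>j < length Q. arr s' ''size'' (Q ! j) = 1))"
    using mem by (intro exec_size_ones) (auto simp: s0_def bfs_mem_def)
  show ?thesis
    unfolding size_code_def block.simps exec_Seq exec_SetReg exec_Skip eval_expr.simps
      s0_def[symmetric]
  proof (rule exec_mono[OF 1], rule exec_mono[OF loop])
    fix t1 t2 :: nat and s1 s2 :: ram
    assume 1: "t1 \<le> 3 * length Q + 1 \<and> size_frame s0 s1 \<and> reg s1 ''k'' = length Q \<and>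
      (\<forall>j < length Q. arr s1 ''size'' (Q ! j) = 1)"
    then show "size_frame s s1" "reg s1 ''k'' = length Q" "\<forall>j < length Q. arr s1 ''size'' (Q ! j) = 1"
      using f0 by (auto simp: size_frame_def)
    assume "t2 \<le> 5 * length Q + 1 \<and> size_frame s s2 \<and> (\<forall>x \<in> T. arr s2 ''size'' x = sz x)"
    then show "1 + (t1 + (t2 + 1)) \<le> 10 * card T + 10 \<and> size_frame s s2 \<and>
        (\<forall>x \<in> T. arr s2 ''size'' x = sz x)"
      using 1 fin(3) by simp
  qed
qed

end

text \<open>In place of a multiplication, \<open>lev = Suc (level_size d k)\<close> is added to
  \<open>acc\<close> until this has been done \<open>cnt = 2 ^ Suc k * (d - 2)\<close> times; then
  \<open>acc\<close> is the next threshold and \<open>cnt\<close> is doubled.\<close>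

definition level_body :: com where
  "level_body = If (Less (Reg ''j'') (Reg ''cnt''))
     (block [SetReg ''acc'' (Plus (Reg ''acc'') (Reg ''lev'')),
       SetReg ''j'' (Plus (Reg ''j'') (Const 1))])
     (block [SetReg ''l'' (Plus (Reg ''l'') (Const 1)), SetArr ''tau'' (Reg ''l'') (Reg ''acc''),
       SetReg ''lev'' (Plus (Reg ''acc'') (Const 1)), SetReg ''cnt'' (Plus (Reg ''cnt'') (Reg ''cnt'')),
       SetReg ''j'' (Const 0)])"

definition level_code :: "string \<Rightarrow> com" where
  "level_code n = block
    [SetArr ''tau'' (Const 0) (Const 0), SetReg ''l'' (Const 0), SetReg ''acc'' (Const 0),
     SetReg ''j'' (Const 0), SetReg ''lev'' (Const 1),
     SetReg ''cnt'' (Plus (Minus (Reg ''Delta'') (Const 2)) (Minus (Reg ''Delta'') (Const 2))),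
     While (Less (Reg ''acc'') (Reg n)) level_body,
     SetReg ''l'' (Plus (Reg ''l'') (Const 1))]"

definition level_frame :: "ram \<Rightarrow> ram \<Rightarrow> bool" where
  "level_frame s s' \<longleftrightarrow>
     (\<forall>z. z \<notin> {''l'', ''acc'', ''j'', ''lev'', ''cnt''} \<longrightarrow> reg s' z = reg s z) \<and>
     (\<forall>z. z \<noteq> ''tau'' \<longrightarrow> arr s' z = arr s z)"

lemma level_size_mono: "mono (level_size d)"
  by (rule incseq_SucI) simp

text \<open>The loop may stop in the middle of a level, as soon as \<open>acc\<close> reaches
  \<open>n\<close>: level \<open>k\<close> is then too small and level \<open>Suc k\<close> large
  enough, and only thresholds below the latter are wanted. Thus the time is linear in
  \<open>n\<close> even if the next threshold is far larger.\<close>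

lemma exec_level_code:
  assumes d: "3 \<le> d" "reg s ''Delta'' = d" and n: "reg s m = n" "0 < n"
    and m: "m \<notin> {''l'', ''acc'', ''j'', ''lev'', ''cnt''}"
  shows "exec (level_code m) s (\<lambda>t s'. t \<le> 16 * n + 20 \<and> level_frame s s' \<and>
    reg s' ''l'' = least_level d n \<and> (\<forall>i < least_level d n. arr s' ''tau'' i = level_size d i))"
proof -
  define I where "I = (\<lambda>(k, j) s'. level_frame s s' \<and> reg s' ''l'' = k \<and> reg s' ''j'' = j \<and>
    level_size d k < n \<and> j \<le> 2 ^ Suc k * (d - 2) \<and>
    reg s' ''acc'' = level_size d k + j * Suc (level_size d k) \<and>
    reg s' ''lev'' = Suc (level_size d k) \<and> reg s' ''cnt'' = 2 ^ Suc k * (d - 2) \<and>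
    (\<forall>i \<le> k. arr s' ''tau'' i = level_size d i))"
  \<comment> \<open>An addition lowers \<open>n - acc\<close> and may exhaust \<open>cnt\<close>;
    the change of level that follows is paid by the extra unit. The factor 8 covers the longer of
    the two bodies and the test.\<close>
  define pot where "pot = (\<lambda>(k, j). 8 * (2 * (n - (level_size d k + j * Suc (level_size d k))) +
    (if j < 2 ^ Suc k * (d - 2) then 0 else 1)))"
  let ?test = "Less (Reg ''acc'') (Reg m)"
  have loop: "exec (While ?test level_body) s0
      (\<lambda>t s'. \<exists>g. I g s' \<and> \<not> eval_test ?test s' \<and> t + pot g \<le> Suc (pot (0, 0)))"
    if "I (0, 0) s0" for s0
  proof (rule exec_While[where I = I and pot = pot and g = "(0, 0)"])
    show "I (0, 0) s0" by (rule that)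
  next
    fix g and s' :: ram
    assume I: "I g s'" and test: "eval_test ?test s'"
    obtain k j where g: "g = (k, j)" by (cases g)
    define a where "a = level_size d k + j * Suc (level_size d k)"
    define N where "N = 2 ^ Suc k * (d - 2)"
    have s': "reg s' ''l'' = k" "reg s' ''j'' = j" "reg s' ''acc'' = a"
        "reg s' ''lev'' = Suc (level_size d k)" "reg s' ''cnt'' = N" "j \<le> N" "level_frame s s'"
        "level_size d k < n" "\<forall>i \<le> k. arr s' ''tau'' i = level_size d i"
      using I by (auto simp: I_def g a_def N_def)
    have a: "a < n" using test s' n m by (simp add: level_frame_def)
    have N: "0 < N" "N + N = 2 ^ Suc (Suc k) * (d - 2)" using d by (auto simp: N_def)
    show "exec level_body s' (\<lambda>t s'. \<exists>g'. I g' s' \<and> pot g' + t < pot g)"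
    proof (cases "j < N")
      case True
      have "pot (k, Suc j) + 4 < pot g"
        using True a unfolding pot_def g prod.case N_def[symmetric] a_def
        by (auto simp: not_less)
      moreover have "exec level_body s' (\<lambda>t s''. t \<le> 4 \<and> I (k, Suc j) s'')"
        using True s' a
        by (simp add: level_body_def exec_simps cong: exec_weak_cong del: One_nat_def)
          (simp add: I_def level_frame_def a_def N_def)
      ultimately show ?thesis by (elim exec_mono) fastforce
    next
      case False
      then have j: "j = N" using s' by simp
      have lev: "level_size d (Suc k) = a" by (simp only: level_size.simps a_def j N_def)
      have "pot (Suc k, 0) + 7 < pot g"
        using j N unfolding pot_def g prod.case N_def[symmetric] a_def[symmetric] lev N(2)[symmetric]
        by simp
      moreover have "\<forall>i \<le> Suc k. ((arr s' ''tau'')(Suc k := a)) i = level_size d i"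
        using s' lev by (auto simp: le_Suc_eq simp del: level_size.simps)
      moreover have "exec level_body s' (\<lambda>t s''. t \<le> 7 \<and> I (Suc k, 0) s'')"
        using False s' a N calculation(2)
        by (simp add: level_body_def exec_simps cong: exec_weak_cong del: One_nat_def)
          (simp add: I_def level_frame_def lev del: level_size.simps)
      ultimately show ?thesis by (elim exec_mono) fastforce
    qed
  qed blast
  show ?thesis
    unfolding level_code_def block.simps exec_Seq exec_SetReg exec_SetArr exec_Skip eval_expr.simps
  proof (rule exec_mono[OF loop], goal_cases)
    case 1
    show ?case using d n by (auto simp: I_def level_frame_def)
  next
    case (2 t s')
    then obtain k j where I: "I (k, j) s'" "\<not> eval_test ?test s'" "t \<le> Suc (pot (0, 0))"
      by (auto simp: split_paired_all)
    define a where "a = level_size d k + j * Suc (level_size d k)"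
    have "n \<le> a" using I n m by (auto simp: I_def a_def level_frame_def)
    moreover have "j * Suc (level_size d k) \<le> 2 ^ Suc k * (d - 2) * Suc (level_size d k)"
      using I by (intro mult_le_mono1) (simp add: I_def)
    ultimately have le: "n \<le> level_size d (Suc k)" by (simp add: a_def)
    have "least_level d n = Suc k"
    proof (rule antisym)
      show "least_level d n \<le> Suc k" by (rule least_level_le[OF le])
      have "\<not> least_level d n \<le> k"
        using le_least_level[OF d(1), of n] monoD[OF level_size_mono, of "least_level d n" k d] I
        by (auto simp: I_def)
      then show "Suc k \<le> least_level d n" by simp
    qed
    moreover have "pot (0, 0) \<le> 16 * n + 8" by (simp add: pot_def)
    ultimately show ?case
      using I by (auto simp: I_def level_frame_def less_Suc_eq_le)
  qed
qed

section \<open>Processing the tasks\<close>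

text \<open>A branch that is too large is recognised by its stored size alone. The flag
  \<open>f\<close> is 0 during the search and \<open>Delta\<close> after success, so that the single
  loop test \<open>c + f < Delta\<close> covers both reasons to stop.\<close>

definition scan_body :: com where
  "scan_body = block
    [If (neq (Reg ''c'') (Reg ''p''))
       (If (neq (Reg ''c'') (Reg ''q''))
         (block [SetReg ''f'' (Reg ''Delta''),
           If (Less (slot ''pos'' ''w'' ''c'') (Arr ''deg'' (Reg ''w'')))
             (If (Less (Reg ''th'') (Arr ''size'' (slot ''nbr'' ''w'' ''c''))) (SetReg ''f'' (Const 0)) Skip) Skip,
           If (Less (slot ''pos'' ''x'' ''c'') (Arr ''deg'' (Reg ''x'')))
             (If (Less (Reg ''th'') (Arr ''size'' (slot ''nbr'' ''x'' ''c''))) (SetReg ''f'' (Const 0)) Skip) Skip])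
         Skip) Skip,
     If (Less (Reg ''f'') (Reg ''Delta'')) (SetReg ''c'' (Plus (Reg ''c'') (Const 1))) Skip]"

definition push_code :: "string \<Rightarrow> string \<Rightarrow> com" where
  "push_code v q = If (Less (slot ''pos'' v ''c'') (Arr ''deg'' (Reg v)))
     (block [SetArr ''sw'' (Reg ''top'') (slot ''nbr'' v ''c''), SetArr ''sp'' (Reg ''top'') (Reg ''c''),
       SetArr ''sq'' (Reg ''top'') (Reg q), SetArr ''sl'' (Reg ''top'') (Reg ''l''),
       SetReg ''top'' (Plus (Reg ''top'') (Const 1))])
     Skip"

definition scan_code :: com where
  "scan_code = While (Less (Plus (Reg ''c'') (Reg ''f'')) (Reg ''Delta'')) scan_body"

text \<open>A failed search ends with \<open>c = Delta\<close>; then the chain is followed with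
  \<open>c = p\<close>, and the level stays.\<close>

definition select_code :: com where
  "select_code = If (Less (Reg ''c'') (Reg ''Delta'')) (SetReg ''l'' (Minus (Reg ''l'') (Const 1)))
     (SetReg ''c'' (Reg ''p''))"

definition flips_code :: com where
  "flips_code = Seq (flip_call ''w'' ''p'' ''c'')
     (Seq (flip_call ''w'' ''c'' ''q'') (flip_call ''x'' ''q'' ''c''))"

text \<open>The new tasks are read from the tables before the swaps, while the branches still carry
  colour \<open>c\<close>.\<close>

definition finish_code :: com where
  "finish_code = Seq (If (neq (Reg ''c'') (Reg ''p'')) (push_code ''w'' ''p'') Skip)
     (Seq (push_code ''x'' ''q'') flips_code)"

definition fetch_code :: com where
  "fetch_code = block
    [SetReg ''x'' (slot ''nbr'' ''w'' ''q''), SetReg ''th'' (Arr ''tau'' (Minus (Reg ''l'') (Const 1))),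
     SetReg ''c'' (Const 0), SetReg ''f'' (Const 0)]"

definition used_code :: com where
  "used_code = Seq fetch_code (Seq scan_code (Seq select_code finish_code))"

definition task_code :: com where
  "task_code = Seq (block
    [SetReg ''top'' (Minus (Reg ''top'') (Const 1)),
     SetReg ''w'' (Arr ''sw'' (Reg ''top'')), SetReg ''p'' (Arr ''sp'' (Reg ''top'')),
     SetReg ''q'' (Arr ''sq'' (Reg ''top'')), SetReg ''l'' (Arr ''sl'' (Reg ''top''))])
   (If (Less (slot ''pos'' ''w'' ''q'') (Arr ''deg'' (Reg ''w''))) used_code (flip_call ''w'' ''p'' ''q''))"

definition main_code :: com where
  "main_code = While (Less (Const 0) (Reg ''top'')) task_code"

text \<open>The list is reversed because its head is the last cell in use.\<close>

definition stack :: "nat task list \<Rightarrow> ram \<Rightarrow> bool" where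
  "stack ts s \<longleftrightarrow> reg s ''top'' = length ts \<and> (\<forall>k < length ts.
     (arr s ''sw'' k, arr s ''sp'' k, arr s ''sq'' k, arr s ''sl'' k) = rev ts ! k)"

lemma stack_cong:
  assumes "stack ts s" "reg s' ''top'' = reg s ''top''"
    "\<And>z. z \<in> {''sw'', ''sp'', ''sq'', ''sl''} \<Longrightarrow> arr s' z = arr s z"
  shows "stack ts s'"
  using assms by (simp add: stack_def)

lemma stack_Cons:
  "stack (t # ts) s \<Longrightarrow> reg s ''top'' = Suc (length ts) \<and>
    (arr s ''sw'' (length ts), arr s ''sp'' (length ts), arr s ''sq'' (length ts), arr s ''sl'' (length ts)) = t \<and>
    (\<forall>k < length ts. (arr s ''sw'' k, arr s ''sp'' k, arr s ''sq'' k, arr s ''sl'' k) = rev ts ! k)"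
  unfolding stack_def by (auto simp: nth_append less_Suc_eq)

locale recolor_ram = recolor_tree d nb T \<pi> r out ix sz
  for d and nb :: "nat \<Rightarrow> nat set" and T \<pi> r out ix sz +
  fixes V :: "nat set" and L :: nat
  assumes T_V: "T \<subseteq> V"
begin

text \<open>The \<open>L\<close> stored thresholds serve tasks up to level \<open>L\<close>, since a
  task of level \<open>Suc k\<close> compares with the threshold of level \<open>k\<close>.\<close>

definition memory :: "nat view \<Rightarrow> ram \<Rightarrow> bool" where
  "memory h s \<longleftrightarrow> rep d V nb h (arr s) \<and> reg s ''Delta'' = d \<and> (\<forall>y \<in> T. arr s ''size'' y = sz y) \<and>
     (\<forall>i < L. arr s ''tau'' i = level_size d i)"

lemma memory_cong:
  assumes "memory h s" "reg s' ''Delta'' = reg s ''Delta''"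
    "\<And>z. z \<notin> {''sw'', ''sp'', ''sq'', ''sl''} \<Longrightarrow> arr s' z = arr s z"
  shows "memory h s'"
proof -
  have "rep d V nb h (arr s)" using assms(1) by (simp add: memory_def)
  then have "rep d V nb h (arr s')" by (rule rep_cong) (rule assms(3), auto)
  then show ?thesis using assms by (simp add: memory_def)
qed

text \<open>The colour of the parent edge is excluded because the lookup would yield the size of the
  parent, or an arbitrary value in the case of \<open>out\<close>.\<close>

lemma wt_table:
  assumes mem: "memory h s" and h: "valid h" and x: "x \<in> T" and c: "c < d" "c \<noteq> h x (\<pi> x)"
  shows "wt h x c = (if arr s ''pos'' (arr s ''row'' x + c) < arr s ''deg'' x
    then arr s ''size'' (arr s ''nbr'' (arr s ''row'' x + c)) else 0)"
proof -
  have rep: "rep d V nb h (arr s)" and xV: "x \<in> V" using mem x T_V by (auto simp: memory_def)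
  have row: "arr s ''row'' x = x * d" by (rule rep_row[OF rep xV])
  show ?thesis
  proof (cases "c \<in> h x ` nb x")
    case True
    then obtain y where y: "y \<in> nb x" "c = h x y" by auto
    then have "y \<in> T" "\<pi> y = x" using child_iff[OF x y(1)] c by auto
    moreover have "arr s ''nbr'' (x * d + c) = y" using rep_used(2)[OF rep xV c(1) y(1)] y by simp
    ultimately show ?thesis
      using rep_used(1)[OF rep xV c(1)] True wt_child[OF h x, of y] mem y
      by (simp add: row memory_def)
  next
    case False
    then have "{y. y \<in> T \<and> \<pi> y = x \<and> h x y = c} = {}" using child_nb by blast
    then have "wt h x c = 0" unfolding wt_def by (simp only: sum.empty)
    then show ?thesis using rep_used(1)[OF rep xV c(1)] False by (simp add: row)
  qed
qed

definition scan_frame :: "ram \<Rightarrow> ram \<Rightarrow> bool" where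
  "scan_frame s s' \<longleftrightarrow> arr s' = arr s \<and> (\<forall>z. z \<notin> {''c'', ''f''} \<longrightarrow> reg s' z = reg s z)"

lemma exec_scan_body:
  assumes mem: "memory h s" and h: "valid h" and w: "w \<in> T" "x \<in> T"
    and p: "h w (\<pi> w) = p" and q: "h x (\<pi> x) = q"
    and r: "reg s ''w'' = w" "reg s ''x'' = x" "reg s ''p'' = p" "reg s ''q'' = q" "reg s ''c'' = c"
      "reg s ''f'' = 0" "reg s ''th'' = level_size d k" and c: "c < d"
  shows "exec scan_body s (\<lambda>t s'. t \<le> 20 \<and> scan_frame s s' \<and>
    reg s' ''c'' = (if fits h w p q x k c then c else Suc c) \<and>
    reg s' ''f'' = (if fits h w p q x k c then d else 0))"
proof -
  have D: "reg s ''Delta'' = d" using mem by (simp add: memory_def)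
  have d0: "0 < d" using d3 by simp
  show ?thesis
  proof (cases "c = p \<or> c = q")
    case True
    then have "\<not> fits h w p q x k c" by (auto simp: fits_def)
    then show ?thesis
      using True d0 unfolding scan_body_def
      by (cases "c = p")
        (simp_all add: exec_simps r D scan_frame_def cong: exec_weak_cong del: One_nat_def)
  next
    case False
    then have "fits h w p q x k c \<longleftrightarrow>
        (if arr s ''pos'' (arr s ''row'' w + c) < arr s ''deg'' w
          then arr s ''size'' (arr s ''nbr'' (arr s ''row'' w + c)) else 0) \<le> level_size d k \<and>
        (if arr s ''pos'' (arr s ''row'' x + c) < arr s ''deg'' x
          then arr s ''size'' (arr s ''nbr'' (arr s ''row'' x + c)) else 0) \<le> level_size d k"
      using wt_table[OF mem h w(1) c] wt_table[OF mem h w(2) c] p q by (simp add: fits_def)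
    then show ?thesis
      using False d0 unfolding scan_body_def slot_def
      by (cases "arr s ''pos'' (arr s ''row'' w + c) < arr s ''deg'' w";
          cases "arr s ''size'' (arr s ''nbr'' (arr s ''row'' w + c)) \<le> level_size d k";
          cases "arr s ''pos'' (arr s ''row'' x + c) < arr s ''deg'' x";
          cases "arr s ''size'' (arr s ''nbr'' (arr s ''row'' x + c)) \<le> level_size d k")
        (simp_all add: exec_simps r D scan_frame_def not_le not_less cong: exec_weak_cong
          del: One_nat_def)
  qed
qed

lemma exec_scan:
  assumes mem: "memory h s" and h: "valid h" and w: "w \<in> T" "x \<in> T"
    and p: "h w (\<pi> w) = p" and q: "h x (\<pi> x) = q"
    and r: "reg s ''w'' = w" "reg s ''x'' = x" "reg s ''p'' = p" "reg s ''q'' = q" "reg s ''c'' = 0"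
      "reg s ''f'' = 0" "reg s ''th'' = level_size d k"
  shows "exec scan_code s
    (\<lambda>t s'. scan_frame s s' \<and> (\<exists>c. reg s' ''c'' = c \<and> t \<le> 21 * c + 22 \<and>
      (\<forall>c'<c. \<not> fits h w p q x k c') \<and> (c < d \<and> fits h w p q x k c \<or> c = d)))"
proof -
  let ?test = "Less (Plus (Reg ''c'') (Reg ''f'')) (Reg ''Delta'')"
  define I where "I = (\<lambda>(c, f) s'. scan_frame s s' \<and> reg s' ''c'' = c \<and> reg s' ''f'' = f \<and> c \<le> d \<and>
    (\<forall>c'<c. \<not> fits h w p q x k c') \<and> (f = 0 \<or> f = d \<and> c < d \<and> fits h w p q x k c))"
  \<comment> \<open>Success uses up a round without advancing \<open>c\<close>; the subtracted 21
    accounts for it.\<close>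
  define pot where "pot = (\<lambda>(c, f :: nat). 21 * (d - c) - (if f = 0 then 0 else 21 :: nat))"
  have D: "reg s' ''Delta'' = d" if "scan_frame s s'" for s'
    using that mem by (simp add: scan_frame_def memory_def)
  show ?thesis
    unfolding scan_code_def
  proof (rule exec_While[where I = I and pot = pot and g = "(0, 0)"])
    show "I (0, 0) s" using r by (simp add: I_def scan_frame_def)
  next
    fix g and s' :: ram
    assume I: "I g s'" and test: "eval_test ?test s'"
    obtain c f where g: "g = (c, f)" by (cases g)
    have fr: "scan_frame s s'" using I by (simp add: I_def g)
    have c: "c < d" "f = 0" using I test D[OF fr] by (auto simp: I_def g)
    have mem': "memory h s'" using memory_cong[OF mem] fr by (simp add: scan_frame_def)
    have "exec scan_body s' (\<lambda>t s''. t \<le> 20 \<and> scan_frame s' s'' \<and>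
      reg s'' ''c'' = (if fits h w p q x k c then c else Suc c) \<and>
      reg s'' ''f'' = (if fits h w p q x k c then d else 0))"
      by (rule exec_scan_body[OF mem' h w p q]) (use I r fr c in \<open>auto simp: I_def g scan_frame_def\<close>)
    then show "exec scan_body s' (\<lambda>t s''. \<exists>g'. I g' s'' \<and> pot g' + t < pot g)"
    proof (rule exec_mono, goal_cases post)
      case (post t s'')
      note post = this
      have fr': "scan_frame s s''" using fr post by (simp add: scan_frame_def)
      show ?case
      proof (cases "fits h w p q x k c")
        case True
        have "I (c, d) s''" using True post fr' I by (simp add: I_def g c)
        moreover have "t \<le> 20" "0 < d - c" using post c by auto
        then have "pot (c, d) + t < pot g" using c d3 by (simp add: pot_def g)
        ultimately show ?thesis by blast
      next
        case False
        have "I (Suc c, 0) s''" using False post fr' I c by (simp add: I_def g less_Suc_eq)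
        moreover have "t \<le> 20" "0 < d - c" using post c by auto
        then have "pot (Suc c, 0) + t < pot g" using c by (simp add: pot_def g)
        ultimately show ?thesis by blast
      qed
    qed
  next
    fix g t and s' :: ram
    assume *: "I g s'" "\<not> eval_test ?test s'" "t + pot g \<le> Suc (pot (0, 0))"
    obtain c f where "g = (c, f)" by (cases g)
    note I = *(1)[unfolded this] and test = *(2) and t = *(3)[unfolded this]
    have "c < d \<and> fits h w p q x k c \<or> c = d"
      using I test D[of s'] by (auto simp: I_def)
    moreover have "t \<le> 21 * c + 22"
      using t I by (auto simp: pot_def I_def split: if_splits)
    ultimately show "scan_frame s s' \<and> (\<exists>c. reg s' ''c'' = c \<and> t \<le> 21 * c + 22 \<and>
      (\<forall>c'<c. \<not> fits h w p q x k c') \<and> (c < d \<and> fits h w p q x k c \<or> c = d))"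
      using I by (auto simp: I_def)
  qed
qed

section \<open>Opening tasks and swapping colours in memory\<close>

definition push_frame :: "ram \<Rightarrow> ram \<Rightarrow> bool" where
  "push_frame s s' \<longleftrightarrow> (\<forall>z. z \<noteq> ''top'' \<longrightarrow> reg s' z = reg s z) \<and>
     (\<forall>z. z \<notin> {''sw'', ''sp'', ''sq'', ''sl''} \<longrightarrow> arr s' z = arr s z)"

lemma exec_push_code:
  assumes mem: "memory h s" and x: "reg s v = x" "x \<in> T" and c: "reg s ''c'' = c" "c < d"
    and ts: "stack ts s" and v: "v \<noteq> ''top''" "q \<noteq> ''top''"
  shows "exec (push_code v q) s (\<lambda>t s'. t \<le> 7 \<and> push_frame s s' \<and>
    (\<exists>zs. next_tasks h x c (reg s q) (reg s ''l'') zs \<and> stack (zs @ ts) s'))"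
proof -
  have rep: "rep d V nb h (arr s)" and xV: "x \<in> V" using mem x T_V by (auto simp: memory_def)
  have row: "arr s ''row'' x = x * d" by (rule rep_row[OF rep xV])
  have top: "reg s ''top'' = length ts" using ts by (simp add: stack_def)
  show ?thesis
  proof (cases "c \<in> h x ` nb x")
    case False
    have "next_tasks h x c (reg s q) (reg s ''l'') []" using False by (simp add: next_tasks_def)
    then show ?thesis
      using ts rep_used(1)[OF rep xV c(2)] False v unfolding push_code_def slot_def
      by (simp add: exec_simps x(1) c(1) row push_frame_def cong: exec_weak_cong) force
  next
    case True
    then obtain z where z: "z \<in> nb x" "c = h x z" by auto
    have nz: "arr s ''nbr'' (x * d + c) = z" using rep_used(2)[OF rep xV c(2) z(1)] z by simp
    let ?t = "(z, c, reg s q, reg s ''l'')"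
    have nt: "next_tasks h x c (reg s q) (reg s ''l'') [?t]" using z by (simp add: next_tasks_def)
    have "exec (push_code v q) s (\<lambda>t s'. t \<le> 7 \<and> push_frame s s' \<and> stack (?t # ts) s')"
      using ts rep_used(1)[OF rep xV c(2)] True v unfolding push_code_def slot_def
      by (simp add: exec_simps x(1) c(1) row top nz cong: exec_weak_cong)
        (auto simp: push_frame_def stack_def nth_append less_Suc_eq)
    then show ?thesis
    proof (rule exec_mono, goal_cases post)
      case (post t s')
      then show ?case
        using nt by (intro conjI exI[of _ "[?t]"]) auto
    qed
  qed
qed

definition flip_frame :: "ram \<Rightarrow> ram \<Rightarrow> bool" where
  "flip_frame s s' \<longleftrightarrow>
     (\<forall>z. z \<notin> {''fw'', ''fp'', ''fq'', ''i'', ''j'', ''m''} \<longrightarrow> reg s' z = reg s z) \<and>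
     (\<forall>z. z \<notin> {''cols'', ''pos'', ''nbr''} \<longrightarrow> arr s' z = arr s z)"

lemma exec_flip:
  assumes mem: "memory h s" and h: "valid h" and w: "reg s v = w" "w \<in> T" and p: "reg s p' = p" "p < d"
    and q: "reg s q' = q" "q < d" and ts: "stack ts s"
    and n: "v \<notin> {''fw'', ''fp'', ''fq''}" "p' \<notin> {''fw'', ''fp'', ''fq''}" "q' \<notin> {''fw'', ''fp'', ''fq''}"
    and Q: "\<And>s'. memory (flip h w p q) s' \<Longrightarrow> stack ts s' \<Longrightarrow> flip_frame s s' \<Longrightarrow> Q 14 s'"
  shows "exec (flip_call v p' q') s Q"
proof (rule exec_flip_call[OF n])
  fix s' :: ram
  assume arr: "arr s' = flip_tables (reg s v) (reg s p') (reg s q') (arr s)"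
    and reg: "\<And>z. z \<notin> {''fw'', ''fp'', ''fq'', ''i'', ''j'', ''m''} \<Longrightarrow> reg s' z = reg s z"
  have other: "arr s' z = arr s z" if "z \<notin> {''cols'', ''pos'', ''nbr''}" for z
    unfolding arr by (rule flip_tables_other[OF that])
  have "rep d V nb (flip h w p q) (arr s')"
    unfolding arr w p q
  proof (rule rep_flip)
    show "rep d V nb h (arr s)" using mem by (simp add: memory_def)
    show "w \<in> V" using w T_V by blast
    show "h x z < d" if "z \<in> nb x" for x z using h that by (simp add: valid_def)
  qed (use p q in simp_all)
  moreover have "arr s' ''size'' = arr s ''size''" "arr s' ''tau'' = arr s ''tau''"
    by (rule other, simp)+
  moreover have "reg s' ''Delta'' = reg s ''Delta''" by (rule reg) simp
  ultimately have "memory (flip h w p q) s'"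
    using mem by (simp add: memory_def)
  moreover have "stack ts s'"
    by (rule stack_cong[OF ts]) (rule reg, simp, rule other, auto)
  moreover have "flip_frame s s'" using other reg by (simp add: flip_frame_def)
  ultimately show "Q 14 s'" by (rule Q)
qed

section \<open>Correctness and running time of the task loop\<close>

definition main_inv :: "(nat set \<Rightarrow> nat) \<Rightarrow> nat \<Rightarrow> nat set set \<times> nat view \<times>
    nat task list \<Rightarrow> ram \<Rightarrow> bool" where
  "main_inv col R = (\<lambda>(X, h, ts) s. rc_inv col R X h ts \<and> memory h s \<and> stack ts s \<and>
     (\<forall>(w, p, q, k) \<in> set ts. k \<le> L))"

lemma exec_used_code:
  assumes inv: "rc_inv col R X h ((w, p, q, k) # ts)" and mem: "memory h s" and ts: "stack ts s"
    and r: "reg s ''w'' = w" "reg s ''p'' = p" "reg s ''q'' = q" "reg s ''l'' = k"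
    and used: "q \<in> h w ` nb w" and L: "k \<le> L" "\<forall>(w, p, q, k) \<in> set ts. k \<le> L"
  shows "exec used_code s (\<lambda>t s'. \<exists>X' h' new. main_inv col R (X', h', new @ ts) s' \<and>
    (\<exists>n. t \<le> 21 * n + 100 \<and> (\<Sum>t\<leftarrow>new. sz (fst t)) + max 2 n \<le> sz w))"
proof -
  obtain x where x: "x \<in> nb w" "h w x = q" using used by auto
  obtain j where k: "k = Suc j" using rc_inv_level[OF inv] by blast
  note inv' = inv[unfolded k]
  have val: "valid h" and tok: "task_ok X h (w, p, q, k)" using inv by (auto simp: rc_inv_def)
  have w: "w \<in> T" "h w (\<pi> w) = p" "p \<noteq> q" using tok by (auto simp: task_ok_def)
  note xs = task_child[OF inv x]
  note lt = task_ok_lt[OF val tok]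
  have rep: "rep d V nb h (arr s)" and wV: "w \<in> V" using mem w T_V by (auto simp: memory_def)
  have nx: "arr s ''nbr'' (arr s ''row'' w + q) = x"
    using rep_used(2)[OF rep wV lt(2) x(1)] x rep_row[OF rep wV] by simp
  have tau: "arr s ''tau'' j = level_size d j" using mem L k by (simp add: memory_def)
  define s1 where "s1 = s\<lparr>reg := (reg s)(''x'' := x, ''th'' := level_size d j, ''c'' := 0, ''f'' := 0)\<rparr>"
  have s1: "memory h s1" "stack ts s1" "reg s1 ''w'' = w" "reg s1 ''x'' = x" "reg s1 ''p'' = p"
      "reg s1 ''q'' = q" "reg s1 ''c'' = 0" "reg s1 ''f'' = 0" "reg s1 ''th'' = level_size d j"
      "reg s1 ''l'' = Suc j"
    using mem ts r k by (simp_all add: memory_def stack_def s1_def)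
  define Q where "Q t s' \<longleftrightarrow> (\<exists>X' h' new. main_inv col R (X', h', new @ ts) s' \<and>
    (\<exists>n. t \<le> 21 * n + 100 \<and> (\<Sum>t\<leftarrow>new. sz (fst t)) + max 2 n \<le> sz w))" for t :: nat and s' :: ram
  have final: "Q t s'"
    if "branch h w p q x j c k' n"
      "if c = p then ys = [] else next_tasks h w c p k' ys" "next_tasks h x c q k' zs"
      "memory (flip (flip (flip h w p c) w c q) x q c) s'" "stack (zs @ ys @ ts) s'"
      "t \<le> 21 * n + 100"
    for c k' n ys zs t s'
  proof -
    note step = rc_step[OF inv' x that(1,2,3)]
    obtain X' where X': "rc_inv col R X' (flip (flip (flip h w p c) w c q) x q c) (zs @ ys @ ts)"
      using step(1) by blast
    have "k' \<le> L" using that(1) L k by (auto simp: branch_def)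
    then have "\<forall>(w, p, q, k) \<in> set (zs @ ys). k \<le> L"
      using that(2,3) by (auto simp: next_tasks_def split: if_splits)
    then have "main_inv col R (X', flip (flip (flip h w p c) w c q) x q c, (zs @ ys) @ ts) s'"
      using X' that(4,5) L(2) unfolding main_inv_def by (simp add: ball_Un)
    then show ?thesis using that(6) step(2) unfolding Q_def by blast
  qed
  have flips: "exec flips_code s3
       (\<lambda>t s'. t = 42 \<and> memory (flip (flip (flip h w p c) w c q) x q c) s' \<and> stack us s')"
    if m3: "memory h s3" "stack us s3" and c: "c < d" and r3: "reg s3 ''w'' = w" "reg s3 ''x'' = x"
      "reg s3 ''p'' = p" "reg s3 ''q'' = q" "reg s3 ''c'' = c"
    for s3 us c
  proof -
    have v4: "valid (flip h w p c)" by (rule valid_flip[OF val lt(1) c])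
    have v5: "valid (flip (flip h w p c) w c q)" by (rule valid_flip[OF v4 c lt(2)])
    show ?thesis
      unfolding flips_code_def exec_Seq
    proof (rule exec_flip[OF m3(1) val r3(1) w(1) r3(3) lt(1) r3(5) c m3(2)], simp_all)
      fix s4 assume m4: "memory (flip h w p c) s4" "stack us s4" and "flip_frame s3 s4"
      then have r4: "reg s4 ''w'' = w" "reg s4 ''x'' = x" "reg s4 ''q'' = q" "reg s4 ''c'' = c"
        using r3 by (simp_all add: flip_frame_def)
      show "exec (flip_call ''w'' ''c'' ''q'') s4 (\<lambda>t1 s1. exec (flip_call ''x'' ''q'' ''c'') s1
         (\<lambda>t2 s2. t1 + t2 = 28 \<and> memory (flip (flip (flip h w p c) w c q) x q c) s2 \<and> stack us s2))"
      proof (rule exec_flip[OF m4(1) v4 r4(1) w(1) r4(4) c r4(3) lt(2) m4(2)], simp_all)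
        fix s5 assume m5: "memory (flip (flip h w p c) w c q) s5" "stack us s5" and "flip_frame s4 s5"
        then have r5: "reg s5 ''x'' = x" "reg s5 ''q'' = q" "reg s5 ''c'' = c"
          using r4 by (simp_all add: flip_frame_def)
        show "exec (flip_call ''x'' ''q'' ''c'') s5
           (\<lambda>t2 s2. t2 = 14 \<and> memory (flip (flip (flip h w p c) w c q) x q c) s2 \<and> stack us s2)"
          by (rule exec_flip[OF m5(1) v5 r5(1) xs(1) r5(2) lt(2) r5(3) c m5(2)]) simp_all
      qed
    qed
  qed
  have push1: "exec (If (neq (Reg ''c'') (Reg ''p'')) (push_code ''w'' ''p'') Skip) s3
      (\<lambda>t s4. t \<le> 8 \<and> push_frame s3 s4 \<and>
        (\<exists>ys. (if c = p then ys = [] else next_tasks h w c p k' ys) \<and> stack (ys @ ts) s4))"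
    if m3: "memory h s3" "stack ts s3" and c: "c < d" and r3: "reg s3 ''w'' = w" "reg s3 ''p'' = p"
      "reg s3 ''c'' = c" "reg s3 ''l'' = k'"
    for s3 c k'
  proof (cases "c = p")
    case True
    then show ?thesis using m3 r3 by (simp add: exec_simps push_frame_def)
  next
    case False
    have "exec (push_code ''w'' ''p'') s3 (\<lambda>t s'. Suc t \<le> 8 \<and> push_frame s3 s' \<and>
      (\<exists>ys. next_tasks h w c p k' ys \<and> stack (ys @ ts) s'))"
      by (rule exec_mono[OF exec_push_code[OF m3(1) r3(1) w(1) r3(3) c m3(2)]]) (use r3 in auto)
    then show ?thesis using False r3 by (simp add: exec_If)
  qed
  have rest: "exec finish_code s3 (\<lambda>t s'. Q (t0 + t) s')"
    if m3: "memory h s3" "stack ts s3" and r3: "reg s3 ''w'' = w" "reg s3 ''x'' = x" "reg s3 ''p'' = p"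
      "reg s3 ''q'' = q" "reg s3 ''c'' = c" "reg s3 ''l'' = k'"
      and ck: "branch h w p q x j c k' n"
      and t0: "t0 \<le> 21 * n + 30"
    for s3 c k' n t0
  proof -
    have c: "c < d" using ck lt by (auto simp: branch_def)
    show ?thesis
      unfolding finish_code_def exec_Seq
    proof (rule exec_mono[OF push1[OF m3 c r3(1,3,5,6)]], goal_cases post)
      case (post t1 s4)
      then obtain ys where t1: "t1 \<le> 8" and f4: "push_frame s3 s4"
        and ys: "if c = p then ys = [] else next_tasks h w c p k' ys" "stack (ys @ ts) s4"
        by blast
      have m4: "memory h s4" by (rule memory_cong[OF m3(1)]) (use f4 in \<open>auto simp: push_frame_def\<close>)
      have r4: "reg s4 ''w'' = w" "reg s4 ''x'' = x" "reg s4 ''p'' = p"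
        "reg s4 ''q'' = q" "reg s4 ''c'' = c" "reg s4 ''l'' = k'"
        using r3 f4 by (simp_all add: push_frame_def)
      show ?case
      proof (rule exec_mono[OF exec_push_code[OF m4 r4(2) xs(1) r4(5) c ys(2)]], simp, simp, goal_cases post)
        case (post t2 s5)
        then obtain zs where t2: "t2 \<le> 7" and f5: "push_frame s4 s5"
          and zs: "next_tasks h x c q k' zs" "stack (zs @ ys @ ts) s5"
          using r4 by auto
        have m5: "memory h s5" by (rule memory_cong[OF m4]) (use f5 in \<open>auto simp: push_frame_def\<close>)
        have r5: "reg s5 ''w'' = w" "reg s5 ''x'' = x" "reg s5 ''p'' = p"
          "reg s5 ''q'' = q" "reg s5 ''c'' = c"
          using r4 f5 by (simp_all add: push_frame_def)
        show ?case
          by (rule exec_mono[OF flips[OF m5 zs(2) c r5]], rule final[OF ck ys(1) zs(1)])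
            (use t0 t1 t2 in auto)
      qed
    qed
  qed
  have "exec used_code s Q"
    unfolding used_code_def exec_Seq
  proof -
    have "exec scan_code s1 (\<lambda>t2 s2. exec select_code s2 (\<lambda>t3 s3.
        exec finish_code s3
          (\<lambda>t4 s'. Q (5 + (t2 + (t3 + t4))) s')))"
    proof (rule exec_mono[OF exec_scan[OF s1(1) val w(1) xs(1) w(2) _ s1(3-9)]])
      show "h x (\<pi> x) = q" using xs by simp
      fix t2 :: nat and s2 :: ram
      assume "scan_frame s1 s2 \<and> (\<exists>c. reg s2 ''c'' = c \<and> t2 \<le> 21 * c + 22 \<and>
        (\<forall>c'<c. \<not> fits h w p q x j c') \<and> (c < d \<and> fits h w p q x j c \<or> c = d))"
      then obtain n where f2: "scan_frame s1 s2" and n: "reg s2 ''c'' = n" "t2 \<le> 21 * n + 22"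
        "\<forall>c'<n. \<not> fits h w p q x j c'" "n < d \<and> fits h w p q x j n \<or> n = d"
        by blast
      have m2: "memory h s2" by (rule memory_cong[OF s1(1)]) (use f2 in \<open>auto simp: scan_frame_def\<close>)
      have st2: "stack ts s2" by (rule stack_cong[OF s1(2)]) (use f2 in \<open>auto simp: scan_frame_def\<close>)
      have r2: "reg s2 ''w'' = w" "reg s2 ''x'' = x" "reg s2 ''p'' = p" "reg s2 ''q'' = q"
        "reg s2 ''l'' = Suc j" "reg s2 ''Delta'' = d"
        using f2 s1 m2 by (simp_all add: scan_frame_def memory_def)
      define s3 where "s3 = (if n < d then s2\<lparr>reg := (reg s2)(''l'' := j)\<rparr> else s2\<lparr>reg := (reg s2)(''c'' := p)\<rparr>)"
      have sel: "exec select_code s2 Q' \<longleftrightarrow> Q' 2 s3" for Q'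
        unfolding select_code_def by (simp add: exec_simps r2 n(1) s3_def numeral_2_eq_2)
      define c where "c = (if n < d then n else p)"
      define k' where "k' = (if n < d then j else Suc j)"
      have m3: "memory h s3" by (rule memory_cong[OF m2]) (auto simp: s3_def)
      have st3: "stack ts s3" by (rule stack_cong[OF st2]) (auto simp: s3_def)
      have r3: "reg s3 ''w'' = w" "reg s3 ''x'' = x" "reg s3 ''p'' = p" "reg s3 ''q'' = q"
        "reg s3 ''c'' = c" "reg s3 ''l'' = k'"
        using r2 n(1) by (simp_all add: s3_def c_def k'_def)
      show "exec select_code s2 (\<lambda>t3 s3.
        exec finish_code s3
          (\<lambda>t4 s'. Q (5 + (t2 + (t3 + t4))) s'))"
        unfolding sel
      proof (rule exec_mono[OF rest[OF m3 st3 r3, where n = n and ?t0.0 = "5 + (t2 + 2)"]])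
        show "branch h w p q x j c k' n"
          using n by (auto simp: branch_def c_def k'_def)
        show "5 + (t2 + 2) \<le> 21 * n + 30" using n by simp
      qed (simp add: add.assoc)
    qed
    then show "exec fetch_code s (\<lambda>t1 s1. exec scan_code s1 (\<lambda>t2 s2.
        exec select_code s2 (\<lambda>t3 s3.
        exec finish_code s3
          (\<lambda>t4 s'. Q (t1 + (t2 + (t3 + t4))) s'))))"
      by (simp add: fetch_code_def exec_simps r nx tau k slot_def s1_def cong: exec_weak_cong del: One_nat_def)
        (simp add: numeral_eq_Suc)
  qed
  then show ?thesis unfolding Q_def .
qed

text \<open>Each vertex that leaves the open tasks pays 200 units. If the chain goes on, at least
  \<open>max 2 n\<close> vertices leave, against a time of at most \<open>21 * n + 107\<close>; a
  task that ends at once still loses \<open>w\<close>, against 21 units.\<close>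

lemma exec_task_code:
  assumes inv: "main_inv col R (X, h, (w, p, q, k) # ts) s"
  shows "exec task_code s (\<lambda>t s'. \<exists>X' h' new. main_inv col R (X', h', new @ ts) s' \<and>
    200 * (\<Sum>t\<leftarrow>new. sz (fst t)) + t < 200 * sz w)"
proof -
  have rc: "rc_inv col R X h ((w, p, q, k) # ts)" and mem: "memory h s"
    and st: "stack ((w, p, q, k) # ts) s" and L: "k \<le> L" "\<forall>(w, p, q, k) \<in> set ts. k \<le> L"
    using inv by (auto simp: main_inv_def)
  note st' = stack_Cons[OF st]
  define s1 where "s1 = s\<lparr>reg := (reg s)(''top'' := length ts, ''w'' := w, ''p'' := p, ''q'' := q, ''l'' := k)\<rparr>"
  have m1: "memory h s1" using mem by (simp add: memory_def s1_def)
  have st1: "stack ts s1" using st' by (simp add: stack_def s1_def)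
  have r1: "reg s1 ''w'' = w" "reg s1 ''p'' = p" "reg s1 ''q'' = q" "reg s1 ''l'' = k"
    by (simp_all add: s1_def)
  have val: "valid h" and tok: "task_ok X h (w, p, q, k)" using rc by (auto simp: rc_inv_def)
  have w: "w \<in> T" using tok by (simp add: task_ok_def)
  then have rep: "rep d V nb h (arr s)" and wV: "w \<in> V" using mem T_V by (auto simp: memory_def)
  note lt = task_ok_lt[OF val tok]
  have used: "arr s ''pos'' (arr s ''row'' w + q) < arr s ''deg'' w \<longleftrightarrow> q \<in> h w ` nb w"
    using rep_used(1)[OF rep wV lt(2)] rep_row[OF rep wV] by simp
  define P where "P t s' \<longleftrightarrow> (\<exists>X' h' new. main_inv col R (X', h', new @ ts) s' \<and>
    200 * (\<Sum>t\<leftarrow>new. sz (fst t)) + t < 200 * sz w)" for t :: nat and s' :: ram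
  have start: "exec task_code s P \<longleftrightarrow>
      (if q \<in> h w ` nb w then exec used_code s1 (\<lambda>t. P (t + 7))
       else exec (flip_call ''w'' ''p'' ''q'') s1 (\<lambda>t. P (t + 7)))"
    unfolding task_code_def used[symmetric] s1_def
    using st'
    by (simp add: exec_simps slot_def cong: exec_weak_cong del: One_nat_def)
      (simp add: numeral_eq_Suc)
  have "exec task_code s P"
  proof (cases "q \<in> h w ` nb w")
    case True
    show ?thesis
      unfolding start if_P[OF True]
    proof (rule exec_mono[OF exec_used_code[OF rc m1 st1 r1 True L]], goal_cases post)
      case (post t s')
      then obtain X' h' new n where 1: "main_inv col R (X', h', new @ ts) s'"
          "t \<le> 21 * n + 100" "(\<Sum>t\<leftarrow>new. sz (fst t)) + max 2 n \<le> sz w"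
        by blast
      then have "200 * (\<Sum>t\<leftarrow>new. sz (fst t)) + (t + 7) < 200 * sz w" by (simp add: max_def split: if_splits)
      then show ?case using 1(1) unfolding P_def by blast
    qed
  next
    case False
    show ?thesis
      unfolding start if_not_P[OF False]
    proof (rule exec_flip[OF m1 val r1(1) w r1(2) lt(1) r1(3) lt(2) st1], simp_all)
      fix s' assume "memory (flip h w p q) s'" "stack ts s'"
      then have "main_inv col R (X, flip h w p q, [] @ ts) s'"
        using rc_step_free[OF rc False] L by (auto simp: main_inv_def)
      then show "P 21 s'" using sz_pos[OF w] unfolding P_def by fastforce
    qed
  qed
  then show ?thesis unfolding P_def .
qed

lemma exec_main_code:
  assumes "main_inv col R (X, h, ts) s"
  shows "exec main_code s (\<lambda>t s'. t \<le> 200 * (\<Sum>t\<leftarrow>ts. sz (fst t)) + 1 \<and>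
    (\<exists>X' h'. rc_inv col R X' h' [] \<and> rep d V nb h' (arr s')))"
proof -
  define pot where "pot = (\<lambda>(X :: nat set set, h :: nat \<Rightarrow> nat \<Rightarrow> nat, ts :: nat task list).
    200 * (\<Sum>t\<leftarrow>ts. sz (fst t)))"
  show ?thesis
    unfolding main_code_def
  proof (rule exec_While[where I = "main_inv col R" and pot = pot and g = "(X, h, ts)"])
    show "main_inv col R (X, h, ts) s" by (rule assms)
  next
    fix g and s' :: ram
    assume I: "main_inv col R g s'" and test: "eval_test (Less (Const 0) (Reg ''top'')) s'"
    obtain X h ts where g: "g = (X, h, ts)" by (cases g)
    have "ts \<noteq> []" using I test by (auto simp: g main_inv_def stack_def)
    then obtain w p q k ts' where ts: "ts = (w, p, q, k) # ts'" by (cases ts) auto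
    from exec_task_code[OF I[unfolded g ts]]
    show "exec task_code s' (\<lambda>t s''. \<exists>g'. main_inv col R g' s'' \<and> pot g' + t < pot g)"
    proof (rule exec_mono, goal_cases post)
      case (post t s'')
      then obtain X' h' new where "main_inv col R (X', h', new @ ts') s''"
          "200 * (\<Sum>t\<leftarrow>new. sz (fst t)) + t < 200 * sz w"
        by blast
      then show ?case
        by (intro exI[of _ "(X', h', new @ ts')"]) (simp add: pot_def g ts)
    qed
  next
    fix g t and s' :: ram
    assume *: "main_inv col R g s'" "\<not> eval_test (Less (Const 0) (Reg ''top'')) s'"
      "t + pot g \<le> Suc (pot (X, h, ts))"
    obtain X' h' ts' where "g = (X', h', ts')" by (cases g)
    note 1 = *[unfolded this]
    from 1(1,2) have "ts' = []" by (simp add: main_inv_def stack_def)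
    then show "t \<le> 200 * (\<Sum>t\<leftarrow>ts. sz (fst t)) + 1 \<and>
        (\<exists>X' h'. rc_inv col R X' h' [] \<and> rep d V nb h' (arr s'))"
      using 1 by (auto simp: pot_def main_inv_def memory_def)
  qed
qed

end

section \<open>The complete program\<close>

definition add_half :: "string \<Rightarrow> string \<Rightarrow> string \<Rightarrow> com" where
  "add_half w out c = block
    [SetReg c (Arr ''cols'' (Plus (Arr ''row'' (Reg w)) (Arr ''deg'' (Reg w)))),
     set_slot ''nbr'' w c (Reg out), SetArr ''deg'' (Reg w) (Plus (Arr ''deg'' (Reg w)) (Const 1))]"

definition race_code :: com where
  "race_code = While (both_pending (CHR ''1'') (CHR ''2'')) (Seq (bfs_step (CHR ''1'')) (bfs_step (CHR ''2'')))"

text \<open>If the search from \<open>u\<close> is still pending, the one from \<open>v\<close> has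
  ended, and \<open>v\<close> becomes the root. Then \<open>p\<close> is the colour of the new edge
  as the root sees it and \<open>q\<close> the colour at the other end.\<close>

definition orient_code :: com where
  "orient_code = If (Less (Reg ''1h'') (Reg ''1t''))
     (block [SetReg ''r'' (Reg ''v''), SetReg ''o'' (Reg ''u''),
       SetReg ''p'' (Reg ''b''), SetReg ''q'' (Reg ''a'')])
     (block [SetReg ''r'' (Reg ''u''), SetReg ''o'' (Reg ''v''),
       SetReg ''p'' (Reg ''a''), SetReg ''q'' (Reg ''b'')])"

definition choose_code :: com where
  "choose_code = Seq (bfs_init (CHR ''1'') ''u'' ''v'') (Seq (bfs_init (CHR ''2'') ''v'' ''u'')
    (Seq race_code orient_code))"

text \<open>The search of the chosen tree is repeated from scratch, so that the code that follows
  need not know which of the two searches was completed. This costs linear time once more.\<close>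

definition prepare_code :: com where
  "prepare_code = Seq (bfs_init (CHR ''1'') ''r'' ''o'') (Seq (bfs_loop (CHR ''1''))
    (Seq (size_code (CHR ''1'')) (level_code ''1t'')))"

definition root_code :: com where
  "root_code = If (neq (Reg ''p'') (Reg ''q''))
    (block [SetArr ''sw'' (Const 0) (Reg ''r''), SetArr ''sp'' (Const 0) (Reg ''p''),
      SetArr ''sq'' (Const 0) (Reg ''q''), SetArr ''sl'' (Const 0) (Reg ''l''),
      SetReg ''top'' (Const 1)])
    (SetReg ''top'' (Const 0))"

definition link_code :: com where
  "link_code = Seq (add_half ''u'' ''v'' ''a'') (Seq (add_half ''v'' ''u'' ''b'')
    (Seq choose_code (Seq prepare_code (Seq root_code main_code))))"

lemma exec_add_half:
  assumes "c \<noteq> w" "c \<noteq> out"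
  shows "exec (add_half w out c) s Q \<longleftrightarrow>
    (let x = reg s w; C = arr s ''cols'' (arr s ''row'' x + arr s ''deg'' x) in
     Q 4 (s\<lparr>reg := (reg s)(c := C),
       arr := (arr s)(''nbr'' := (arr s ''nbr'')(arr s ''row'' x + C := reg s out),
         ''deg'' := (arr s ''deg'')(x := arr s ''deg'' x + 1))\<rparr>))"
  using assms unfolding add_half_def set_slot_def
  by (simp add: exec_simps assms[symmetric] Let_def cong: exec_weak_cong del: One_nat_def)

abbreviation same_tables :: "(string \<Rightarrow> nat \<Rightarrow> nat) \<Rightarrow> ram \<Rightarrow> bool" where
  "same_tables A s \<equiv> \<forall>z \<in> {''row'', ''deg'', ''pos'', ''cols'', ''nbr''}. arr s z = A z"

locale link_ram = link d V E col u v for d V E col and u v :: nat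
begin

text \<open>The two halves of the new edge are inserted one after the other. In between, the
  neighbourhoods are not symmetric, which \<open>rep\<close> allows.\<close>

lemma exec_add_halves:
  assumes rep: "represents d V E col s" and r: "reg s ''u'' = u" "reg s ''v'' = v" "reg s ''Delta'' = d"
    and Q: "\<And>s' a b. free u a \<Longrightarrow> free v b \<Longrightarrow>
      rep d V (nbrs E') (H a b) (arr s') \<Longrightarrow>
      reg s' ''a'' = a \<Longrightarrow> reg s' ''b'' = b \<Longrightarrow> reg s' ''u'' = u \<Longrightarrow> reg s' ''v'' = v \<Longrightarrow>
      reg s' ''Delta'' = d \<Longrightarrow> Q 4 4 s'"
  shows "exec (add_half ''u'' ''v'' ''a'') s
    (\<lambda>t1 s1. exec (add_half ''v'' ''u'' ''b'') s1 (\<lambda>t2 s2. Q t1 t2 s2))"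
proof -
  define h where "h = (\<lambda>x y. col {x, y})"
  have rep0: "rep d V (nbrs E) h (arr s)"
    using rep represents_iff_rep[OF simple, of col h d s] by (simp add: h_def)
  have lt: "h x z < d" if "z \<in> nbrs E x" for x z using col_lt[OF that] by (simp add: h_def)
  have deg: "card (nbrs E u) < d" "card (nbrs E v) < d"
    using degree_less by (simp_all add: degree_eq_card_nbrs[OF simple])
  define a where "a = arr s ''cols'' (arr s ''row'' u + arr s ''deg'' u)"
  define A where "A = (arr s)(''nbr'' := (arr s ''nbr'')(arr s ''row'' u + a := v),
    ''deg'' := (arr s ''deg'')(u := arr s ''deg'' u + 1))"
  note add1 = rep_add[OF rep0 uv_V(1) nbrs_uv(1) finite_nbrs[OF simple] deg(1) lt lt a_def A_def]
  define nb1 where "nb1 = (nbrs E)(u := insert v (nbrs E u))"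
  define h1 where "h1 = h(u := (h u)(v := a))"
  have rep1: "rep d V nb1 h1 A" using add1(3) by (simp add: nb1_def h1_def)
  have nb1v: "nb1 v = nbrs E v" "h1 v = h v" using u_neq_v by (auto simp: nb1_def h1_def)
  have lt1: "h1 x z < d" if "z \<in> nb1 x" for x z
    using that lt add1(1) by (auto simp: nb1_def h1_def split: if_splits)
  define b where "b = A ''cols'' (A ''row'' v + A ''deg'' v)"
  define B where "B = A(''nbr'' := (A ''nbr'')(A ''row'' v + b := u),
    ''deg'' := (A ''deg'')(v := A ''deg'' v + 1))"
  have fin1: "u \<notin> nb1 v" "finite (nb1 v)" "card (nb1 v) < d"
    using nb1v nbrs_uv finite_nbrs[OF simple] deg by auto
  note add2 = rep_add[OF rep1 uv_V(2) fin1 lt1 lt1 b_def B_def]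
  have "nb1(v := insert u (nb1 v)) = nbrs E'"
    using u_neq_v by (auto simp: nb1_def nbrs_insert fun_eq_iff)
  moreover have "h1(v := (h1 v)(u := b)) = H a b"
    using u_neq_v by (auto simp: h1_def h_def half_coloring_def fun_eq_iff)
  ultimately have rep2: "rep d V (nbrs E') (H a b) B"
    using add2(3) by simp
  have "free u a" using add1(1,2) by (auto simp: free_def h_def image_iff)
  moreover have "free v b" using add2(1,2) nb1v by (auto simp: free_def h_def image_iff)
  moreover define s1 where "s1 = s\<lparr>reg := (reg s)(''a'' := a), arr := A\<rparr>"
  moreover define s2 where "s2 = s1\<lparr>reg := (reg s1)(''b'' := b), arr := B\<rparr>"
  ultimately have "Q 4 4 s2" using rep2 r by (intro Q) simp_all
  moreover have s1: "arr s1 = A" "reg s1 ''v'' = v" "reg s1 ''u'' = u" using r by (simp_all add: s1_def)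
  have "exec (add_half ''u'' ''v'' ''a'') s Q' \<longleftrightarrow> Q' 4 s1" for Q'
    by (simp add: exec_add_half r Let_def s1_def a_def A_def)
  moreover have "exec (add_half ''v'' ''u'' ''b'') s1 Q' \<longleftrightarrow> Q' 4 s2" for Q'
    by (simp add: exec_add_half s1 Let_def s2_def b_def B_def)
  ultimately show ?thesis by simp
qed

lemma table_nb_bij:
  assumes rep: "rep d V (nbrs E') (H a b) A"
    and ab: "free u a" "free v b" and x: "x \<in> V"
  shows "bij_betw (table_nb A x) {..<A ''deg'' x} (nbrs E' x)"
  using rep_table_nb[OF rep x] half_valid[OF ab] by blast

lemma bfs_ram_link:
  assumes rep: "rep d V (nbrs E') (H a b) A"
    and ab: "free u a" "free v b" and ro: "(r, out) = (u, v) \<or> (r, out) = (v, u)"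
  shows "bfs_ram V E r out A"
  unfolding bfs_ram_def
  by (rule bfs_tree_link[OF ro table_nb_bij[OF rep ab]])
    (use component_subset[OF simple root_cases(2)[OF ro]] in blast)

lemma exec_choose_code:
  assumes rep: "rep d V (nbrs E') (H a b) (arr s)"
    and ab: "free u a" "free v b"
    and rg: "reg s ''u'' = u" "reg s ''v'' = v" "reg s ''a'' = a" "reg s ''b'' = b"
  shows "exec choose_code s (\<lambda>t s'. \<exists>r out. ((r, out) = (u, v) \<or> (r, out) = (v, u)) \<and>
    card (component E r) \<le> card (component E out) \<and>
    t \<le> 75 * card (component E r) + 20 \<and> same_tables (arr s) s' \<and>
    reg s' ''r'' = r \<and> reg s' ''o'' = out \<and>
    reg s' ''p'' = H a b r out \<and> reg s' ''q'' = H a b out r \<and>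
    reg s' ''Delta'' = reg s ''Delta'')"
proof -
  have 1: "bfs_ram V E u v (arr s)" and 2: "bfs_ram V E v u (arr s)"
    by (rule bfs_ram_link[OF rep ab]; simp)+
  interpret u: bfs_ram V E u v "arr s" by (rule 1)
  interpret v: bfs_ram V E v u "arr s" by (rule 2)
  have hc: "H a b u v = a" "H a b v u = b"
    using u_neq_v by (auto simp: half_coloring_def)
  let ?\<pi> = "\<lambda>_. 0 :: nat"
  define P where "P t s' \<longleftrightarrow> (\<exists>r out. ((r, out) = (u, v) \<or> (r, out) = (v, u)) \<and>
    card (component E r) \<le> card (component E out) \<and>
    t \<le> 75 * card (component E r) + 20 \<and> same_tables (arr s) s' \<and>
    reg s' ''r'' = r \<and> reg s' ''o'' = out \<and>
    reg s' ''p'' = H a b r out \<and> reg s' ''q'' = H a b out r \<and>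
    reg s' ''Delta'' = reg s ''Delta'')"
    for t :: nat and s' :: ram
  show ?thesis
    unfolding choose_code_def exec_Seq P_def[symmetric]
  proof (rule exec_mono[OF exec_bfs_init[OF rg(1,2), of _ ?\<pi>]], goal_cases post)
    case (post t1 s1)
    note s1 = this
    have r1: "reg s1 ''v'' = v" "reg s1 ''u'' = u"
      using s1 rg by (simp_all add: bfs_frame_def)
    show ?case
    proof (rule exec_mono[OF exec_bfs_init[OF r1, of _ ?\<pi>]], goal_cases post)
      case (post t2 s2)
      note s2 = this
      have tab: "same_tables (arr s) s2" using s1 s2 by (simp add: bfs_frame_def)
      have "bfs_mem (CHR ''1'') [u] (?\<pi>(u := v)) 0 0 s2" using s1 s2 bfs_mem_frame by auto
      then have su: "u.searching (CHR ''1'') [u] (?\<pi>(u := v)) 0 0 s2"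
        by (intro u.searching_init) (use tab in auto)
      have sv: "v.searching (CHR ''2'') [v] (?\<pi>(v := u)) 0 0 s2"
        by (intro v.searching_init) (use s2 tab in auto)
      have r2: "reg s2 ''u'' = u" "reg s2 ''v'' = v" "reg s2 ''a'' = a" "reg s2 ''b'' = b"
        "reg s2 ''Delta'' = reg s ''Delta''"
        using s1 s2 rg by (simp_all add: bfs_frame_def)
      show ?case
      unfolding race_code_def
      proof (rule exec_mono[OF exec_race[OF 1 2 _ su sv]], simp, goal_cases post)
        case (post t3 s3)
        note s3 = this
        have r3: "reg s3 ''u'' = u" "reg s3 ''v'' = v" "reg s3 ''a'' = a" "reg s3 ''b'' = b"
          "reg s3 ''Delta'' = reg s ''Delta''"
          using s3 r2 by (simp_all add: race_frame_def)
        have tab3: "same_tables (arr s) s3" using s3 tab by (simp add: race_frame_def)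
        have t: "t1 = 6" "t2 = 6" using s1 s2 by auto
        note cmp = conjunct1[OF s3] conjunct2[OF conjunct2[OF s3]]
        show ?case
        proof (cases "reg s3 ''1h'' < reg s3 ''1t''")
          case True
          then have c: "card (component E v) \<le> card (component E u)"
            "t3 \<le> 75 * card (component E v) + 1" using cmp by auto
          have "exec orient_code s3
            (\<lambda>t s'. t = 6 \<and> arr s' = arr s3 \<and> reg s' ''r'' = v \<and> reg s' ''o'' = u \<and>
              reg s' ''p'' = b \<and> reg s' ''q'' = a \<and> reg s' ''Delta'' = reg s ''Delta'')"
            using True r3 by (simp add: orient_code_def exec_simps cong: exec_weak_cong del: One_nat_def)
          then show ?thesis
            unfolding P_def by (rule exec_mono) (rule exI[of _ v], rule exI[of _ u], use c t tab3 hc in simp)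
        next
          case False
          then have c: "card (component E u) \<le> card (component E v)"
            "t3 \<le> 75 * card (component E u) + 1" using cmp by auto
          have "exec orient_code s3
            (\<lambda>t s'. t = 6 \<and> arr s' = arr s3 \<and> reg s' ''r'' = u \<and> reg s' ''o'' = v \<and>
              reg s' ''p'' = a \<and> reg s' ''q'' = b \<and> reg s' ''Delta'' = reg s ''Delta'')"
            using False r3 by (simp add: orient_code_def exec_simps cong: exec_weak_cong del: One_nat_def)
          then show ?thesis
            unfolding P_def by (rule exec_mono) (rule exI[of _ u], rule exI[of _ v], use c t tab3 hc in simp)
        qed
      qed
    qed
  qed
qed

lemma exec_prepare_code:
  assumes rep: "rep d V (nbrs E') (H a b) (arr s)"
    and ab: "free u a" "free v b" and ro: "(r, out) = (u, v) \<or> (r, out) = (v, u)"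
    and rg: "reg s ''r'' = r" "reg s ''o'' = out" "reg s ''Delta'' = d"
    and n: "n = card (component E r)"
  shows "exec prepare_code s (\<lambda>t s'. t \<le> 70 * n + 50 \<and> same_tables (arr s) s' \<and>
    (\<forall>z \<in> {''r'', ''p'', ''q'', ''Delta''}. reg s' z = reg s z) \<and>
    reg s' ''l'' = least_level d n \<and> (\<forall>i < least_level d n. arr s' ''tau'' i = level_size d i) \<and>
    (\<exists>\<pi> ix sz. recolor_tree d (nbrs E') (component E r) \<pi> r out ix sz \<and>
      (\<forall>x \<in> component E r. arr s' ''size'' x = sz x)))"
proof -
  interpret bfs_ram V E r out "arr s" by (rule bfs_ram_link[OF rep ab ro])
  let ?\<pi> = "\<lambda>_. 0 :: nat"
  define P where "P t s' \<longleftrightarrow> t \<le> 70 * n + 50 \<and> same_tables (arr s) s' \<and>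
    (\<forall>z \<in> {''r'', ''p'', ''q'', ''Delta''}. reg s' z = reg s z) \<and>
    reg s' ''l'' = least_level d n \<and> (\<forall>i < least_level d n. arr s' ''tau'' i = level_size d i) \<and>
    (\<exists>\<pi> ix sz. recolor_tree d (nbrs E') (component E r) \<pi> r out ix sz \<and>
      (\<forall>x \<in> component E r. arr s' ''size'' x = sz x))"
    for t :: nat and s' :: ram
  show ?thesis
    unfolding prepare_code_def exec_Seq P_def[symmetric]
  proof (rule exec_mono[OF exec_bfs_init[OF rg(1,2), of _ ?\<pi>]], goal_cases post)
    case (post t1 s1)
    note s1 = this
    then have "same_tables (arr s) s1" by (simp add: bfs_frame_def)
    then have sr: "searching (CHR ''1'') [r] (?\<pi>(r := out)) 0 0 s1"
      by (intro searching_init) (use s1 in auto)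
    show ?case
    proof (rule exec_mono[OF exec_bfs_loop[OF sr]], goal_cases post)
      case (post t2 s2)
      then obtain Q \<pi> where t2: "t2 \<le> 13 * bfs_pot [r] (?\<pi>(r := out)) 0 0 + 1"
        and f2: "bfs_frame (CHR ''1'') s1 s2" and sr2: "searching (CHR ''1'') Q \<pi> (length Q) 0 s2"
        by blast
      have inv: "bfs_inv Q \<pi> (length Q) 0" and mem2: "bfs_mem (CHR ''1'') Q \<pi> (length Q) 0 s2"
        using sr2 by (auto simp: searching_def)
      obtain ix sz where rt: "recolor_tree d (nbrs E') (component E r) \<pi> r out ix sz"
        using bfs_recolor_tree[OF d3 inv] root_cases(1)[OF ro] by auto
      note sz = recolor_tree.sz[OF rt]
      have f: "bfs_frame (CHR ''1'') s s2" using s1 f2 bfs_frame_trans by blast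
      show ?case
      proof (rule exec_mono[OF exec_size_code[OF sr2 sz]], assumption, goal_cases post)
        case (post t3 s3)
        note s3 = this
        have D: "reg s3 ''Delta'' = d" using s3 f rg by (simp add: size_frame_def bfs_frame_def)
        have N: "reg s3 ''1t'' = n"
          using s3 mem2 bfs_finished(3)[OF inv] n by (simp add: size_frame_def bfs_mem_def)
        have n0: "0 < n" using card_T_pos n by simp
        show ?case
        proof (rule exec_mono[OF exec_level_code[OF d3 D N n0]], simp, goal_cases post)
          case (post t4 s4)
          note s4 = this
          have "t1 + (t2 + (t3 + t4)) \<le> 70 * n + 50"
            using s1 t2 s3 s4 bfs_pot_init[of "?\<pi>(r := out)"] n by simp
          moreover have "same_tables (arr s) s4"
            using s4 s3 f by (simp add: level_frame_def size_frame_def bfs_frame_def)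
          moreover have "\<forall>z \<in> {''r'', ''p'', ''q'', ''Delta''}. reg s4 z = reg s z"
            using s4 s3 f by (simp add: level_frame_def size_frame_def bfs_frame_def)
          moreover have "\<forall>x \<in> component E r. arr s4 ''size'' x = sz x"
            using s4 s3 by (simp add: level_frame_def)
          ultimately show ?case
            using s4 rt unfolding P_def by blast
        qed
      qed
    qed
  qed
qed

text \<open>The race compares vertices while \<open>smaller_size\<close> compares edges. As the
  chosen tree has no more vertices than the other one, either edge count bounds it.\<close>

lemma smaller_component:
  assumes "(r, out) = (u, v) \<or> (r, out) = (v, u)" "card (component E r) \<le> card (component E out)"
  shows "card (component E r) \<le> Suc (smaller_size E u v)"
proof -
  have "card (component E w) \<le> card (tree_edges E w) + 1" if w: "w \<in> {u, v}" for w
  proof -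
    define w' where "w' = (if w = u then v else u)"
    have ro: "(w, w') = (u, v) \<or> (w, w') = (v, u)" using w by (auto simp: w'_def)
    obtain nbf where nbf: "\<forall>x. bij_betw (nbf x) {..<card (nbrs E' x)}
        (nbrs E' x)"
      using neighbour_enum_exists by blast
    interpret bfs_tree V E w w' nbf "\<lambda>x. card (nbrs E' x)"
      by (rule bfs_tree_link[OF ro nbf[rule_format]])
    show ?thesis by (rule card_T_le)
  qed
  from this[of u] this[of v] show ?thesis using assms by (auto simp: smaller_size_def min_def)
qed

lemma exec_link_code:
  assumes rep: "represents d V E col s" and rg: "reg s ''u'' = u" "reg s ''v'' = v" "reg s ''Delta'' = d"
  shows "exec link_code s (\<lambda>t s'. t \<le> 1000 * (smaller_size E u v + 1) \<and>
    (\<exists>col'. proper_coloring d E' col' \<and>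
      recourse E col col' \<le> recourse_bound d (smaller_size E u v) \<and>
      represents d V E' col' s'))"
proof -
  define P where "P t s' \<longleftrightarrow> t \<le> 1000 * (smaller_size E u v + 1) \<and>
    (\<exists>col'. proper_coloring d E' col' \<and>
      recourse E col col' \<le> recourse_bound d (smaller_size E u v) \<and>
      represents d V E' col' s')" for t :: nat and s' :: ram
  have "exec link_code s P"
    unfolding link_code_def exec_Seq
  proof (rule exec_add_halves[OF rep rg])
    fix s1 :: ram and a b :: nat
    assume ab: "free u a" "free v b" and rep1: "rep d V (nbrs E') (H a b) (arr s1)"
      and r1: "reg s1 ''a'' = a" "reg s1 ''b'' = b" "reg s1 ''u'' = u" "reg s1 ''v'' = v" "reg s1 ''Delta'' = d"
    show "exec choose_code s1 (\<lambda>t3 s2. exec prepare_code s2 (\<lambda>t4 s3.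
      exec root_code s3 (\<lambda>t5 s4. exec main_code s4 (\<lambda>t6 s'. P (4 + (4 + (t3 + (t4 + (t5 + t6))))) s'))))"
    proof (rule exec_mono[OF exec_choose_code[OF rep1 ab r1(3,4,1,2)]])
      fix t3 :: nat and s2 :: ram
      let ?h = "H a b"
      assume "\<exists>r out. ((r, out) = (u, v) \<or> (r, out) = (v, u)) \<and>
        card (component E r) \<le> card (component E out) \<and>
        t3 \<le> 75 * card (component E r) + 20 \<and> same_tables (arr s1) s2 \<and>
        reg s2 ''r'' = r \<and> reg s2 ''o'' = out \<and> reg s2 ''p'' = ?h r out \<and> reg s2 ''q'' = ?h out r \<and>
        reg s2 ''Delta'' = reg s1 ''Delta''"
      then obtain r out where ro: "(r, out) = (u, v) \<or> (r, out) = (v, u)"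
        and small: "card (component E r) \<le> card (component E out)"
        and t3: "t3 \<le> 75 * card (component E r) + 20" and tab2: "same_tables (arr s1) s2"
        and r2: "reg s2 ''r'' = r" "reg s2 ''o'' = out" "reg s2 ''p'' = ?h r out" "reg s2 ''q'' = ?h out r"
          "reg s2 ''Delta'' = d"
        using r1(5) by blast
      define n where "n = card (component E r)"
      define k where "k = least_level d n"
      have rep2: "rep d V (nbrs E') ?h (arr s2)"
        by (rule rep_cong[OF rep1]) (rule bspec[OF tab2])
      have n: "n \<le> Suc (smaller_size E u v)" unfolding n_def by (rule smaller_component[OF ro small])
      show "exec prepare_code s2 (\<lambda>t4 s3. exec root_code s3 (\<lambda>t5 s4.
        exec main_code s4 (\<lambda>t6 s'. P (4 + (4 + (t3 + (t4 + (t5 + t6))))) s')))"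
      proof (rule exec_mono[OF exec_prepare_code[OF rep2 ab ro r2(1,2,5) n_def]], goal_cases post)
        case (post t4 s3)
        note s3 = this
        then obtain \<pi> ix sz where rt: "recolor_tree d (nbrs E') (component E r) \<pi> r out ix sz"
          and size: "\<forall>x \<in> component E r. arr s3 ''size'' x = sz x"
          by blast
        have tau: "\<forall>i < k. arr s3 ''tau'' i = level_size d i" using s3 by (simp add: k_def)
        have r3: "reg s3 ''r'' = r" "reg s3 ''p'' = ?h r out" "reg s3 ''q'' = ?h out r"
          "reg s3 ''Delta'' = d" "reg s3 ''l'' = k"
          using s3 r2 by (simp_all add: k_def)
        have rep3: "rep d V (nbrs E') ?h (arr s3)"
          by (rule rep_cong[OF rep2]) (rule bspec[OF conjunct1[OF conjunct2[OF s3]]])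
        have TV: "component E r \<subseteq> V" by (rule component_subset[OF simple root_cases(2)[OF ro]])
        interpret recolor_ram d "nbrs E'" "component E r" \<pi> r out ix sz V k
          by (intro recolor_ram.intro rt recolor_ram_axioms.intro TV)
        define ts where "ts = (if ?h r out = ?h out r then [] else [(r, ?h r out, ?h out r, k)])"
        have szr: "sz r = n" using sz_root by (simp add: n_def)
        \<comment> \<open>The program uses the level for the exact number \<open>n\<close> of
          vertices, whereas the bound is stated for \<open>Suc N\<close>; monotonicity bridges the
          two.\<close>
        have "least_level d n \<le> least_level d (Suc (smaller_size E u v))"
          using le_least_level[OF d3, of "Suc (smaller_size E u v)"] n
          by (intro least_level_le) simp
        then have R: "Suc (level_cost k) \<le> recourse_bound d (smaller_size E u v)"
          using monoD[OF level_cost_mono] by (simp add: recourse_bound_def k_def)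
        have "sz r \<le> level_size d k" using le_least_level[OF d3, of n] by (simp add: szr k_def)
        from rc_inv_init[OF rt ro ab refl refl this R]
        have rc: "rc_inv col (recourse_bound d (smaller_size E u v)) {{u, v}} ?h ts" by (simp add: ts_def)
        have root: "exec root_code s3 (\<lambda>t s'. t \<le> 7 \<and>
          main_inv col (recourse_bound d (smaller_size E u v)) ({{u, v}}, ?h, ts) s')"
        proof (cases "?h r out = ?h out r")
          case True
          have st: "stack [] (s3\<lparr>reg := (reg s3)(''top'' := 0)\<rparr>)" by (simp add: stack_def)
          show ?thesis
            using True rc rep3 size tau unfolding root_code_def
            by (simp add: exec_simps r3 cong: exec_weak_cong)
              (use st in \<open>simp add: main_inv_def memory_def ts_def r3\<close>)
        next
          case False
          show ?thesis
            using False rc rep3 size tau unfolding root_code_def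
            by (simp add: exec_simps r3 cong: exec_weak_cong)
              (simp add: main_inv_def memory_def ts_def stack_def r3)
        qed
        show ?case
        proof (rule exec_mono[OF root], goal_cases post)
          case (post t5 s4)
          note s4 = this
          show ?case
          proof (rule exec_mono[OF exec_main_code[OF conjunct2[OF s4]]], goal_cases post)
            case (post t6 s')
            then obtain X' h' where t6: "t6 \<le> 200 * (\<Sum>t\<leftarrow>ts. sz (fst t)) + 1"
              and rc': "rc_inv col (recourse_bound d (smaller_size E u v)) X' h' []"
              and rep': "rep d V (nbrs E') h' (arr s')"
              by blast
            obtain col' where col': "\<And>x y. {x, y} \<in> E' \<Longrightarrow> col' {x, y} = h' x y"
              "proper_coloring d E' col'"
              "recourse E col col' \<le> recourse_bound d (smaller_size E u v)"
              using rc_inv_final[OF rt rc'] by blast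
            have "represents d V E' col' s'"
              using represents_iff_rep[OF simple', of col' h' d s'] col'(1) rep' by simp
            moreover have "(\<Sum>t\<leftarrow>ts. sz (fst t)) \<le> n" by (simp add: ts_def szr)
            \<comment> \<open>Up to constants, choice, preparation and main loop take
              \<open>75 * n\<close>, \<open>70 * n\<close> and \<open>200 * n\<close> units, so 1000
              leaves ample room.\<close>
            then have "4 + (4 + (t3 + (t4 + (t5 + t6)))) \<le> 1000 * (smaller_size E u v + 1)"
              using t3 s3 s4 t6 n unfolding n_def[symmetric] by simp
            ultimately show ?case
              using col' unfolding P_def by blast
          qed
        qed
      qed
    qed
  qed
  then show ?thesis unfolding P_def .
qed

end

text \<open>One bound function serves both the existence of a recolouring for vertices of any type
  and the program for vertices that are numbers. The summand 1 in the time bound is for a tree that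
  consists of a single vertex.\<close>

theorem theorem3p2:
  shows "\<exists>(R :: nat \<Rightarrow> nat \<Rightarrow> nat) (C :: real).
    C > 0 \<and>
    (\<forall>\<Delta>\<ge>3. \<forall>\<^sub>F N in sequentially.
       real (R \<Delta> N) \<le>
         C * (1 / (real \<Delta> - 2) * sqrt (log 2 (real N)) * 2 powr sqrt (2 * log 2 (real N)))) \<and>
    (\<forall>\<Delta>\<ge>3. \<forall>(V :: 'a set) E col u v. link_instance \<Delta> V E col u v \<longrightarrow>
       (\<exists>col'. proper_coloring \<Delta> (insert {u, v} E) col' \<and>
               recourse E col col' \<le> R \<Delta> (smaller_size E u v))) \<and>
    (\<exists>(prog :: com) (K :: nat).
       \<forall>\<Delta>\<ge>3. \<forall>(V :: nat set) E col u v s.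
         link_instance \<Delta> V E col u v \<and> represents \<Delta> V E col s \<and>
         reg s ''Delta'' = \<Delta> \<and> reg s ''u'' = u \<and> reg s ''v'' = v \<longrightarrow>
         (\<exists>col' t s'. proper_coloring \<Delta> (insert {u, v} E) col' \<and>
               recourse E col col' \<le> R \<Delta> (smaller_size E u v) \<and>
               runs prog s t s' \<and> t \<le> K * (smaller_size E u v + 1) \<and>
               represents \<Delta> V (insert {u, v} E) col' s'))"
proof (intro exI[of _ recourse_bound] exI[of _ "72 :: real"] exI[of _ link_code] exI[of _ "1000 :: nat"]
    conjI allI impI)
  fix \<Delta> :: nat assume "3 \<le> \<Delta>"
  then show "\<forall>\<^sub>F N in sequentially. real (recourse_bound \<Delta> N) \<le>
      72 * (1 / (real \<Delta> - 2) * sqrt (log 2 (real N)) * 2 powr sqrt (2 * log 2 (real N)))"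
    by (rule recourse_bound_eventually)
next
  fix \<Delta> :: nat and V :: "'a set" and E col u v
  assume "3 \<le> \<Delta>" "link_instance \<Delta> V E col u v"
  then interpret link \<Delta> V E col u v by unfold_locales
  show "\<exists>col'. proper_coloring \<Delta> (insert {u, v} E) col' \<and>
      recourse E col col' \<le> recourse_bound \<Delta> (smaller_size E u v)"
    by (rule link_recolor)
next
  fix \<Delta> :: nat and V :: "nat set" and E col u v s
  assume "3 \<le> \<Delta>" and asm: "link_instance \<Delta> V E col u v \<and> represents \<Delta> V E col s \<and>
    reg s ''Delta'' = \<Delta> \<and> reg s ''u'' = u \<and> reg s ''v'' = v"
  then interpret link_ram \<Delta> V E col u v by unfold_locales auto
  show "\<exists>col' t s'. proper_coloring \<Delta> (insert {u, v} E) col' \<and>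
      recourse E col col' \<le> recourse_bound \<Delta> (smaller_size E u v) \<and>
      runs link_code s t s' \<and> t \<le> 1000 * (smaller_size E u v + 1) \<and>
      represents \<Delta> V (insert {u, v} E) col' s'"
    using exec_link_code[of s] asm unfolding exec_def by blast
qed simp

end
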